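(* Let $n\ge 2$, let $V$ be an $n$-dimensional $\mathbb{Q}$-vector space, $L\subset V$ a lattice of rank $n$ with fixed $\mathbb{Z}$-basis $e_1,\dots,e_n$, and $\Lambda=\mathrm{Hom}_{\mathbb{Z}}(L,\mathbb{Z})$ with dual basis $f_1,\dots,f_n$. Let $a_1,\dots,a_n\in\Lambda$ be $n$ linearly independent primitive elements and fix $v\in V/L$. 1. (Modular property) For $(w,x)$ in a dense open subset of $\mathbb{C}\times\mathrm{Hom}_{\mathbb{Z}}(L,\mathbb{C})\simeq\mathbb{C}\times\mathbb{C}^n$, $$\prod_{j=1}^{n} G_{n-2,a_1,\dots,\widehat{a_j},\dots,a_n}(v)(w,x)^{(-1)^{j+1}}=\exp\big(2i\pi\, B_{n,a_1,\dots,a_n}(v)(w,x)\big).$$ 2. (Equivariance) For every $g\in\mathrm{SL}_n(\mathbb{Z})$, $$G_{n-2,g\cdot a_1,\dots,g\cdot a_{n-1}}(g\cdot v)(w,g\cdot x)=G_{n-2,a_1,\dots,a_{n-1}}(v)(w,x),\qquad B_{n,g\cdot a_1,\dots,g\cdot a_n}(g\cdot v)(w,g\cdot x)=B_{n,a_1,\dots,a_n}(v)(w,x)$$ as functions of $(v,w,x)\in V/L\times\mathbb{C}\times\mathrm{Hom}_{\mathbb{Z}}(L,\mathbb{C})$ (wherever defined).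
   Context: Notation: $\widehat{a_j}$ means $a_j$ is omitted. $\det$ denotes the determinant with respect to the basis $f_1,\dots,f_n$ on $\Lambda$ (and with respect to $e_1,\dots,e_n$ on $L$); for $a_1,\dots,a_{n-1}\in\Lambda$, $\det(a_1,\dots,a_{n-1},\cdot)$ is a $\mathbb{Z}$-linear form on $\Lambda$, hence an element of $L=\mathrm{Hom}_{\mathbb{Z}}(\Lambda,\mathbb{Z})$. Elements $x\in\mathrm{Hom}_{\mathbb{Z}}(L,\mathbb{C})$ are extended linearly to $V$, so $x(\delta)$ makes sense for $\delta\in V$. A positive dual family to linearly independent $a_1,\dots,a_m\in\Lambda$ is a family $\alpha_1,\dots,\alpha_m\in L$ with $a_j(\alpha_j)>0$ and $a_k(\alpha_j)=0$ for $k\ne j$; when $m=n$ there is a unique such family consisting of primitive vectors (the primitive positive dual family). Nishizawa's functions: for $r\ge0$, $z\in\mathbb{C}$, $\tau_0,\dots,\tau_r$ in the upper half plane $\mathbb{H}$, $$G_r(z,\tau_0,\dots,\tau_r)=\prod_{m_0,\dots,m_r\ge0}\Big(1-e^{2i\pi(-z+\sum_j(m_j+1)\tau_j)}\Big)\Big(1-e^{2i\pi(z+\sum_j m_j\tau_j)}\Big)^{(-1)^r},$$ extended to $\tau_j\in\mathbb{C}\setminus\mathbb{R}$ by $G_r(z,\tau_0,\dots,-\tau_j,\dots,\tau_r)=G_r(z+\tau_j,\tau_0,\dots,\tau_j,\dots,\tau_r)^{-1}$. Geometric $G$ functions: for linearly independent primitive $b_1,\dots,b_{n-1}\in\Lambda$,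 write $\det(b_1,\dots,b_{n-1},\cdot)=s\gamma$ with $s\in\mathbb{Z}_{>0}$ and $\gamma\in L$ primitive; choose a positive dual family $\beta_1,\dots,\beta_{n-1}\in L$ to $b_1,\dots,b_{n-1}$, let $F=\{\delta\in v+L: 0\le b_j(\delta)<b_j(\beta_j)\ \forall j\}$ (stable under translation by $\mathbb{Z}\gamma$, with $F/\mathbb{Z}\gamma$ finite), and set $$G_{n-2,b_1,\dots,b_{n-1}}(v)(w,x)=\prod_{\delta\in F/\mathbb{Z}\gamma}G_{n-2}\Big(\tfrac{w+x(\delta)}{x(\gamma)},\tfrac{x(\beta_1)}{x(\gamma)},\dots,\tfrac{x(\beta_{n-1})}{x(\gamma)}\Big),$$ defined on a dense open set of $(w,x)$ and independent of the choice of $\beta$. Multiple Bernoulli polynomials: $B^*_{n,m}(z,\omega_1,\dots,\omega_n)$ are defined by $e^{zt}\prod_{j=1}^n\frac{\omega_jt}{e^{\omega_jt}-1}=\sum_{m\ge0}B^*_{n,m}(z,\omega)\frac{t^m}{m!}$. Geometric Bernoulli functions: for linearly independent $a_1,\dots,a_n\in\Lambda$ with primitive positive dual family $\alpha_1,\dots,\alpha_n$, let $\epsilon$ be the sign of $(-1)^n\det(a_1,\dots,a_n)$, $F(a,v)=\{\delta\in v+L:0\le a_j(\delta)<a_j(\alpha_j)\ \forall j\}$ (a finite set), and $$B_{n,a_1,\dots,a_n}(v)(w,x)=\Big(\prod_{j=1}^n x(\alpha_j)\Big)^{-1}\frac{\epsilon}{n!}\sum_{\delta\in F(a,v)}B^*_{n,n}\big(w+x(\delta),x(\alpha_1),\dots,x(\alpha_n)\big).$$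 Actions of $g\in\mathrm{SL}_n(\mathbb{Z})$: on $L$ (and $V$, $V/L$) by $g\cdot\alpha=g\alpha$ in coordinates w.r.t. $e_1,\dots,e_n$; on $\Lambda$ and on $\mathrm{Hom}_{\mathbb{Z}}(L,\mathbb{C})$ by $g\cdot a=ag^{-1}$ in coordinates w.r.t. $f_1,\dots,f_n$ (row vectors), so that $(g\cdot a)(g\cdot\alpha)=a(\alpha)$. *)

theory Defs
  imports "HOL-Analysis.Analysis" "HOL-Computational_Algebra.Formal_Power_Series"
    "Jordan_Normal_Form.Determinant"
begin

section \<open>Nishizawa's functions\<close>

(* The infinite product is the unconditional one, i.e. the limit of the finite subproducts.
   Since inverse 0 = 0, the value at a pole is 0 by convention. *)
definition nishizawa_upper :: "nat \<Rightarrow> complex \<Rightarrow> (nat \<Rightarrow> complex) \<Rightarrow> complex" where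
  "nishizawa_upper r z \<tau> =
     Lim (finite_subsets_at_top ({..r} \<rightarrow>\<^sub>E (UNIV :: nat set)))
       (\<lambda>M. \<Prod>m\<in>M.
          (1 - exp (2 * \<i> * of_real pi * (- z + (\<Sum>j\<le>r. (of_nat (m j) + 1) * \<tau> j)))) *
          (1 - exp (2 * \<i> * of_real pi * (z + (\<Sum>j\<le>r. of_nat (m j) * \<tau> j)))) powi ((-1) ^ r))"

(* Extension to non-real parameters: all parameters in the lower half-plane are reflected at once.
   The two lemmas below show that this is the extension determined by
   G(z, .., -\<tau>_j, ..) = 1 / G(z + \<tau>_j, .., \<tau>_j, ..). *)
definition nishizawa_G :: "nat \<Rightarrow> complex \<Rightarrow> (nat \<Rightarrow> complex) \<Rightarrow> complex" where
  "nishizawa_G r z \<tau> =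
     (let J = {j. j \<le> r \<and> Im (\<tau> j) < 0}
      in nishizawa_upper r (z + (\<Sum>j\<in>J. - \<tau> j)) (\<lambda>j. if j \<in> J then - \<tau> j else \<tau> j)
           powi ((-1) ^ card J))"

lemma nishizawa_G_upper:
  assumes "\<And>j. j \<le> r \<Longrightarrow> Im (\<tau> j) > 0"
  shows "nishizawa_G r z \<tau> = nishizawa_upper r z \<tau>"
proof -
  have "{j. j \<le> r \<and> Im (\<tau> j) < 0} = {}"
    using assms by force
  then show ?thesis
    unfolding nishizawa_G_def Let_def by (simp only:) simp
qed

lemma nishizawa_G_reflect:
  assumes "j \<le> r" "Im (\<tau> j) \<noteq> 0"
  shows "nishizawa_G r z (\<tau>(j := - \<tau> j)) = inverse (nishizawa_G r (z + \<tau> j) \<tau>)"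
proof -
  define J where "J = {k. k \<le> r \<and> Im (\<tau> k) < 0}"
  define J' where "J' = {k. k \<le> r \<and> Im ((\<tau>(j := - \<tau> j)) k) < 0}"
  have fin: "finite J" "finite J'"
    unfolding J_def J'_def by (auto intro: finite_subset[of _ "{..r}"])
  have fn: "(\<lambda>k. if k \<in> J' then - (\<tau>(j := - \<tau> j)) k else (\<tau>(j := - \<tau> j)) k)
      = (\<lambda>k. if k \<in> J then - \<tau> k else \<tau> k)"
    using assms by (auto simp: J_def J'_def fun_eq_iff)
  have "z + (\<Sum>k\<in>J'. - (\<tau>(j := - \<tau> j)) k) = z + \<tau> j + (\<Sum>k\<in>J. - \<tau> k)
      \<and> (-1 :: int) ^ card J' = - ((-1) ^ card J)"
  proof (cases "Im (\<tau> j) > 0")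
    case True
    then have *: "J' = insert j J" "j \<notin> J"
      using assms by (auto simp: J_def J'_def)
    have "(\<Sum>k\<in>J. - (\<tau>(j := - \<tau> j)) k) = (\<Sum>k\<in>J. - \<tau> k)"
      using * by (intro sum.cong) auto
    with * fin show ?thesis by simp
  next
    case False
    then have *: "J = insert j J'" "j \<notin> J'"
      using assms by (auto simp: J_def J'_def)
    have "(\<Sum>k\<in>J'. - (\<tau>(j := - \<tau> j)) k) = (\<Sum>k\<in>J'. - \<tau> k)"
      using * by (intro sum.cong) auto
    with * fin show ?thesis by simp
  qed
  moreover have "nishizawa_G r z (\<tau>(j := - \<tau> j)) =
      nishizawa_upper r (z + (\<Sum>k\<in>J'. - (\<tau>(j := - \<tau> j)) k))
        (\<lambda>k. if k \<in> J' then - (\<tau>(j := - \<tau> j)) k else (\<tau>(j := - \<tau> j)) k) powi ((-1) ^ card J')"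
    by (simp only: nishizawa_G_def Let_def J'_def)
  moreover have "nishizawa_G r (z + \<tau> j) \<tau> =
      nishizawa_upper r (z + \<tau> j + (\<Sum>k\<in>J. - \<tau> k))
        (\<lambda>k. if k \<in> J then - \<tau> k else \<tau> k) powi ((-1) ^ card J)"
    by (simp only: nishizawa_G_def Let_def J_def)
  ultimately show ?thesis
    by (simp only: fn power_int_minus)
qed

section \<open>Multiple Bernoulli polynomials\<close>

(* For nonzero parameters both series in each quotient have subdegree 1, so the quotient of
   formal power series is the genuine one. *)
definition multiple_bernoulli :: "nat \<Rightarrow> nat \<Rightarrow> complex \<Rightarrow> (nat \<Rightarrow> complex) \<Rightarrow> complex" where
  "multiple_bernoulli n m z \<omega> =
     fact m * fps_nth (fps_exp z * (\<Prod>j<n. fps_const (\<omega> j) * fps_X / (fps_exp (\<omega> j) - 1))) m"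

section \<open>Geometric families over a lattice\<close>

definition primitive_in :: "(rat \<Rightarrow> 'm \<Rightarrow> 'm) \<Rightarrow> 'm set \<Rightarrow> 'm \<Rightarrow> bool" where
  "primitive_in sc M u \<longleftrightarrow> u \<in> M \<and> (\<forall>(k::int). \<forall>u'\<in>M. u = sc (of_int k) u' \<longrightarrow> \<bar>k\<bar> = 1)"

definition omit :: "nat \<Rightarrow> (nat \<Rightarrow> 'b) \<Rightarrow> nat \<Rightarrow> 'b" where
  "omit j a i = (if i < j then a i else a (Suc i))"

(* All families of length m are indexed by {..<m}. Elements of Hom(L, Z) and Hom(L, C) are
   represented by their unique Q-linear extensions to V, and V/L is the set of cosets of L. *)
locale based_lattice = vector_space scale
  for scale :: "rat \<Rightarrow> 'v::ab_group_add \<Rightarrow> 'v" +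
  fixes n :: nat and e :: "nat \<Rightarrow> 'v"
  assumes inj_e: "inj_on e {..<n}"
    and independent_e: "independent (e ` {..<n})"
    and span_e: "span (e ` {..<n}) = UNIV"
begin

definition L :: "'v set" where
  "L = {\<Sum>i<n. scale (of_int (c i)) (e i) | c :: nat \<Rightarrow> int. True}"

definition V_mod_L :: "'v set set" where
  "V_mod_L = range (\<lambda>u. (+) u ` L)"

definition dual_lattice :: "('v \<Rightarrow> rat) set" where
  "dual_lattice = {a. Vector_Spaces.linear scale (*) a \<and> a ` L \<subseteq> \<int>}"

definition HomC :: "('v \<Rightarrow> complex) set" where
  "HomC = {x. Vector_Spaces.linear scale (\<lambda>r z. of_rat r * z) x}"

definition HomC_topology :: "('v \<Rightarrow> complex) topology" where
  "HomC_topology =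
     pullback_topology HomC (\<lambda>x. \<lambda>i\<in>{..<n}. x (e i)) (product_topology (\<lambda>_. euclidean) {..<n})"

definition primitive_L :: "'v \<Rightarrow> bool" where
  "primitive_L = primitive_in scale L"

definition primitive_dual :: "('v \<Rightarrow> rat) \<Rightarrow> bool" where
  "primitive_dual = primitive_in (\<lambda>r a u. r * a u) dual_lattice"

definition lin_indep_forms :: "nat \<Rightarrow> (nat \<Rightarrow> 'v \<Rightarrow> rat) \<Rightarrow> bool" where
  "lin_indep_forms m a \<longleftrightarrow>
     (\<forall>c :: nat \<Rightarrow> int. (\<forall>u\<in>L. (\<Sum>i<m. of_int (c i) * a i u) = 0) \<longrightarrow> (\<forall>i<m. c i = 0))"

definition det_forms :: "(nat \<Rightarrow> 'v \<Rightarrow> rat) \<Rightarrow> rat" where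
  "det_forms a = Determinant.det (mat n n (\<lambda>(i, j). a i (e j)))"

definition pos_dual_family :: "nat \<Rightarrow> (nat \<Rightarrow> 'v \<Rightarrow> rat) \<Rightarrow> (nat \<Rightarrow> 'v) \<Rightarrow> bool" where
  "pos_dual_family m a \<alpha> \<longleftrightarrow> \<alpha> \<in> {..<m} \<rightarrow>\<^sub>E L \<and>
     (\<forall>j<m. a j (\<alpha> j) > 0 \<and> (\<forall>k<m. k \<noteq> j \<longrightarrow> a k (\<alpha> j) = 0))"

subsection \<open>Geometric G functions\<close>

definition normal_vector :: "(nat \<Rightarrow> 'v \<Rightarrow> rat) \<Rightarrow> 'v" where
  "normal_vector b = (THE \<gamma>. primitive_L \<gamma> \<and>
     (\<exists>s::int. s > 0 \<and> (\<forall>y\<in>dual_lattice. det_forms (b(n - 1 := y)) = of_int s * y \<gamma>)))"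

definition chosen_dual :: "(nat \<Rightarrow> 'v \<Rightarrow> rat) \<Rightarrow> nat \<Rightarrow> 'v" where
  "chosen_dual b = (SOME \<beta>. pos_dual_family (n - 1) b \<beta>)"

definition G_region :: "(nat \<Rightarrow> 'v \<Rightarrow> rat) \<Rightarrow> 'v set \<Rightarrow> 'v set" where
  "G_region b v = {\<delta> \<in> v. \<forall>j<n-1. 0 \<le> b j \<delta> \<and> b j \<delta> < b j (chosen_dual b j)}"

definition translation_rel :: "'v \<Rightarrow> ('v \<times> 'v) set" where
  "translation_rel \<gamma> = {(\<delta>, \<delta>'). \<exists>k::int. \<delta>' = \<delta> + scale (of_int k) \<gamma>}"

(* The factor attached to a class does not depend on the representative, because nishizawa_G has
   period 1 in its first argument. *)
definition geom_G :: "(nat \<Rightarrow> 'v \<Rightarrow> rat) \<Rightarrow> 'v set \<Rightarrow> complex \<Rightarrow> ('v \<Rightarrow> complex) \<Rightarrow> complex" where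
  "geom_G b v w x =
     (let \<gamma> = normal_vector b; \<beta> = chosen_dual b in
      \<Prod>D \<in> G_region b v // translation_rel \<gamma>.
        nishizawa_G (n - 2) ((w + x (SOME \<delta>. \<delta> \<in> D)) / x \<gamma>) (\<lambda>j. x (\<beta> j) / x \<gamma>))"

(* Where the defining product makes sense, as a meromorphic function of w (with value 0 at poles). *)
definition geom_G_defined :: "(nat \<Rightarrow> 'v \<Rightarrow> rat) \<Rightarrow> ('v \<Rightarrow> complex) \<Rightarrow> bool" where
  "geom_G_defined b x \<longleftrightarrow> x (normal_vector b) \<noteq> 0 \<and>
     (\<forall>j<n-1. x (chosen_dual b j) / x (normal_vector b) \<notin> \<real>)"

subsection \<open>Geometric Bernoulli functions\<close>

definition primitive_pos_dual :: "(nat \<Rightarrow> 'v \<Rightarrow> rat) \<Rightarrow> nat \<Rightarrow> 'v" where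
  "primitive_pos_dual a = (THE \<alpha>. pos_dual_family n a \<alpha> \<and> (\<forall>j<n. primitive_L (\<alpha> j)))"

definition B_region :: "(nat \<Rightarrow> 'v \<Rightarrow> rat) \<Rightarrow> 'v set \<Rightarrow> 'v set" where
  "B_region a v = {\<delta> \<in> v. \<forall>j<n. 0 \<le> a j \<delta> \<and> a j \<delta> < a j (primitive_pos_dual a j)}"

definition geom_B :: "(nat \<Rightarrow> 'v \<Rightarrow> rat) \<Rightarrow> 'v set \<Rightarrow> complex \<Rightarrow> ('v \<Rightarrow> complex) \<Rightarrow> complex" where
  "geom_B a v w x =
     (let \<alpha> = primitive_pos_dual a in
      inverse (\<Prod>j<n. x (\<alpha> j)) * (of_rat (sgn ((-1) ^ n * det_forms a)) / fact n) *
      (\<Sum>\<delta> \<in> B_region a v. multiple_bernoulli n n (w + x \<delta>) (\<lambda>j. x (\<alpha> j))))"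

definition geom_B_defined :: "(nat \<Rightarrow> 'v \<Rightarrow> rat) \<Rightarrow> ('v \<Rightarrow> complex) \<Rightarrow> bool" where
  "geom_B_defined a x \<longleftrightarrow> (\<forall>j<n. x (primitive_pos_dual a j) \<noteq> 0)"

subsection \<open>Action of the special linear group over the integers\<close>

definition SL :: "int mat set" where
  "SL = {g \<in> carrier_mat n n. Determinant.det g = 1}"

definition mat_inv :: "int mat \<Rightarrow> int mat" where
  "mat_inv g = (THE h. h \<in> carrier_mat n n \<and> inverts_mat g h \<and> inverts_mat h g)"

definition coord :: "'v \<Rightarrow> nat \<Rightarrow> rat" where
  "coord u i = representation (e ` {..<n}) u (e i)"

definition act_vec :: "int mat \<Rightarrow> 'v \<Rightarrow> 'v" where
  "act_vec g u = (\<Sum>i<n. scale (\<Sum>j<n. of_int (g $$ (i, j)) * coord u j) (e i))"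

definition act_coset :: "int mat \<Rightarrow> 'v set \<Rightarrow> 'v set" where
  "act_coset g v = act_vec g ` v"

(* Right multiplication of the row vector (a(e_0), ..., a(e_(n-1))) by the inverse of g; used both
   for rational- and for complex-valued forms. *)
definition act_form :: "int mat \<Rightarrow> ('v \<Rightarrow> 'k) \<Rightarrow> 'v \<Rightarrow> 'k::field_char_0" where
  "act_form g a u =
     (\<Sum>j<n. (\<Sum>i<n. a (e i) * of_int (mat_inv g $$ (i, j))) * of_rat (coord u j))"

end

end

theory Submission
  imports Defs "HOL-Complex_Analysis.Conformal_Mappings"
    "HOL-Computational_Algebra.Fundamental_Theorem_Algebra"
begin

text \<open>
  On a cone, all factors of the modular product are Nishizawa functions of the same
  \<open>z = w + x \<delta>\<close> and \<open>\<omega>\<^sub>k = x \<alpha>\<^sub>k\<close>, with \<open>\<alpha>\<close> the primitive positive dual family: the normal vector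
  of the family without \<open>a\<^sub>j\<close> is \<open>\<plusminus>\<alpha>\<^sub>j\<close>, and the finite set of the Bernoulli function represents the
  classes of every factor. So the modular property reduces to the statement that
  \<open>\<Phi>(z) = \<Prod>\<^sub>k G(z/\<omega>\<^sub>k, \<omega>\<^sub>j/\<omega>\<^sub>k) \<cdot> exp (2 \<pi> \<i> B(z, \<omega>))\<close> is 1.

  By induction on the number of parameters \<open>\<Phi>\<close> has all \<open>\<omega>\<^sub>j\<close> as periods, since a shift by \<open>\<omega>\<^sub>j\<close>
  multiplies it by the product without \<open>\<omega>\<^sub>j\<close>. For two parameters the zeros of the two theta factors
  cancel and Liouville's theorem makes \<open>\<Phi>\<close> constant; for three or more parameters, generic periods
  accumulate at 0 and the identity theorem applies, while nongeneric parameters follow by continuity.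
  The constant \<open>c\<close> is 1: the distribution relations and homogeneity give \<open>c = c\<^sup>m\<close> with \<open>m = N\<^sup>n\<close> for
  every \<open>N \<ge> 1\<close>, which forces \<open>c = 1\<close>.

  The geometric functions do not depend on the dual family, because two dual vectors of the same
  form agree up to positive multiples and multiples of \<open>\<gamma>\<close>, and \<open>G\<close> satisfies a distribution relation
  and has period 1 in each modulus. Equivariance is then transport along the action.
\<close>


section \<open>Unconditional infinite products\<close>

text \<open>Since \<open>inverse 0 = 0\<close>, poles also take the value 0, and equations such as
  the shift are available only where nothing vanishes. The first safe region is the complement of
  the integer span of the \<omega>'s; for three or more parameters this span may accumulate, so its
  complement need not be open. Constancy and the value 1 are therefore proved off the span first,
  and then extended by limits to the open set where no factor vanishes, which also gives the domain
  of the modular property its shape.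

  The induction starts from G without parameters, which is \<open>- e2pi (- z)\<close>; for a single
  \<omega> the Bernoulli factor is its inverse. Two parameters need their own argument because their
  periods are discrete.

  The relation for c comes from stretching the \<omega>'s by N one after the other: \<Phi> becomes a
  product of N^n values of the \<Phi> for N\<omega>, all at points off the span, and homogeneity
  identifies the constant for N\<omega> with c. The intermediate families are stretched unevenly, so
  constancy has to be known for all families \<open>M j * \<omega> j\<close> with positive integers
  \<open>M j\<close>.\<close>

definition has_uprod :: "('i \<Rightarrow> complex) \<Rightarrow> 'i set \<Rightarrow> complex \<Rightarrow> bool" where
  "has_uprod f S p \<longleftrightarrow> (prod f \<longlongrightarrow> p) (finite_subsets_at_top S)"

lemma has_uprod_Lim: "has_uprod f S p \<Longrightarrow> Lim (finite_subsets_at_top S) (prod f) = p"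
  unfolding has_uprod_def by (intro tendsto_Lim) auto

lemma has_uprod_unique: "has_uprod f S p \<Longrightarrow> has_uprod f S q \<Longrightarrow> p = q"
  using has_uprod_Lim by metis

lemma has_uprod_mult:
  "has_uprod f S p \<Longrightarrow> has_uprod g S q \<Longrightarrow> has_uprod (\<lambda>i. f i * g i) S (p * q)"
  unfolding has_uprod_def prod.distrib by (rule tendsto_mult)

lemma has_uprod_prod:
  "(\<And>k. k \<in> K \<Longrightarrow> has_uprod (f k) S (p k)) \<Longrightarrow> has_uprod (\<lambda>i. \<Prod>k\<in>K. f k i) S (\<Prod>k\<in>K. p k)"
proof (induction K rule: infinite_finite_induct)
  case (insert k K)
  then show ?case by (simp add: has_uprod_mult)
qed (simp_all add: has_uprod_def prod.neutral_const[abs_def])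

lemma has_uprod_inverse:
  assumes "has_uprod f S p" "p \<noteq> 0"
  shows "has_uprod (\<lambda>i. inverse (f i)) S (inverse p)"
proof -
  have "(\<lambda>M. inverse (prod f M)) = prod (\<lambda>i. inverse (f i))"
    by (simp add: fun_eq_iff prod_inversef[symmetric] o_def)
  with assms show ?thesis
    unfolding has_uprod_def using tendsto_inverse by metis
qed

lemma has_uprod_zero:
  assumes "i \<in> S" "f i = 0"
  shows "has_uprod f S 0"
proof -
  have "eventually (\<lambda>M. prod f M = 0) (finite_subsets_at_top S)"
    using assms by (auto simp: eventually_finite_subsets_at_top intro!: exI[of _ "{i}"])
  then show ?thesis unfolding has_uprod_def by (rule tendsto_eventually)
qed

lemma has_uprod_finite: "finite S \<Longrightarrow> has_uprod f S (prod f S)"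
  unfolding has_uprod_def by (simp add: finite_subsets_at_top_finite tendsto_principal_singleton)

lemma has_uprod_reindex:
  assumes "bij_betw h S T"
  shows "has_uprod (\<lambda>i. f (h i)) S p \<longleftrightarrow> has_uprod f T p"
proof -
  have T: "T = h ` S" and inj: "inj_on h S"
    using assms by (auto simp: bij_betw_def)
  have "has_uprod f T p \<longleftrightarrow> ((\<lambda>F. prod f (h ` F)) \<longlongrightarrow> p) (finite_subsets_at_top S)"
    unfolding has_uprod_def T
    by (metis inj filterlim_filtermap filtermap_image_finite_subsets_at_top)
  also have "\<dots> \<longleftrightarrow> has_uprod (\<lambda>i. f (h i)) S p"
    unfolding has_uprod_def
  proof (intro tendsto_cong eventually_finite_subsets_at_top_weakI)
    fix X assume "finite X" "X \<subseteq> S"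
    then show "prod f (h ` X) = (\<Prod>i\<in>X. f (h i))"
      using inj by (subst prod.reindex) (auto intro: inj_on_subset simp: o_def)
  qed
  finally show ?thesis ..
qed

lemma filterlim_Int_finite_subsets_at_top:
  "A \<subseteq> C \<Longrightarrow> filterlim (\<lambda>M. M \<inter> A) (finite_subsets_at_top A) (finite_subsets_at_top C)"
  unfolding filterlim_iff
  by (clarsimp simp: eventually_finite_subsets_at_top)
     (metis Int_lower2 finite_Int inf.bounded_iff order_trans)

lemma has_uprod_Un_disjoint:
  assumes "has_uprod f A p" "has_uprod f B q" "A \<inter> B = {}"
  shows "has_uprod f (A \<union> B) (p * q)"
proof -
  let ?F = "finite_subsets_at_top (A \<union> B)"
  have "((\<lambda>M. prod f (M \<inter> A)) \<longlongrightarrow> p) ?F" "((\<lambda>M. prod f (M \<inter> B)) \<longlongrightarrow> q) ?F"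
    using assms unfolding has_uprod_def
    by (auto intro: filterlim_compose[OF _ filterlim_Int_finite_subsets_at_top])
  then have "((\<lambda>M. prod f (M \<inter> A) * prod f (M \<inter> B)) \<longlongrightarrow> p * q) ?F"
    by (rule tendsto_mult)
  moreover have "eventually (\<lambda>M. prod f (M \<inter> A) * prod f (M \<inter> B) = prod f M) ?F"
  proof (rule eventually_finite_subsets_at_top_weakI)
    fix M assume M: "finite M" "M \<subseteq> A \<union> B"
    then have "M = (M \<inter> A) \<union> (M \<inter> B)" "(M \<inter> A) \<inter> (M \<inter> B) = {}"
      using assms(3) by auto
    with M show "prod f (M \<inter> A) * prod f (M \<inter> B) = prod f M"
      by (metis finite_Int prod.union_disjoint)
  qed
  ultimately show ?thesis
    unfolding has_uprod_def by (rule Lim_transform_eventually)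
qed

lemma has_uprod_UN_disjoint:
  assumes "finite K" "\<And>k. k \<in> K \<Longrightarrow> has_uprod f (A k) (p k)"
    "\<And>k l. k \<in> K \<Longrightarrow> l \<in> K \<Longrightarrow> k \<noteq> l \<Longrightarrow> A k \<inter> A l = {}"
  shows "has_uprod f (\<Union>k\<in>K. A k) (\<Prod>k\<in>K. p k)"
  using assms
proof (induction K rule: finite_induct)
  case empty
  then show ?case using has_uprod_finite[of "{}"] by simp
next
  case (insert k K)
  have "has_uprod f (A k \<union> (\<Union>l\<in>K. A l)) (p k * (\<Prod>l\<in>K. p l))"
    using insert by (intro has_uprod_Un_disjoint insert.IH) blast+
  then show ?case using insert.hyps by simp
qed

section \<open>Convergence of products dominated by a summable family\<close>

lemma norm_prod_minus1_le_exp: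
  fixes f :: "'i \<Rightarrow> complex"
  assumes "\<And>i. i \<in> M \<Longrightarrow> norm (f i) \<le> B i"
  shows "norm ((\<Prod>i\<in>M. 1 + f i) - 1) \<le> exp (\<Sum>i\<in>M. B i) - 1"
  using assms
proof (induction M rule: infinite_finite_induct)
  case (insert x M)
  let ?P = "\<Prod>i\<in>M. 1 + f i" and ?S = "\<Sum>i\<in>M. B i"
  have IH: "norm (?P - 1) \<le> exp ?S - 1" and Bx: "norm (f x) \<le> B x"
    using insert by auto
  have "(\<Prod>i\<in>insert x M. 1 + f i) - 1 = (1 + f x) * (?P - 1) + f x"
    using insert.hyps by (simp add: algebra_simps)
  also have "norm \<dots> \<le> norm (1 + f x) * norm (?P - 1) + norm (f x)"
    by (metis norm_mult norm_triangle_ineq)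
  also have "norm (1 + f x) \<le> 1 + B x"
    using norm_triangle_ineq[of 1 "f x"] Bx by simp
  also have "(1 + B x) * norm (?P - 1) + norm (f x) \<le> (1 + B x) * (exp ?S - 1) + B x"
    using IH Bx norm_ge_zero[of "f x"] by (intro add_mono mult_left_mono) linarith+
  also have "\<dots> = (1 + B x) * exp ?S - 1" by (simp add: algebra_simps)
  also have "(1 + B x) * exp ?S \<le> exp (B x) * exp ?S"
    by (intro mult_right_mono exp_ge_add_one_self) simp
  finally have "norm ((\<Prod>i\<in>insert x M. 1 + f i) - 1) \<le> exp (B x) * exp ?S - 1"
    by (simp add: mult_right_mono)
  then show ?case
    using insert.hyps by (simp add: exp_add)
qed auto

lemma summable_on_tail_small:
  fixes B :: "'i \<Rightarrow> real"
  assumes "B summable_on S" "\<And>i. i \<in> S \<Longrightarrow> B i \<ge> 0" "d > 0"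
  obtains M0 where "finite M0" "M0 \<subseteq> S"
    "\<And>M. finite M \<Longrightarrow> M \<subseteq> S - M0 \<Longrightarrow> sum B M < d"
proof -
  have "(sum B \<longlongrightarrow> infsum B S) (finite_subsets_at_top S)"
    using assms(1) has_sum_infsum unfolding has_sum_def by blast
  then have "eventually (\<lambda>M. dist (sum B M) (infsum B S) < d) (finite_subsets_at_top S)"
    using assms(3) by (rule tendstoD)
  then obtain M0 where M0: "finite M0" "M0 \<subseteq> S"
    and *: "\<And>M. finite M \<Longrightarrow> M0 \<subseteq> M \<Longrightarrow> M \<subseteq> S \<Longrightarrow> dist (sum B M) (infsum B S) < d"
    unfolding eventually_finite_subsets_at_top by (elim exE conjE) (rule that; auto)
  show ?thesis
  proof
    fix M assume M: "finite M" "M \<subseteq> S - M0"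
    have "sum B (M \<union> M0) \<le> infsum B S"
      using assms M M0 by (intro finite_sum_le_infsum) auto
    moreover have "sum B (M \<union> M0) = sum B M + sum B M0"
      using M M0 by (intro sum.union_disjoint) auto
    moreover have "dist (sum B M0) (infsum B S) < d" using * M0 by auto
    ultimately show "sum B M < d" unfolding dist_real_def by linarith
  qed (use M0 in auto)
qed

text \<open>The error is measured relative to the finite product over M0. Beyond a Cauchy estimate,
  this prevents a product of nonzero factors from converging to 0. One M0 serves all t.\<close>

lemma uprod_tail_estimate:
  fixes f :: "'i \<Rightarrow> 't \<Rightarrow> complex"
  assumes "B summable_on S" "\<And>i t. i \<in> S \<Longrightarrow> t \<in> X \<Longrightarrow> norm (f i t) \<le> B i"
    "\<And>i. i \<in> S \<Longrightarrow> B i \<ge> 0" "e > 0"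
  obtains M0 where "finite M0" "M0 \<subseteq> S"
    "\<And>M t. finite M \<Longrightarrow> M0 \<subseteq> M \<Longrightarrow> M \<subseteq> S \<Longrightarrow> t \<in> X \<Longrightarrow>
      norm ((\<Prod>i\<in>M. 1 + f i t) - (\<Prod>i\<in>M0. 1 + f i t)) \<le> e * norm (\<Prod>i\<in>M0. 1 + f i t)"
proof -
  \<comment> \<open>The threshold is chosen so that a tail sum below \<open>ln (1 + e)\<close> keeps
    the tail product within e of 1.\<close>
  obtain M0 where M0: "finite M0" "M0 \<subseteq> S"
    "\<And>M. finite M \<Longrightarrow> M \<subseteq> S - M0 \<Longrightarrow> sum B M < ln (1 + e)"
    using summable_on_tail_small[of B S "ln (1 + e)"] assms ln_gt_zero[of "1 + e"] by auto
  show ?thesis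
  proof
    fix M t assume M: "finite M" "M0 \<subseteq> M" "M \<subseteq> S" "t \<in> X"
    let ?P = "\<lambda>M. \<Prod>i\<in>M. 1 + f i t"
    have "?P M = ?P M0 * ?P (M - M0)"
      using M by (metis mult.commute prod.subset_diff)
    then have "?P M - ?P M0 = (?P (M - M0) - 1) * ?P M0" by (simp add: algebra_simps)
    then have "norm (?P M - ?P M0) = norm (?P (M - M0) - 1) * norm (?P M0)"
      by (simp only: norm_mult)
    also have "norm (?P (M - M0) - 1) \<le> exp (sum B (M - M0)) - 1"
      using M assms(2) by (intro norm_prod_minus1_le_exp) auto
    also have "sum B (M - M0) < ln (1 + e)" using M by (intro M0(3)) auto
    then have "exp (sum B (M - M0)) - 1 \<le> exp (ln (1 + e)) - 1" by simp
    also have "\<dots> = e" using assms(4) by simp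
    finally show "norm (?P M - ?P M0) \<le> e * norm (?P M0)" by (simp add: mult_right_mono)
  qed (use M0 in auto)
qed

text \<open>All finite subproducts are bounded by \<open>exp (infsum B S)\<close>, uniformly in t,
  so the relative estimate with \<open>e / C\<close> becomes an absolute one.\<close>

lemma uprod_uniformly_Cauchy:
  fixes f :: "'i \<Rightarrow> 't \<Rightarrow> complex"
  assumes "B summable_on S" "\<And>i t. i \<in> S \<Longrightarrow> t \<in> X \<Longrightarrow> norm (f i t) \<le> B i"
    "\<And>i. i \<in> S \<Longrightarrow> B i \<ge> 0" "e > 0"
  obtains M0 where "finite M0" "M0 \<subseteq> S"
    "\<And>M t. finite M \<Longrightarrow> M0 \<subseteq> M \<Longrightarrow> M \<subseteq> S \<Longrightarrow> t \<in> X \<Longrightarrow>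
      norm ((\<Prod>i\<in>M. 1 + f i t) - (\<Prod>i\<in>M0. 1 + f i t)) \<le> e"
proof -
  define C where "C = exp (infsum B S)"
  have C: "C > 0" by (simp add: C_def)
  obtain M0 where M0: "finite M0" "M0 \<subseteq> S"
    "\<And>M t. finite M \<Longrightarrow> M0 \<subseteq> M \<Longrightarrow> M \<subseteq> S \<Longrightarrow> t \<in> X \<Longrightarrow>
       norm ((\<Prod>i\<in>M. 1 + f i t) - (\<Prod>i\<in>M0. 1 + f i t)) \<le> e / C * norm (\<Prod>i\<in>M0. 1 + f i t)"
    using uprod_tail_estimate[of B S X f "e / C"] assms C by (auto simp: divide_simps)
  have "norm (\<Prod>i\<in>M0. 1 + f i t) \<le> C" if "t \<in> X" for t
  proof -
    have "norm (\<Prod>i\<in>M0. 1 + f i t) \<le> (\<Prod>i\<in>M0. exp (B i))"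
      unfolding prod_norm[symmetric]
    proof (intro prod_mono conjI)
      fix i assume "i \<in> M0"
      then have "norm (f i t) \<le> B i" using assms M0 that by auto
      then show "norm (1 + f i t) \<le> exp (B i)"
        using norm_triangle_ineq[of 1 "f i t"] exp_ge_add_one_self[of "B i"] unfolding norm_one by linarith
    qed auto
    also have "\<dots> = exp (sum B M0)" using M0 by (simp add: exp_sum)
    also have "\<dots> \<le> C" unfolding C_def exp_le_cancel_iff
      using M0 assms by (intro finite_sum_le_infsum) auto
    finally show ?thesis .
  qed
  then have le: "e / C * norm (\<Prod>i\<in>M0. 1 + f i t) \<le> e" if "t \<in> X" for t
    using mult_left_mono[of "norm (\<Prod>i\<in>M0. 1 + f i t)" C "e / C"] assms(4) C that by simp
  show ?thesis
  proof
    show "norm ((\<Prod>i\<in>M. 1 + f i t) - (\<Prod>i\<in>M0. 1 + f i t)) \<le> e"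
      if "finite M" "M0 \<subseteq> M" "M \<subseteq> S" "t \<in> X" for M t
      using M0(3)[OF that] le[OF that(4)] by (rule order_trans)
  qed (use M0 in auto)
qed

lemma has_uprod_summable:
  fixes f :: "'i \<Rightarrow> complex"
  assumes "B summable_on S" "\<And>i. i \<in> S \<Longrightarrow> norm (f i) \<le> B i"
  shows "has_uprod (\<lambda>i. 1 + f i) S (Lim (finite_subsets_at_top S) (prod (\<lambda>i. 1 + f i)))"
proof -
  let ?F = "finite_subsets_at_top S" and ?P = "prod (\<lambda>i. 1 + f i)"
  have B0: "B i \<ge> 0" if "i \<in> S" for i using assms(2)[OF that] norm_ge_zero order_trans by blast
  have "cauchy_filter (filtermap ?P ?F)"
    unfolding cauchy_filter_metric_filtermap
  proof (intro allI impI)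
    fix e :: real assume e: "e > 0"
    obtain M0 where M0: "finite M0" "M0 \<subseteq> S"
      "\<And>M. finite M \<Longrightarrow> M0 \<subseteq> M \<Longrightarrow> M \<subseteq> S \<Longrightarrow> norm (?P M - ?P M0) \<le> e / 3"
      using uprod_uniformly_Cauchy[of B S UNIV "\<lambda>i _. f i" "e / 3"] assms B0 e by auto
    show "\<exists>P. eventually P ?F \<and> (\<forall>x y. P x \<and> P y \<longrightarrow> dist (?P x) (?P y) < e)"
    proof (intro exI conjI allI impI)
      show "eventually (\<lambda>M. finite M \<and> M0 \<subseteq> M \<and> M \<subseteq> S) ?F"
        using M0 by (auto simp: eventually_finite_subsets_at_top)
      fix M M' assume "(finite M \<and> M0 \<subseteq> M \<and> M \<subseteq> S) \<and> (finite M' \<and> M0 \<subseteq> M' \<and> M' \<subseteq> S)"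
      then have "norm (?P M - ?P M0) \<le> e / 3" "norm (?P M' - ?P M0) \<le> e / 3"
        using M0(3)[of M] M0(3)[of M'] by auto
      then show "dist (?P M) (?P M') < e"
        using e norm_triangle_ineq4[of "?P M - ?P M0" "?P M' - ?P M0"]
        by (simp add: dist_norm)
    qed
  qed
  then obtain c where "filtermap ?P ?F \<le> nhds c"
    using cauchy_filter_complete_converges[of "filtermap ?P ?F" UNIV] complete_UNIV
    by (auto simp: filtermap_bot_iff)
  then have "has_uprod (\<lambda>i. 1 + f i) S c"
    unfolding has_uprod_def filterlim_def .
  then show ?thesis using has_uprod_Lim by metis
qed

lemma uniform_limit_uprod:
  fixes f :: "'i \<Rightarrow> 't \<Rightarrow> complex"
  assumes "B summable_on S" "\<And>i t. i \<in> S \<Longrightarrow> t \<in> X \<Longrightarrow> norm (f i t) \<le> B i"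
    "\<And>i. i \<in> S \<Longrightarrow> B i \<ge> 0"
    "\<And>t. t \<in> X \<Longrightarrow> has_uprod (\<lambda>i. 1 + f i t) S (p t)"
  shows "uniform_limit X (\<lambda>M t. \<Prod>i\<in>M. 1 + f i t) p (finite_subsets_at_top S)"
proof (rule uniform_limitI)
  fix e :: real assume e: "e > 0"
  let ?F = "finite_subsets_at_top S"
  obtain M0 where M0: "finite M0" "M0 \<subseteq> S"
    "\<And>M t. finite M \<Longrightarrow> M0 \<subseteq> M \<Longrightarrow> M \<subseteq> S \<Longrightarrow> t \<in> X \<Longrightarrow>
       norm ((\<Prod>i\<in>M. 1 + f i t) - (\<Prod>i\<in>M0. 1 + f i t)) \<le> e / 3"
    using uprod_uniformly_Cauchy[of B S X f "e / 3"] assms(1-3) e by (auto simp: divide_simps)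
  have lim: "norm (p t - (\<Prod>i\<in>M0. 1 + f i t)) \<le> e / 3" if "t \<in> X" for t
  proof (rule tendsto_upperbound)
    show "((\<lambda>M. norm ((\<Prod>i\<in>M. 1 + f i t) - (\<Prod>i\<in>M0. 1 + f i t))) \<longlongrightarrow>
        norm (p t - (\<Prod>i\<in>M0. 1 + f i t))) ?F"
      using assms(4)[OF that] unfolding has_uprod_def by (intro tendsto_intros)
    show "eventually (\<lambda>M. norm ((\<Prod>i\<in>M. 1 + f i t) - (\<Prod>i\<in>M0. 1 + f i t)) \<le> e / 3) ?F"
      using M0 that by (auto simp: eventually_finite_subsets_at_top intro!: exI[of _ M0])
  qed auto
  have "\<forall>t\<in>X. dist (\<Prod>i\<in>M. 1 + f i t) (p t) < e" if "finite M" "M0 \<subseteq> M" "M \<subseteq> S" for M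
  proof
    fix t assume t: "t \<in> X"
    have "norm ((\<Prod>i\<in>M. 1 + f i t) - p t) \<le>
      norm ((\<Prod>i\<in>M. 1 + f i t) - (\<Prod>i\<in>M0. 1 + f i t)) + norm (p t - (\<Prod>i\<in>M0. 1 + f i t))"
      by norm
    then show "dist (\<Prod>i\<in>M. 1 + f i t) (p t) < e"
      unfolding dist_norm using M0(3)[OF that t] lim[OF t] e by linarith
  qed
  then show "\<forall>\<^sub>F M in ?F. \<forall>t\<in>X. dist (\<Prod>i\<in>M. 1 + f i t) (p t) < e"
    using M0 by (auto simp: eventually_finite_subsets_at_top intro!: exI[of _ M0])
qed

text \<open>The relative tail estimate with e = 1/2 survives in the limit: p = 0 would force the
  product over M0 to vanish, a finite product of nonzero factors.\<close>

lemma has_uprod_nonzero: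
  fixes f :: "'i \<Rightarrow> complex"
  assumes "B summable_on S" "\<And>i. i \<in> S \<Longrightarrow> norm (f i) \<le> B i"
    "has_uprod (\<lambda>i. 1 + f i) S p" "\<And>i. i \<in> S \<Longrightarrow> 1 + f i \<noteq> 0"
  shows "p \<noteq> 0"
proof
  let ?P = "prod (\<lambda>i. 1 + f i)"
  assume p: "p = 0"
  have B0: "B i \<ge> 0" if "i \<in> S" for i using assms(2)[OF that] norm_ge_zero order_trans by blast
  obtain M0 where M0: "finite M0" "M0 \<subseteq> S"
    "\<And>M. finite M \<Longrightarrow> M0 \<subseteq> M \<Longrightarrow> M \<subseteq> S \<Longrightarrow> norm (?P M - ?P M0) \<le> 1/2 * norm (?P M0)"
    using uprod_tail_estimate[of B S UNIV "\<lambda>i _. f i" "1/2"] assms B0 by auto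
  have "norm (p - ?P M0) \<le> 1/2 * norm (?P M0)"
  proof (rule tendsto_upperbound)
    show "((\<lambda>M. norm (?P M - ?P M0)) \<longlongrightarrow> norm (p - ?P M0)) (finite_subsets_at_top S)"
      using assms(3) unfolding has_uprod_def by (intro tendsto_intros)
    show "eventually (\<lambda>M. norm (?P M - ?P M0) \<le> 1/2 * norm (?P M0)) (finite_subsets_at_top S)"
      using M0 by (auto simp: eventually_finite_subsets_at_top intro!: exI[of _ M0])
  qed auto
  then have "?P M0 = 0" using p by simp
  then show False using M0 assms(4) by auto
qed

section \<open>Multiple q-Pochhammer products\<close>

definition e2pi :: "complex \<Rightarrow> complex" where
  "e2pi z = exp (2 * \<i> * of_real pi * z)"

lemma e2pi_add: "e2pi (x + y) = e2pi x * e2pi y"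
  by (simp add: e2pi_def exp_add algebra_simps)

lemma e2pi_0 [simp]: "e2pi 0 = 1"
  by (simp add: e2pi_def)

lemma e2pi_of_int [simp]: "e2pi (of_int k) = 1"
  unfolding e2pi_def using exp_2pi_1_int[of k] by (simp add: algebra_simps)

lemma e2pi_minus: "e2pi (- z) = inverse (e2pi z)"
  by (simp add: e2pi_def exp_minus)

lemma e2pi_nonzero [simp]: "e2pi z \<noteq> 0"
  by (simp add: e2pi_def)

lemma e2pi_add_Ints: "k \<in> \<int> \<Longrightarrow> e2pi (z + k) = e2pi z"
  by (elim Ints_cases) (simp add: e2pi_add)

lemma norm_e2pi: "norm (e2pi z) = exp (- 2 * pi * Im z)"
  by (simp add: e2pi_def norm_exp_eq_Re)

lemma e2pi_eq_1_iff: "e2pi z = 1 \<longleftrightarrow> z \<in> \<int>"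
proof
  assume "e2pi z = 1"
  then obtain n :: int where "Im z = 0" "2 * pi * Re z = of_int (2 * n) * pi"
    unfolding e2pi_def exp_eq_1 by auto
  then have "z = of_int n" by (auto simp: complex_eq_iff)
  then show "z \<in> \<int>" by simp
qed (auto elim!: Ints_cases)

text \<open>Factorization of X^N - 1 over the N-th roots of unity, evaluated at 1 / X for X =
  \<open>e2pi (y / N)\<close> and multiplied by X^N.\<close>

lemma prod_one_minus_e2pi:
  assumes "N > 0"
  shows "(\<Prod>i<N. 1 - e2pi ((y + of_nat i) / of_nat N)) = 1 - e2pi y"
proof -
  define X where "X = e2pi (y / of_nat N)"
  have X0: "X \<noteq> 0" by (simp add: X_def)
  have XN: "X ^ N = e2pi y"
    using assms unfolding X_def e2pi_def exp_of_nat_mult[symmetric] by (simp add: field_simps)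
  have cis: "cis (2 * pi * real k / real N) = e2pi (of_nat k / of_nat N)" for k
    unfolding e2pi_def cis_conv_exp by (simp add: mult_ac)
  define p :: "complex poly" where "p = monom 1 N - 1"
  have pd: "pderiv p = monom (of_nat N) (N - 1)"
    by (simp add: p_def pderiv_diff pderiv_monom)
  \<comment> \<open>The derivative N X^(N - 1) can vanish only at 0, which is not a root of p; so
    every root of unity occurs exactly once.\<close>
  have rs: "rsquarefree p"
    unfolding rsquarefree_roots pd using assms by (auto simp: p_def poly_monom zero_power)
  have deg: "degree p = N"
    unfolding p_def diff_conv_add_uminus using assms
    by (subst degree_add_eq_left) (auto simp: degree_monom_eq)
  have "coeff p N = 1" using assms by (simp add: p_def)
  then have lc: "lead_coeff p = 1" using deg by simp
  have "p = (\<Prod>z | poly p z = 0. [:-z, 1:])"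
    using complex_poly_decompose_rsquarefree[OF rs] lc by simp
  then have "poly p (inverse X) = poly (\<Prod>z | poly p z = 0. [:-z, 1:]) (inverse X)" by simp
  also have "{z. poly p z = 0} = {z. z ^ N = 1}" by (simp add: p_def poly_monom)
  also have "poly (\<Prod>z\<in>{z. z ^ N = 1}. [:-z, 1:]) (inverse X) = (\<Prod>z\<in>{z. z ^ N = 1}. inverse X - z)"
    by (simp add: poly_prod)
  also have "\<dots> = (\<Prod>i<N. inverse X - e2pi (of_nat i / of_nat N))"
    using prod.reindex_bij_betw[OF Complex.bij_betw_roots_unity[OF assms], of "\<lambda>z. inverse X - z"]
    by (simp only: cis)
  finally have "inverse X ^ N - 1 = (\<Prod>i<N. inverse X - e2pi (of_nat i / of_nat N))"
    by (simp add: p_def poly_monom)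
  then have "X ^ N * (inverse X ^ N - 1) = (\<Prod>i<N. X * (inverse X - e2pi (of_nat i / of_nat N)))"
    by (simp add: prod.distrib)
  moreover have "X ^ N * (inverse X ^ N - 1) = 1 - X ^ N"
    using X0 by (simp add: algebra_simps flip: power_mult_distrib)
  moreover have "X * (inverse X - e2pi (of_nat i / of_nat N)) = 1 - e2pi ((y + of_nat i) / of_nat N)" for i
    using X0 unfolding X_def by (simp add: algebra_simps add_divide_distrib e2pi_add)
  ultimately show ?thesis using XN by simp
qed

text \<open>The multiple q-Pochhammer symbol in the variable \<open>e2pi z\<close> with bases
  \<open>e2pi (\<tau> j)\<close>. An arbitrary index set allows a single parameter to be
  deleted.\<close>

definition qpoch :: "'i set \<Rightarrow> ('i \<Rightarrow> complex) \<Rightarrow> complex \<Rightarrow> complex" where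
  "qpoch I \<tau> z = Lim (finite_subsets_at_top (I \<rightarrow>\<^sub>E (UNIV :: nat set)))
     (prod (\<lambda>m. 1 - e2pi (z + (\<Sum>j\<in>I. of_nat (m j) * \<tau> j))))"

definition upper :: "'i set \<Rightarrow> ('i \<Rightarrow> complex) \<Rightarrow> bool" where
  "upper I \<tau> \<longleftrightarrow> finite I \<and> (\<forall>j\<in>I. Im (\<tau> j) > 0)"

text \<open>A finite set of exponents lies in a box; over the box the sum is a product of geometric
  sums, each at most \<open>1 / (1 - q)\<close>.\<close>

lemma summable_on_prod_power_PiE:
  assumes "finite I" "0 \<le> q" "q < (1::real)" "c \<ge> 0"
  shows "(\<lambda>m. c * (\<Prod>j\<in>I. q ^ m j)) summable_on (I \<rightarrow>\<^sub>E (UNIV :: nat set))"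
proof (rule nonneg_bdd_above_summable_on)
  show "bdd_above (sum (\<lambda>m. c * (\<Prod>j\<in>I. q ^ m j)) ` {F. F \<subseteq> I \<rightarrow>\<^sub>E UNIV \<and> finite F})"
  proof (rule bdd_aboveI2)
    fix F :: "('a \<Rightarrow> nat) set" assume "F \<in> {F. F \<subseteq> I \<rightarrow>\<^sub>E UNIV \<and> finite F}"
    then have F: "F \<subseteq> I \<rightarrow>\<^sub>E UNIV" "finite F" by auto
    define K where "K = Max ((\<lambda>m. \<Sum>j\<in>I. m j) ` F)"
    have "F \<subseteq> I \<rightarrow>\<^sub>E {..K}"
    proof
      fix m assume m: "m \<in> F"
      have "m j \<le> K" if "j \<in> I" for j
      proof -
        have "m j \<le> (\<Sum>j\<in>I. m j)" using assms(1) that by (intro member_le_sum) auto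
        also have "\<dots> \<le> K" unfolding K_def using F m by (intro Max_ge) auto
        finally show ?thesis .
      qed
      then show "m \<in> I \<rightarrow>\<^sub>E {..K}" using F m by (auto simp: PiE_iff)
    qed
    then have "sum (\<lambda>m. \<Prod>j\<in>I. q ^ m j) F \<le> sum (\<lambda>m. \<Prod>j\<in>I. q ^ m j) (I \<rightarrow>\<^sub>E {..K})"
      using assms by (intro sum_mono2 finite_PiE prod_nonneg) auto
    also have "\<dots> = (\<Prod>j\<in>I. \<Sum>k\<le>K. q ^ k)"
      using assms by (subst prod_sum_PiE) auto
    also have "\<dots> \<le> (\<Prod>j\<in>I. 1 / (1 - q))"
    proof (intro prod_mono conjI sum_nonneg)
      have "(\<Sum>k\<le>K. q ^ k) = (1 - q ^ Suc K) / (1 - q)"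
        using sum_gp0[of q K] assms by auto
      also have "\<dots> \<le> 1 / (1 - q)" using assms by (intro divide_right_mono) auto
      finally show "(\<Sum>k\<le>K. q ^ k) \<le> 1 / (1 - q)" .
    qed (use assms in auto)
    finally show "sum (\<lambda>m. c * (\<Prod>j\<in>I. q ^ m j)) F \<le> c * (\<Prod>j\<in>I. 1 / (1 - q))"
      using assms by (simp add: sum_distrib_left[symmetric] mult_left_mono)
  qed
qed (use assms in \<open>auto intro!: mult_nonneg_nonneg prod_nonneg\<close>)

text \<open>A majorant that knows z and \<tau> only through lower bounds for imaginary parts, so
  that one summable family serves a whole region of parameters.\<close>

lemma norm_e2pi_lattice_le:
  assumes "finite I" "\<And>j. j \<in> I \<Longrightarrow> Im (\<tau> j) \<ge> d" "Im z \<ge> - R"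
  shows "norm (- e2pi (z + (\<Sum>j\<in>I. of_nat (m j) * \<tau> j)))
    \<le> exp (2 * pi * R) * (\<Prod>j\<in>I. exp (- 2 * pi * d) ^ m j)"
proof -
  have "norm (- e2pi (z + (\<Sum>j\<in>I. of_nat (m j) * \<tau> j)))
      = exp (- 2 * pi * (Im z + (\<Sum>j\<in>I. real (m j) * Im (\<tau> j))))"
    by (simp add: norm_e2pi)
  also have "\<dots> \<le> exp (- 2 * pi * (- R + (\<Sum>j\<in>I. real (m j) * d)))"
    unfolding exp_le_cancel_iff using assms
    by (intro mult_left_mono_neg add_mono sum_mono mult_left_mono) auto
  also have "\<dots> = exp (2 * pi * R) * exp (\<Sum>j\<in>I. real (m j) * (- 2 * pi * d))"
    unfolding exp_add[symmetric] by (simp add: algebra_simps sum_distrib_left sum_negf)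
  also have "exp (\<Sum>j\<in>I. real (m j) * (- 2 * pi * d)) = (\<Prod>j\<in>I. exp (- 2 * pi * d) ^ m j)"
    using assms(1) by (subst exp_sum) (auto simp only: exp_of_nat_mult)
  finally show ?thesis .
qed

lemma upper_bound:
  assumes "upper I \<tau>"
  obtains d where "d > 0" "\<And>j. j \<in> I \<Longrightarrow> d \<le> Im (\<tau> j)"
proof
  let ?d = "Min (insert 1 ((\<lambda>j. Im (\<tau> j)) ` I))"
  show "?d > 0" "\<And>j. j \<in> I \<Longrightarrow> ?d \<le> Im (\<tau> j)"
    using assms by (auto simp: upper_def)
qed

lemma qpoch_bound_summable:
  assumes "finite I" "d > 0"
  shows "(\<lambda>m. exp (2 * pi * R) * (\<Prod>j\<in>I. exp (- 2 * pi * d) ^ m j)) summable_on (I \<rightarrow>\<^sub>E (UNIV :: nat set))"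
  using assms by (intro summable_on_prod_power_PiE) auto

lemma has_uprod_qpoch:
  assumes "upper I \<tau>"
  shows "has_uprod (\<lambda>m. 1 - e2pi (z + (\<Sum>j\<in>I. of_nat (m j) * \<tau> j))) (I \<rightarrow>\<^sub>E UNIV) (qpoch I \<tau> z)"
proof -
  obtain d where d: "d > 0" "\<And>j. j \<in> I \<Longrightarrow> d \<le> Im (\<tau> j)" using upper_bound[OF assms] by blast
  have I: "finite I" using assms by (simp add: upper_def)
  show ?thesis
    using has_uprod_summable[OF qpoch_bound_summable[OF I d(1), where R = "- Im z"],
        of "\<lambda>m. - e2pi (z + (\<Sum>j\<in>I. of_nat (m j) * \<tau> j))"]
      norm_e2pi_lattice_le[OF I d(2), where R = "- Im z" and z = z]
    unfolding qpoch_def by (simp only: minus_minus order.refl add_uminus_conv_diff)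
qed

lemma qpoch_eqI:
  assumes "upper I \<tau>"
    "has_uprod (\<lambda>m. 1 - e2pi (z + (\<Sum>j\<in>I. of_nat (m j) * \<tau> j))) (I \<rightarrow>\<^sub>E UNIV) p"
  shows "qpoch I \<tau> z = p"
  using has_uprod_unique[OF has_uprod_qpoch[OF assms(1)] assms(2)] .

lemma qpoch_eq_0_iff:
  assumes "upper I \<tau>"
  shows "qpoch I \<tau> z = 0 \<longleftrightarrow> (\<exists>m\<in>I \<rightarrow>\<^sub>E (UNIV::nat set). z + (\<Sum>j\<in>I. of_nat (m j) * \<tau> j) \<in> \<int>)"
proof
  assume *: "qpoch I \<tau> z = 0"
  obtain d where d: "d > 0" "\<And>j. j \<in> I \<Longrightarrow> d \<le> Im (\<tau> j)" using upper_bound[OF assms] by blast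
  have I: "finite I" using assms by (simp add: upper_def)
  show "\<exists>m\<in>I \<rightarrow>\<^sub>E (UNIV::nat set). z + (\<Sum>j\<in>I. of_nat (m j) * \<tau> j) \<in> \<int>"
  proof (rule ccontr)
    assume "\<not> ?thesis"
    then have "qpoch I \<tau> z \<noteq> 0"
      using has_uprod_nonzero[OF qpoch_bound_summable[OF I d(1), where R = "- Im z"],
          of "\<lambda>m. - e2pi (z + (\<Sum>j\<in>I. of_nat (m j) * \<tau> j))" "qpoch I \<tau> z"]
        norm_e2pi_lattice_le[OF I d(2), where R = "- Im z" and z = z] has_uprod_qpoch[OF assms, of z]
      by (simp add: e2pi_eq_1_iff)
    with * show False by simp
  qed
next
  assume "\<exists>m\<in>I \<rightarrow>\<^sub>E (UNIV::nat set). z + (\<Sum>j\<in>I. of_nat (m j) * \<tau> j) \<in> \<int>"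
  then obtain m where "m \<in> I \<rightarrow>\<^sub>E (UNIV::nat set)" "e2pi (z + (\<Sum>j\<in>I. of_nat (m j) * \<tau> j)) = 1"
    using e2pi_eq_1_iff by auto
  then show "qpoch I \<tau> z = 0" using assms by (intro qpoch_eqI has_uprod_zero) auto
qed

section \<open>Continuity and holomorphy of the q-Pochhammer products\<close>

lemma uniform_limit_qpoch:
  assumes "finite I" "d > 0"
    "\<And>t. t \<in> X \<Longrightarrow> Im (z t) \<ge> - R" "\<And>t j. t \<in> X \<Longrightarrow> j \<in> I \<Longrightarrow> Im (\<tau> t j) \<ge> d"
  shows "uniform_limit X (\<lambda>M t. \<Prod>m\<in>M. 1 - e2pi (z t + (\<Sum>j\<in>I. of_nat (m j) * \<tau> t j)))
    (\<lambda>t. qpoch I (\<tau> t) (z t)) (finite_subsets_at_top (I \<rightarrow>\<^sub>E UNIV))"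
proof -
  have up: "upper I (\<tau> t)" if "t \<in> X" for t
    using assms that by (force simp: upper_def)
  show ?thesis
    using uniform_limit_uprod[OF qpoch_bound_summable[OF assms(1,2), where R = R],
        of X "\<lambda>m t. - e2pi (z t + (\<Sum>j\<in>I. of_nat (m j) * \<tau> t j))" "\<lambda>t. qpoch I (\<tau> t) (z t)"]
      norm_e2pi_lattice_le[OF assms(1)] assms has_uprod_qpoch[OF up]
    by (simp add: prod_nonneg)
qed

lemma tendsto_e2pi [tendsto_intros]: "(z \<longlongrightarrow> l) F \<Longrightarrow> ((\<lambda>t. e2pi (z t)) \<longlongrightarrow> e2pi l) F"
  unfolding e2pi_def by (intro tendsto_intros)

lemma holomorphic_on_e2pi [holomorphic_intros]:
  "f holomorphic_on S \<Longrightarrow> (\<lambda>z. e2pi (f z)) holomorphic_on S"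
  unfolding e2pi_def by (intro holomorphic_intros)

text \<open>The finite products converge uniformly on a region X that eventually contains the moving
  parameters, so the limit over finite sets and the limit along F may be exchanged.\<close>

lemma tendsto_qpoch:
  assumes "upper I \<tau>0" "(z \<longlongrightarrow> z0) F" "\<And>j. j \<in> I \<Longrightarrow> ((\<lambda>t. \<tau> t j) \<longlongrightarrow> \<tau>0 j) F"
  shows "((\<lambda>t. qpoch I (\<tau> t) (z t)) \<longlongrightarrow> qpoch I \<tau>0 z0) F"
proof -
  obtain d where d: "d > 0" "\<And>j. j \<in> I \<Longrightarrow> d \<le> Im (\<tau>0 j)" using upper_bound[OF assms(1)] by blast
  have I: "finite I" using assms by (simp add: upper_def)
  \<comment> \<open>The slack of 1 below \<open>Im z0\<close>, and d / 2 in place of d, make the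
    conditions of X hold eventually along F.\<close>
  define R where "R = - (Im z0 - 1)"
  define X where "X = {t. Im (z t) \<ge> - R \<and> (\<forall>j\<in>I. Im (\<tau> t j) \<ge> d / 2)}"
  have "eventually (\<lambda>t. Im (z t) > - R) F"
    using tendsto_Im[OF assms(2)] by (rule order_tendstoD) (simp add: R_def)
  moreover have "eventually (\<lambda>t. Im (\<tau> t j) > d / 2) F" if "j \<in> I" for j
    using tendsto_Im[OF assms(3)[OF that]] by (rule order_tendstoD) (use d that in fastforce)
  then have "eventually (\<lambda>t. \<forall>j\<in>I. Im (\<tau> t j) > d / 2) F"
    using I by (simp add: eventually_ball_finite)
  ultimately have ev: "eventually (\<lambda>t. t \<in> X) F"
    by eventually_elim (auto simp: X_def less_imp_le)
  show ?thesis
  proof (rule swap_uniform_limit'[OF _ _ _ ev])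
    show "\<forall>\<^sub>F M in finite_subsets_at_top (I \<rightarrow>\<^sub>E UNIV).
        ((\<lambda>t. \<Prod>m\<in>M. 1 - e2pi (z t + (\<Sum>j\<in>I. of_nat (m j) * \<tau> t j))) \<longlongrightarrow>
          (\<Prod>m\<in>M. 1 - e2pi (z0 + (\<Sum>j\<in>I. of_nat (m j) * \<tau>0 j)))) F"
      using assms by (intro always_eventually allI tendsto_intros) auto
    show "((\<lambda>M. \<Prod>m\<in>M. 1 - e2pi (z0 + (\<Sum>j\<in>I. of_nat (m j) * \<tau>0 j))) \<longlongrightarrow> qpoch I \<tau>0 z0)
        (finite_subsets_at_top (I \<rightarrow>\<^sub>E UNIV))"
      using has_uprod_qpoch[OF assms(1), of z0] unfolding has_uprod_def .
    show "uniform_limit X (\<lambda>M t. \<Prod>m\<in>M. 1 - e2pi (z t + (\<Sum>j\<in>I. of_nat (m j) * \<tau> t j)))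
        (\<lambda>t. qpoch I (\<tau> t) (z t)) (finite_subsets_at_top (I \<rightarrow>\<^sub>E UNIV))"
      using d(1) by (intro uniform_limit_qpoch[OF I, where d = "d/2" and R = R]) (auto simp: X_def)
  qed auto
qed

text \<open>A locally uniform limit of entire functions: on the unit disc around z the imaginary
  part stays above \<open>Im z - 1\<close>, which suffices for the majorant.\<close>

lemma holomorphic_on_qpoch_UNIV:
  assumes "upper I \<tau>"
  shows "qpoch I \<tau> holomorphic_on UNIV"
proof -
  obtain d where d: "d > 0" "\<And>j. j \<in> I \<Longrightarrow> d \<le> Im (\<tau> j)" using upper_bound[OF assms] by blast
  have I: "finite I" using assms by (simp add: upper_def)
  have "qpoch I \<tau> field_differentiable (at z)" for z
  proof -
    have "qpoch I \<tau> holomorphic_on ball z 1"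
    proof (rule holomorphic_uniform_limit)
      show "\<not> trivial_limit (finite_subsets_at_top (I \<rightarrow>\<^sub>E (UNIV :: nat set)))" by simp
      show "uniform_limit (cball z 1) (\<lambda>M t. \<Prod>m\<in>M. 1 - e2pi (t + (\<Sum>j\<in>I. of_nat (m j) * \<tau> j)))
        (qpoch I \<tau>) (finite_subsets_at_top (I \<rightarrow>\<^sub>E UNIV))"
      proof (rule uniform_limit_qpoch[OF I d(1), where X = "cball z 1" and z = "\<lambda>t. t" and R = "1 - Im z" and \<tau> = "\<lambda>t. \<tau>"])
        fix t assume "t \<in> cball z 1"
        then have "norm (z - t) \<le> 1" by (simp add: dist_norm)
        then show "- (1 - Im z) \<le> Im t" using abs_Im_le_cmod[of "z - t"] by auto
      qed (use d in auto)
      have hol: "(\<lambda>t. \<Prod>m\<in>M. 1 - e2pi (t + (\<Sum>j\<in>I. of_nat (m j) * \<tau> j))) holomorphic_on S" for M S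
        by (intro holomorphic_intros)
      show "\<forall>\<^sub>F M in finite_subsets_at_top (I \<rightarrow>\<^sub>E UNIV).
        continuous_on (cball z 1) (\<lambda>t. \<Prod>m\<in>M. 1 - e2pi (t + (\<Sum>j\<in>I. of_nat (m j) * \<tau> j))) \<and>
        (\<lambda>t. \<Prod>m\<in>M. 1 - e2pi (t + (\<Sum>j\<in>I. of_nat (m j) * \<tau> j))) holomorphic_on ball z 1"
        using hol holomorphic_on_imp_continuous_on[OF hol] by (intro always_eventually) auto
    qed
    then show ?thesis by (rule holomorphic_on_imp_differentiable_at) auto
  qed
  then show ?thesis by (simp add: holomorphic_on_def)
qed

lemma holomorphic_on_qpoch [holomorphic_intros]:
  assumes "upper I \<tau>" "f holomorphic_on S"
  shows "(\<lambda>z. qpoch I \<tau> (f z)) holomorphic_on S"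
  using holomorphic_on_compose_gen[OF assms(2) holomorphic_on_qpoch_UNIV[OF assms(1)]]
  by (simp add: o_def)

lemma qpoch_cong:
  assumes "\<And>j. j \<in> I \<Longrightarrow> \<tau> j - \<tau>' j \<in> \<int>" "z - z' \<in> \<int>"
  shows "qpoch I \<tau> z = qpoch I \<tau>' z'"
proof -
  have "e2pi (z + (\<Sum>j\<in>I. of_nat (m j) * \<tau> j)) = e2pi (z' + (\<Sum>j\<in>I. of_nat (m j) * \<tau>' j))" for m
  proof -
    have "(z - z') + (\<Sum>j\<in>I. of_nat (m j) * (\<tau> j - \<tau>' j)) \<in> \<int>"
      using assms by (intro Ints_add Ints_sum Ints_mult) auto
    then have "e2pi ((z' + (\<Sum>j\<in>I. of_nat (m j) * \<tau>' j)) + ((z - z') + (\<Sum>j\<in>I. of_nat (m j) * (\<tau> j - \<tau>' j))))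
      = e2pi (z' + (\<Sum>j\<in>I. of_nat (m j) * \<tau>' j))" by (rule e2pi_add_Ints)
    then show ?thesis by (simp add: algebra_simps sum_subtractf)
  qed
  then show ?thesis unfolding qpoch_def by simp
qed

lemma qpoch_empty: "qpoch {} \<tau> z = 1 - e2pi z"
  using has_uprod_finite[of "{}"] by (intro qpoch_eqI) (auto simp: upper_def intro!: has_uprod_finite[THEN back_subst[of "has_uprod _ _"]])

lemma qpoch_reindex:
  assumes "bij_betw h I' I"
  shows "qpoch I' (\<lambda>i. \<tau> (h i)) z = qpoch I \<tau> z"
proof -
  define \<Theta> where "\<Theta> = (\<lambda>m::'b \<Rightarrow> nat. restrict (m \<circ> h) I')"
  have bij: "bij_betw \<Theta> (I \<rightarrow>\<^sub>E UNIV) (I' \<rightarrow>\<^sub>E UNIV)"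
  proof (rule bij_betwI[where g = "\<lambda>m. restrict (m \<circ> inv_into I' h) I"])
    show "restrict (\<Theta> m \<circ> inv_into I' h) I = m" if "m \<in> I \<rightarrow>\<^sub>E UNIV" for m
      using that assms unfolding \<Theta>_def
      by (intro ext) (auto simp: bij_betw_inv_into_right[OF assms] inv_into_into bij_betw_imp_surj_on PiE_iff extensional_def)
    show "\<Theta> (restrict (m \<circ> inv_into I' h) I) = m" if "m \<in> I' \<rightarrow>\<^sub>E UNIV" for m
      using that assms unfolding \<Theta>_def
      by (intro ext) (auto simp: bij_betw_inv_into_left[OF assms] bij_betwE PiE_iff extensional_def)
  qed (auto simp: \<Theta>_def)
  have "(\<Sum>j\<in>I. of_nat (m j) * \<tau> j) = (\<Sum>i\<in>I'. of_nat (\<Theta> m i) * \<tau> (h i))" for m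
    by (subst sum.reindex_bij_betw[OF assms, symmetric]) (auto simp: \<Theta>_def)
  then have "has_uprod (\<lambda>m. 1 - e2pi (z + (\<Sum>j\<in>I. of_nat (m j) * \<tau> j))) (I \<rightarrow>\<^sub>E UNIV) p \<longleftrightarrow>
      has_uprod (\<lambda>m. 1 - e2pi (z + (\<Sum>i\<in>I'. of_nat (m i) * \<tau> (h i)))) (I' \<rightarrow>\<^sub>E UNIV) p" for p
    using has_uprod_reindex[OF bij, of "\<lambda>m. 1 - e2pi (z + (\<Sum>i\<in>I'. of_nat (m i) * \<tau> (h i)))" p] by simp
  then show ?thesis unfolding qpoch_def has_uprod_def t2_space_class.Lim_def by simp
qed

section \<open>Functional equations of the q-Pochhammer products\<close>

lemma PiE_mod_decomposition:
  assumes "N > 0"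
  shows "I \<rightarrow>\<^sub>E (UNIV::nat set) = (\<Union>i<N. {m \<in> I \<rightarrow>\<^sub>E UNIV. m j mod N = i})"
  using assms by auto

lemma bij_betw_PiE_mod:
  assumes "j \<in> I" "i < N"
  shows "bij_betw (\<lambda>m. m(j := N * m j + i)) (I \<rightarrow>\<^sub>E (UNIV::nat set)) {m \<in> I \<rightarrow>\<^sub>E UNIV. m j mod N = i}"
  by (rule bij_betwI[where g = "\<lambda>m. m(j := m j div N)"])
     (use assms in \<open>auto simp: PiE_iff extensional_def fun_eq_iff\<close>)

lemma sum_fun_upd_remove:
  assumes "finite I" "j \<in> I"
  shows "(\<Sum>k\<in>I. f k ((m(j := x)) k)) = f j x + (\<Sum>k\<in>I-{j}. f k (m k))"
  by (subst sum.remove[OF assms]) (auto intro!: sum.cong)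

lemma upper_fun_upd: "upper I \<tau> \<Longrightarrow> Im x > 0 \<Longrightarrow> upper I (\<tau>(j := x))"
  by (auto simp: upper_def)

lemma upper_subset: "upper I \<tau> \<Longrightarrow> J \<subseteq> I \<Longrightarrow> upper J \<tau>"
  by (auto simp: upper_def finite_subset)

text \<open>The multi-indices are sorted by the residue i of \<open>m j\<close> modulo N; each
  residue class is a product with parameter \<open>N * \<tau> j\<close> at the point
  \<open>z + i * \<tau> j\<close>.\<close>

lemma qpoch_distribution:
  assumes "upper I \<tau>" "j \<in> I" "N > 0"
  shows "qpoch I \<tau> z = (\<Prod>i<N. qpoch I (\<tau>(j := of_nat N * \<tau> j)) (z + of_nat i * \<tau> j))"
proof (rule qpoch_eqI[OF assms(1)])
  have I: "finite I" using assms by (simp add: upper_def)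
  let ?\<tau> = "\<tau>(j := of_nat N * \<tau> j)"
  have up: "upper I ?\<tau>" using assms by (intro upper_fun_upd) (auto simp: upper_def)
  let ?f = "\<lambda>m. 1 - e2pi (z + (\<Sum>j\<in>I. of_nat (m j) * \<tau> j))"
  have eq: "?f (m(j := N * m j + i)) =
      1 - e2pi ((z + of_nat i * \<tau> j) + (\<Sum>k\<in>I. of_nat (m k) * ?\<tau> k))" for m i
    using sum_fun_upd_remove[OF I assms(2), of "\<lambda>k x. of_nat x * \<tau> k" m]
      sum_fun_upd_remove[OF I assms(2), of "\<lambda>k x. of_nat (m k) * x" \<tau>]
    by (simp add: algebra_simps)
  have "has_uprod ?f {m \<in> I \<rightarrow>\<^sub>E UNIV. m j mod N = i} (qpoch I ?\<tau> (z + of_nat i * \<tau> j))" if "i < N" for i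
    using has_uprod_reindex[OF bij_betw_PiE_mod[OF assms(2) that], of ?f]
      has_uprod_qpoch[OF up, of "z + of_nat i * \<tau> j"] unfolding eq by simp
  then show "has_uprod ?f (I \<rightarrow>\<^sub>E UNIV) (\<Prod>i<N. qpoch I ?\<tau> (z + of_nat i * \<tau> j))"
    by (subst PiE_mod_decomposition[OF assms(3), of I j], intro has_uprod_UN_disjoint) auto
qed

text \<open>The multi-indices with \<open>m j = 0\<close> give the product without the parameter j,
  those with \<open>m j \<ge> 1\<close> the full product moved by \<open>\<tau> j\<close>.\<close>

lemma qpoch_shift:
  assumes "upper I \<tau>" "j \<in> I"
  shows "qpoch I \<tau> z = qpoch (I - {j}) \<tau> z * qpoch I \<tau> (z + \<tau> j)"
proof (rule qpoch_eqI[OF assms(1)])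
  have I: "finite I" using assms by (simp add: upper_def)
  have up: "upper (I - {j}) \<tau>" using assms by (auto intro: upper_subset)
  let ?f = "\<lambda>m. 1 - e2pi (z + (\<Sum>j\<in>I. of_nat (m j) * \<tau> j))"
  have b1: "bij_betw (\<lambda>m. m(j := 0)) ((I - {j}) \<rightarrow>\<^sub>E (UNIV::nat set)) {m \<in> I \<rightarrow>\<^sub>E UNIV. m j = 0}"
    by (rule bij_betwI[where g = "\<lambda>m. m(j := undefined)"])
       (use assms in \<open>auto simp: PiE_iff extensional_def fun_eq_iff\<close>)
  have b2: "bij_betw (\<lambda>m. m(j := Suc (m j))) (I \<rightarrow>\<^sub>E (UNIV::nat set)) {m \<in> I \<rightarrow>\<^sub>E UNIV. m j \<noteq> 0}"
    by (rule bij_betwI[where g = "\<lambda>m. m(j := m j - 1)"])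
       (use assms in \<open>auto simp: PiE_iff extensional_def fun_eq_iff\<close>)
  have e1: "?f (m(j := 0)) = 1 - e2pi (z + (\<Sum>k\<in>I-{j}. of_nat (m k) * \<tau> k))" for m
    using sum_fun_upd_remove[OF I assms(2), of "\<lambda>k x. of_nat x * \<tau> k" m] by simp
  have e2: "?f (m(j := Suc (m j))) = 1 - e2pi ((z + \<tau> j) + (\<Sum>k\<in>I. of_nat (m k) * \<tau> k))" for m
    using sum_fun_upd_remove[OF I assms(2), of "\<lambda>k x. of_nat x * \<tau> k" m]
      sum.remove[OF I assms(2), of "\<lambda>k. of_nat (m k) * \<tau> k"]
    by (simp add: algebra_simps)
  have "has_uprod ?f {m \<in> I \<rightarrow>\<^sub>E UNIV. m j = 0} (qpoch (I - {j}) \<tau> z)"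
    using has_uprod_reindex[OF b1, of ?f] has_uprod_qpoch[OF up, of z] unfolding e1 by simp
  moreover have "has_uprod ?f {m \<in> I \<rightarrow>\<^sub>E UNIV. m j \<noteq> 0} (qpoch I \<tau> (z + \<tau> j))"
    using has_uprod_reindex[OF b2, of ?f] has_uprod_qpoch[OF assms(1), of "z + \<tau> j"] unfolding e2 by simp
  ultimately have "has_uprod ?f ({m \<in> I \<rightarrow>\<^sub>E UNIV. m j = 0} \<union> {m \<in> I \<rightarrow>\<^sub>E UNIV. m j \<noteq> 0})
      (qpoch (I - {j}) \<tau> z * qpoch I \<tau> (z + \<tau> j))"
    by (rule has_uprod_Un_disjoint) auto
  also have "{m \<in> I \<rightarrow>\<^sub>E UNIV. m j = 0} \<union> {m \<in> I \<rightarrow>\<^sub>E UNIV. m j \<noteq> 0} = I \<rightarrow>\<^sub>E (UNIV::nat set)" by auto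
  finally show "has_uprod ?f (I \<rightarrow>\<^sub>E UNIV) (qpoch (I - {j}) \<tau> z * qpoch I \<tau> (z + \<tau> j))" .
qed

lemma upper_divide: "upper I \<tau> \<Longrightarrow> N > 0 \<Longrightarrow> upper I (\<lambda>j. \<tau> j / of_nat N)"
  by (auto simp: upper_def Im_divide_of_nat)

text \<open>Each single factor splits by the root-of-unity identity; the division by N then falls on
  z and on every \<open>\<tau> j\<close> alike.\<close>

lemma qpoch_multiplication:
  assumes "upper I \<tau>" "N > 0"
  shows "qpoch I \<tau> z = (\<Prod>i<N. qpoch I (\<lambda>j. \<tau> j / of_nat N) ((z + of_nat i) / of_nat N))"
proof (rule qpoch_eqI[OF assms(1)])
  have "has_uprod (\<lambda>m. \<Prod>i<N. 1 - e2pi ((z + of_nat i) / of_nat N + (\<Sum>j\<in>I. of_nat (m j) * (\<tau> j / of_nat N))))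
     (I \<rightarrow>\<^sub>E UNIV) (\<Prod>i<N. qpoch I (\<lambda>j. \<tau> j / of_nat N) ((z + of_nat i) / of_nat N))"
    using assms by (intro has_uprod_prod has_uprod_qpoch upper_divide)
  also have "(\<lambda>m. \<Prod>i<N. 1 - e2pi ((z + of_nat i) / of_nat N + (\<Sum>j\<in>I. of_nat (m j) * (\<tau> j / of_nat N))))
    = (\<lambda>m. \<Prod>i<N. 1 - e2pi (((z + (\<Sum>j\<in>I. of_nat (m j) * \<tau> j)) + of_nat i) / of_nat N))"
    by (simp add: add_divide_distrib sum_divide_distrib algebra_simps)
  finally show "has_uprod (\<lambda>m. 1 - e2pi (z + (\<Sum>j\<in>I. of_nat (m j) * \<tau> j))) (I \<rightarrow>\<^sub>E UNIV)
      (\<Prod>i<N. qpoch I (\<lambda>j. \<tau> j / of_nat N) ((z + of_nat i) / of_nat N))"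
    by (simp only: prod_one_minus_e2pi[OF assms(2)])
qed

section \<open>Nishizawa's functions as q-Pochhammer quotients\<close>

definition nonreal :: "'i set \<Rightarrow> ('i \<Rightarrow> complex) \<Rightarrow> bool" where
  "nonreal I \<tau> \<longleftrightarrow> finite I \<and> (\<forall>j\<in>I. Im (\<tau> j) \<noteq> 0)"

definition neg_part :: "'i set \<Rightarrow> ('i \<Rightarrow> complex) \<Rightarrow> 'i set" where
  "neg_part I \<tau> = {j \<in> I. Im (\<tau> j) < 0}"

definition pos_part :: "'i set \<Rightarrow> ('i \<Rightarrow> complex) \<Rightarrow> 'i set" where
  "pos_part I \<tau> = {j \<in> I. Im (\<tau> j) > 0}"

definition reflect :: "('i \<Rightarrow> complex) \<Rightarrow> 'i \<Rightarrow> complex" where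
  "reflect \<tau> j = (if Im (\<tau> j) < 0 then - \<tau> j else \<tau> j)"

text \<open>After reflection the point is z minus the sum over \<open>neg_part\<close>. Nishizawa's
  first factor sits at the sum of the reflected parameters minus that point; the contributions of
  \<open>neg_part\<close> cancel, and only the sum over \<open>pos_part\<close> minus z is
  left.\<close>

definition num_qpoch :: "'i set \<Rightarrow> ('i \<Rightarrow> complex) \<Rightarrow> complex \<Rightarrow> complex" where
  "num_qpoch I \<tau> z = qpoch I (reflect \<tau>) (sum \<tau> (pos_part I \<tau>) - z)"

definition den_qpoch :: "'i set \<Rightarrow> ('i \<Rightarrow> complex) \<Rightarrow> complex \<Rightarrow> complex" where
  "den_qpoch I \<tau> z = qpoch I (reflect \<tau>) (z - sum \<tau> (neg_part I \<tau>))"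

(* For card I = r + 1 the exponent - (-1) ^ card I is Nishizawa's (-1) ^ r; the case I = {} is
   G with r = -1, which starts the induction on the number of parameters. *)
definition gen_G :: "'i set \<Rightarrow> ('i \<Rightarrow> complex) \<Rightarrow> complex \<Rightarrow> complex" where
  "gen_G I \<tau> z = (num_qpoch I \<tau> z * den_qpoch I \<tau> z powi (- ((-1) ^ card I)))
     powi ((-1) ^ card (neg_part I \<tau>))"

lemma upper_reflect: "nonreal I \<tau> \<Longrightarrow> upper I (reflect \<tau>)"
  by (auto simp: nonreal_def upper_def reflect_def)

lemma minus_one_power_cases: "(-1::int) ^ k = 1 \<or> (-1::int) ^ k = -1"
  by (cases "even k") auto

(* Valid also where the denominator vanishes: some factor of the unconditional product is then
   inverse 0 = 0, so the product converges to 0. *)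
lemma nishizawa_upper_eq:
  assumes "\<And>j. j \<le> r \<Longrightarrow> Im (\<tau> j) > 0"
  shows "nishizawa_upper r z \<tau> = qpoch {..r} \<tau> ((\<Sum>j\<le>r. \<tau> j) - z) * qpoch {..r} \<tau> z powi ((-1) ^ r)"
proof -
  let ?S = "{..r} \<rightarrow>\<^sub>E (UNIV::nat set)"
  have up: "upper {..r} \<tau>" using assms by (auto simp: upper_def)
  let ?f = "\<lambda>m. 1 - e2pi (((\<Sum>j\<le>r. \<tau> j) - z) + (\<Sum>j\<in>{..r}. of_nat (m j) * \<tau> j))"
  let ?g = "\<lambda>m. 1 - e2pi (z + (\<Sum>j\<in>{..r}. of_nat (m j) * \<tau> j))"
  have f: "has_uprod ?f ?S (qpoch {..r} \<tau> ((\<Sum>j\<le>r. \<tau> j) - z))"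
    and g: "has_uprod ?g ?S (qpoch {..r} \<tau> z)"
    using up by (auto intro: has_uprod_qpoch)
  have "has_uprod (\<lambda>m. ?f m * ?g m powi ((-1) ^ r)) ?S
      (qpoch {..r} \<tau> ((\<Sum>j\<le>r. \<tau> j) - z) * qpoch {..r} \<tau> z powi ((-1) ^ r))"
  proof (cases "even r")
    case True
    then show ?thesis using has_uprod_mult[OF f g] by simp
  next
    case False
    then have r: "(-1::int) ^ r = -1" by simp
    show ?thesis
    proof (cases "qpoch {..r} \<tau> z = 0")
      case True
      then obtain m where "m \<in> ?S" "?g m = 0"
        using qpoch_eq_0_iff[OF up] e2pi_eq_1_iff by auto
      then show ?thesis using True r by (auto intro: has_uprod_zero)
    next
      case False
      then show ?thesis
        using has_uprod_mult[OF f has_uprod_inverse[OF g]] r by (simp add: power_int_minus)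
    qed
  qed
  also have "(\<lambda>m. ?f m * ?g m powi ((-1) ^ r)) = (\<lambda>m.
          (1 - exp (2 * \<i> * of_real pi * (- z + (\<Sum>j\<le>r. (of_nat (m j) + 1) * \<tau> j)))) *
          (1 - exp (2 * \<i> * of_real pi * (z + (\<Sum>j\<le>r. of_nat (m j) * \<tau> j)))) powi ((-1) ^ r))"
    by (simp add: e2pi_def algebra_simps sum.distrib)
  finally show ?thesis
    unfolding nishizawa_upper_def by (rule has_uprod_Lim)
qed

lemma sum_pos_neg_reflect:
  assumes "finite I"
  shows "sum (reflect \<tau>) I = sum \<tau> (pos_part I \<tau>) - sum \<tau> (neg_part I \<tau>) + (\<Sum>j\<in>{j\<in>I. Im (\<tau> j) = 0}. \<tau> j)"
proof -
  have "I = pos_part I \<tau> \<union> (neg_part I \<tau> \<union> {j\<in>I. Im (\<tau> j) = 0})"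
    by (auto simp: pos_part_def neg_part_def)
  then have "sum (reflect \<tau>) I = sum (reflect \<tau>) (pos_part I \<tau> \<union> (neg_part I \<tau> \<union> {j\<in>I. Im (\<tau> j) = 0}))" by simp
  also have "\<dots> = sum (reflect \<tau>) (pos_part I \<tau>) + (sum (reflect \<tau>) (neg_part I \<tau>) + sum (reflect \<tau>) {j\<in>I. Im (\<tau> j) = 0})"
    using assms by (subst sum.union_disjoint, simp, simp, force simp: pos_part_def neg_part_def)+
      (auto simp: pos_part_def neg_part_def intro!: sum.union_disjoint)
  also have "sum (reflect \<tau>) (pos_part I \<tau>) = sum \<tau> (pos_part I \<tau>)"
    by (intro sum.cong) (auto simp: pos_part_def reflect_def)
  also have "sum (reflect \<tau>) (neg_part I \<tau>) = - sum \<tau> (neg_part I \<tau>)"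
    unfolding sum_negf[symmetric] by (intro sum.cong) (auto simp: neg_part_def reflect_def)
  also have "sum (reflect \<tau>) {j\<in>I. Im (\<tau> j) = 0} = (\<Sum>j\<in>{j\<in>I. Im (\<tau> j) = 0}. \<tau> j)"
    by (intro sum.cong) (auto simp: reflect_def)
  finally show ?thesis by simp
qed

lemma nishizawa_G_eq_gen_G:
  assumes "nonreal {..r} \<tau>"
  shows "nishizawa_G r z \<tau> = gen_G {..r} \<tau> z"
proof -
  have J: "{j. j \<le> r \<and> Im (\<tau> j) < 0} = neg_part {..r} \<tau>" by (auto simp: neg_part_def)
  have upper: "Im (reflect \<tau> j) > 0" if "j \<le> r" for j
    using upper_reflect[OF assms] that by (auto simp: upper_def)
  \<comment> \<open>The two parameter families can differ beyond index r, but
    \<open>nishizawa_upper r\<close> reads only the indices up to r.\<close>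
  have eq: "nishizawa_upper r y (\<lambda>j. if j \<in> neg_part {..r} \<tau> then - \<tau> j else \<tau> j)
      = nishizawa_upper r y (reflect \<tau>)" for y
    unfolding nishizawa_upper_def
    by (intro arg_cong2[where f = Lim] refl ext prod.cong arg_cong2[where f = "(*)"] arg_cong2[where f = "(powi)"]
        arg_cong2[where f = "(-)"] arg_cong2[where f = "(+)"] arg_cong[where f = exp] sum.cong)
       (auto simp: neg_part_def reflect_def)
  have z: "{j \<in> {..r}. Im (\<tau> j) = 0} = {}" using assms by (auto simp: nonreal_def)
  have arg: "sum (reflect \<tau>) {..r} - (z + (\<Sum>j\<in>neg_part {..r} \<tau>. - \<tau> j)) = sum \<tau> (pos_part {..r} \<tau>) - z"
    unfolding sum_pos_neg_reflect[OF finite_atMost] z by (simp add: sum_negf)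
  have "nishizawa_G r z \<tau> = nishizawa_upper r (z + (\<Sum>j\<in>neg_part {..r} \<tau>. - \<tau> j)) (reflect \<tau>)
      powi ((-1) ^ card (neg_part {..r} \<tau>))"
    unfolding nishizawa_G_def Let_def J eq ..
  also have "nishizawa_upper r (z + (\<Sum>j\<in>neg_part {..r} \<tau>. - \<tau> j)) (reflect \<tau>) =
      qpoch {..r} (reflect \<tau>) (sum \<tau> (pos_part {..r} \<tau>) - z) *
      qpoch {..r} (reflect \<tau>) (z + (\<Sum>j\<in>neg_part {..r} \<tau>. - \<tau> j)) powi ((-1) ^ r)"
    unfolding arg[symmetric] by (rule nishizawa_upper_eq) (rule upper)
  finally show ?thesis
    by (simp add: gen_G_def num_qpoch_def den_qpoch_def sum_negf)
qed

text \<open>Under \<open>inverse 0 = 0\<close> a pole shows up as the value 0, too. Hence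
  \<open>gen_G \<noteq> 0\<close> serves as the regularity condition from here on: it excludes zeros
  and poles at once.\<close>

lemma gen_G_eq_0_iff: "gen_G I \<tau> z = 0 \<longleftrightarrow> num_qpoch I \<tau> z = 0 \<or> den_qpoch I \<tau> z = 0"
  unfolding gen_G_def
  using minus_one_power_cases[of "card I"] minus_one_power_cases[of "card (neg_part I \<tau>)"]
  by (auto simp: power_int_eq_0_iff)

text \<open>An integer change of a parameter keeps its imaginary part, so the same parameters get
  reflected and all arguments of the q-Pochhammer products move by integers.\<close>

lemma gen_G_cong:
  assumes "\<And>j. j \<in> I \<Longrightarrow> \<tau> j - \<tau>' j \<in> \<int>" "z - z' \<in> \<int>"
  shows "gen_G I \<tau> z = gen_G I \<tau>' z'"
proof -
  have im: "Im (\<tau> j) = Im (\<tau>' j)" if j: "j \<in> I" for j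
  proof -
    obtain k where "\<tau> j - \<tau>' j = of_int k" using Ints_cases[OF assms(1)[OF j]] by metis
    then have "\<tau> j = \<tau>' j + of_int k" by (simp add: algebra_simps)
    then show ?thesis by simp
  qed
  have parts: "pos_part I \<tau> = pos_part I \<tau>'" "neg_part I \<tau> = neg_part I \<tau>'"
    using im by (auto simp: pos_part_def neg_part_def)
  have r: "reflect \<tau> j - reflect \<tau>' j \<in> \<int>" if "j \<in> I" for j
    using assms(1)[OF that] im[OF that] Ints_minus[OF assms(1)[OF that]] by (auto simp: reflect_def)
  have sp: "sum \<tau> K - sum \<tau>' K \<in> \<int>" if "K \<subseteq> I" for K
    unfolding sum_subtractf[symmetric] using assms that by (auto intro: Ints_sum)
  have "(sum \<tau> (pos_part I \<tau>) - z) - (sum \<tau>' (pos_part I \<tau>') - z') \<in> \<int>"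
    using Ints_diff[OF sp[of "pos_part I \<tau>'"] assms(2)] unfolding parts
    by (simp add: pos_part_def algebra_simps)
  then have num: "num_qpoch I \<tau> z = num_qpoch I \<tau>' z'"
    unfolding num_qpoch_def by (intro qpoch_cong r)
  have "(z - sum \<tau> (neg_part I \<tau>)) - (z' - sum \<tau>' (neg_part I \<tau>')) \<in> \<int>"
    using Ints_diff[OF assms(2) sp[of "neg_part I \<tau>'"]] unfolding parts
    by (simp add: neg_part_def algebra_simps)
  then have "den_qpoch I \<tau> z = den_qpoch I \<tau>' z'"
    unfolding den_qpoch_def by (intro qpoch_cong r)
  with num show ?thesis by (simp add: gen_G_def parts)
qed

lemma gen_G_cong': "(\<And>j. j \<in> I \<Longrightarrow> \<tau> j = \<tau>' j) \<Longrightarrow> gen_G I \<tau> z = gen_G I \<tau>' z"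
  by (rule gen_G_cong) auto

lemma gen_G_reindex:
  assumes "bij_betw h I' I"
  shows "gen_G I' (\<lambda>i. \<tau> (h i)) z = gen_G I \<tau> z"
proof -
  have bp: "bij_betw h (pos_part I' (\<lambda>i. \<tau> (h i))) (pos_part I \<tau>)"
    and bn: "bij_betw h (neg_part I' (\<lambda>i. \<tau> (h i))) (neg_part I \<tau>)"
    using assms by (auto simp: bij_betw_def pos_part_def neg_part_def inj_on_def)
  have r: "reflect (\<lambda>i. \<tau> (h i)) = (\<lambda>i. reflect \<tau> (h i))" by (simp add: reflect_def fun_eq_iff)
  show ?thesis
    unfolding gen_G_def num_qpoch_def den_qpoch_def r qpoch_reindex[OF assms]
      sum.reindex_bij_betw[OF bp] sum.reindex_bij_betw[OF bn]
      bij_betw_same_card[OF bn] bij_betw_same_card[OF assms] ..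
qed

text \<open>Negation exchanges \<open>pos_part\<close> with \<open>neg_part\<close> and numerator
  with denominator, while the reflected parameters stay the same. The exponents match because
  \<open>(-1) ^ card I\<close> is the product of the signs of the two parts. Normal vectors that are
  negatives of dual vectors make this necessary.\<close>

lemma gen_G_minus:
  assumes "nonreal I \<tau>"
  shows "gen_G I (\<lambda>j. - \<tau> j) (- z) = inverse (gen_G I \<tau> z)"
proof -
  have I: "finite I" using assms by (simp add: nonreal_def)
  have p: "pos_part I (\<lambda>j. - \<tau> j) = neg_part I \<tau>" "neg_part I (\<lambda>j. - \<tau> j) = pos_part I \<tau>"
    by (auto simp: pos_part_def neg_part_def)
  have r: "upper I (reflect \<tau>)" using assms by (rule upper_reflect)
  have q: "qpoch I (reflect (\<lambda>j. - \<tau> j)) y = qpoch I (reflect \<tau>) y" for y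
    using assms by (intro qpoch_cong) (auto simp: reflect_def nonreal_def)
  have nd: "num_qpoch I (\<lambda>j. - \<tau> j) (- z) = den_qpoch I \<tau> z"
     "den_qpoch I (\<lambda>j. - \<tau> j) (- z) = num_qpoch I \<tau> z"
    unfolding num_qpoch_def den_qpoch_def p q by (simp_all add: sum_negf algebra_simps)
  have "card I = card (pos_part I \<tau>) + card (neg_part I \<tau>)"
    using assms by (subst card_Un_disjoint[symmetric])
      (auto simp: pos_part_def neg_part_def nonreal_def intro!: arg_cong[where f = card])
  then have c: "(-1::int) ^ card I = (-1) ^ card (pos_part I \<tau>) * (-1) ^ card (neg_part I \<tau>)"
    by (simp add: power_add)
  show ?thesis
    unfolding gen_G_def nd p c
    using minus_one_power_cases[of "card (pos_part I \<tau>)"] minus_one_power_cases[of "card (neg_part I \<tau>)"]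
    by (auto simp: power_int_minus inverse_mult_distrib)
qed

lemma prod_powi_distrib:
  fixes f :: "'k \<Rightarrow> complex"
  shows "(\<Prod>k\<in>K. f k) powi c = (\<Prod>k\<in>K. f k powi c)"
  by (induction K rule: infinite_finite_induct) (auto simp: power_int_mult_distrib)

lemma prod_nat_diff_rev: "(\<Prod>i<N. f (N - 1 - i)) = (\<Prod>i<(N::nat). f i)" for f :: "nat \<Rightarrow> complex"
  by (rule prod.reindex_bij_witness[of _ "\<lambda>i. N - 1 - i" "\<lambda>i. N - 1 - i"]) auto

text \<open>Both q-Pochhammer products distribute over N translates. In one of them the translates
  come in the opposite order, because the minus sign in front of z or the reflection reverses the
  direction along \<open>\<tau> j\<close>.\<close>

lemma gen_G_distribution:
  assumes "nonreal I \<tau>" "j \<in> I" "N > 0"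
  shows "gen_G I \<tau> z = (\<Prod>i<N. gen_G I (\<tau>(j := of_nat N * \<tau> j)) (z + of_nat i * \<tau> j))"
proof -
  let ?\<tau> = "\<tau>(j := of_nat N * \<tau> j)"
  have I: "finite I" using assms by (simp add: nonreal_def)
  have parts: "pos_part I ?\<tau> = pos_part I \<tau>" "neg_part I ?\<tau> = neg_part I \<tau>"
    using assms(3) by (auto simp: pos_part_def neg_part_def zero_less_mult_iff mult_less_0_iff)
  have r: "reflect ?\<tau> = (reflect \<tau>)(j := of_nat N * reflect \<tau> j)"
    using assms(3) by (auto simp: reflect_def fun_eq_iff mult_less_0_iff)
  have up: "upper I (reflect \<tau>)" using assms by (intro upper_reflect)
  note dist = qpoch_distribution[OF up assms(2,3)]
  have fp: "finite (pos_part I \<tau>)" "finite (neg_part I \<tau>)" using I by (auto simp: pos_part_def neg_part_def)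
  have rev: "of_nat (N - 1 - i) = (of_nat N - 1 - of_nat i :: complex)" if "i < N" for i
    using that by (simp add: of_nat_diff)
  have "num_qpoch I \<tau> z = (\<Prod>i<N. num_qpoch I ?\<tau> (z + of_nat i * \<tau> j)) \<and>
        den_qpoch I \<tau> z = (\<Prod>i<N. den_qpoch I ?\<tau> (z + of_nat i * \<tau> j))"
  proof (cases "Im (\<tau> j) > 0")
    case True
    then have jp: "j \<in> pos_part I \<tau>" "j \<notin> neg_part I \<tau>" and rj: "reflect \<tau> j = \<tau> j"
      using assms(2) by (auto simp: pos_part_def neg_part_def reflect_def)
    have s: "sum ?\<tau> (pos_part I \<tau>) = sum \<tau> (pos_part I \<tau>) + (of_nat N - 1) * \<tau> j"
      using sum.remove[OF fp(1) jp(1), of \<tau>] sum_fun_upd_remove[OF fp(1) jp(1), of "\<lambda>k x. x" \<tau>]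
      by (simp add: algebra_simps)
    have s': "sum ?\<tau> (neg_part I \<tau>) = sum \<tau> (neg_part I \<tau>)"
      using jp(2) by (intro sum.cong) auto
    \<comment> \<open>The sum over \<open>pos_part\<close> has grown by
      \<open>(N - 1) * \<tau> j\<close>, so the i-th factor on the right is the factor with index
      \<open>N - 1 - i\<close> of \<open>dist\<close>.\<close>
    have "num_qpoch I \<tau> z = (\<Prod>i<N. qpoch I (reflect ?\<tau>) (sum \<tau> (pos_part I \<tau>) - z + of_nat (N - 1 - i) * \<tau> j))"
      unfolding num_qpoch_def r rj prod_nat_diff_rev[of "\<lambda>i. qpoch I _ (_ + of_nat i * \<tau> j)"]
      using dist by (simp only: rj)
    also have "\<dots> = (\<Prod>i<N. num_qpoch I ?\<tau> (z + of_nat i * \<tau> j))"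
      unfolding num_qpoch_def parts s
      by (intro prod.cong refl arg_cong[where f = "qpoch I (reflect ?\<tau>)"]) (simp only: rev lessThan_iff, simp add: algebra_simps)
    finally have "num_qpoch I \<tau> z = (\<Prod>i<N. num_qpoch I ?\<tau> (z + of_nat i * \<tau> j))" .
    moreover have "den_qpoch I \<tau> z = (\<Prod>i<N. den_qpoch I ?\<tau> (z + of_nat i * \<tau> j))"
      unfolding den_qpoch_def parts s' r dist[of "z - sum \<tau> (neg_part I \<tau>)"] rj
      by (simp add: algebra_simps)
    ultimately show ?thesis ..
  next
    case False
    then have im: "Im (\<tau> j) < 0" using assms by (auto simp: nonreal_def)
    then have jp: "j \<notin> pos_part I \<tau>" "j \<in> neg_part I \<tau>" and rj: "reflect \<tau> j = - \<tau> j"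
      using assms(2) by (auto simp: pos_part_def neg_part_def reflect_def)
    have s: "sum ?\<tau> (neg_part I \<tau>) = sum \<tau> (neg_part I \<tau>) + (of_nat N - 1) * \<tau> j"
      using sum.remove[OF fp(2) jp(2), of \<tau>] sum_fun_upd_remove[OF fp(2) jp(2), of "\<lambda>k x. x" \<tau>]
      by (simp add: algebra_simps)
    have s': "sum ?\<tau> (pos_part I \<tau>) = sum \<tau> (pos_part I \<tau>)"
      using jp(1) by (intro sum.cong) auto
    have "den_qpoch I \<tau> z = (\<Prod>i<N. qpoch I (reflect ?\<tau>) (z - sum \<tau> (neg_part I \<tau>) + of_nat (N - 1 - i) * - \<tau> j))"
      unfolding den_qpoch_def r rj prod_nat_diff_rev[of "\<lambda>i. qpoch I _ (_ + of_nat i * - \<tau> j)"]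
      using dist by (simp only: rj)
    also have "\<dots> = (\<Prod>i<N. den_qpoch I ?\<tau> (z + of_nat i * \<tau> j))"
      unfolding den_qpoch_def parts s
      by (intro prod.cong refl arg_cong[where f = "qpoch I (reflect ?\<tau>)"]) (simp only: rev lessThan_iff, simp add: algebra_simps)
    finally have "den_qpoch I \<tau> z = (\<Prod>i<N. den_qpoch I ?\<tau> (z + of_nat i * \<tau> j))" .
    moreover have "num_qpoch I \<tau> z = (\<Prod>i<N. num_qpoch I ?\<tau> (z + of_nat i * \<tau> j))"
      unfolding num_qpoch_def parts s' r dist[of "sum \<tau> (pos_part I \<tau>) - z"] rj
      by (simp add: algebra_simps)
    ultimately show ?thesis by simp
  qed
  then show ?thesis
    unfolding gen_G_def parts
    by (simp add: prod_powi_distrib prod.distrib power_int_mult_distrib)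
qed

lemma gen_G_multiplication:
  assumes "nonreal I \<tau>" "N > 0"
  shows "gen_G I \<tau> z = (\<Prod>i<N. gen_G I (\<lambda>j. \<tau> j / of_nat N) ((z + of_nat i) / of_nat N))"
proof -
  let ?\<tau> = "\<lambda>j. \<tau> j / of_nat N"
  have parts: "pos_part I ?\<tau> = pos_part I \<tau>" "neg_part I ?\<tau> = neg_part I \<tau>"
    using assms(2) by (auto simp: pos_part_def neg_part_def Im_divide_of_nat zero_less_divide_iff divide_less_0_iff)
  have r: "reflect ?\<tau> = (\<lambda>j. reflect \<tau> j / of_nat N)"
    using assms(2) by (auto simp: reflect_def fun_eq_iff Im_divide_of_nat divide_less_0_iff)
  have up: "upper I (reflect \<tau>)" using assms by (intro upper_reflect)
  note mult = qpoch_multiplication[OF up assms(2)]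
  \<comment> \<open>Period 1 is used here so that, with z - 1, the argument at the reversed index
    \<open>N - 1 - i\<close> exceeds the wanted one by exactly 1, which is again a period.\<close>
  have "num_qpoch I \<tau> z = num_qpoch I \<tau> (z - 1)"
    unfolding num_qpoch_def by (rule qpoch_cong) auto
  also have "\<dots> = (\<Prod>i<N. qpoch I (reflect ?\<tau>) ((sum \<tau> (pos_part I \<tau>) - (z - 1) + of_nat (N - 1 - i)) / of_nat N))"
    unfolding num_qpoch_def r prod_nat_diff_rev[of "\<lambda>i. qpoch I _ ((_ + of_nat i) / _)"]
    by (rule mult)
  also have "\<dots> = (\<Prod>i<N. qpoch I (reflect ?\<tau>) (sum ?\<tau> (pos_part I \<tau>) - ((z + of_nat i) / of_nat N)))"
  proof (intro prod.cong refl qpoch_cong)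
    fix i assume "i \<in> {..<N}"
    then have "(sum \<tau> (pos_part I \<tau>) - (z - 1) + of_nat (N - 1 - i)) / of_nat N - (sum ?\<tau> (pos_part I \<tau>) - ((z + of_nat i) / of_nat N)) = 1"
      using assms(2) by (simp add: of_nat_diff sum_divide_distrib[symmetric] field_simps)
    then show "(sum \<tau> (pos_part I \<tau>) - (z - 1) + of_nat (N - 1 - i)) / of_nat N - (sum ?\<tau> (pos_part I \<tau>) - ((z + of_nat i) / of_nat N)) \<in> \<int>"
      by simp
  qed auto
  also have "\<dots> = (\<Prod>i<N. num_qpoch I ?\<tau> ((z + of_nat i) / of_nat N))"
    unfolding num_qpoch_def parts ..
  finally have "num_qpoch I \<tau> z = (\<Prod>i<N. num_qpoch I ?\<tau> ((z + of_nat i) / of_nat N))" .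
  moreover have "den_qpoch I \<tau> z = (\<Prod>i<N. den_qpoch I ?\<tau> ((z + of_nat i) / of_nat N))"
    unfolding den_qpoch_def parts r mult[of "z - sum \<tau> (neg_part I \<tau>)"]
    by (simp add: diff_divide_distrib add_divide_distrib sum_divide_distrib algebra_simps)
  ultimately show ?thesis
    unfolding gen_G_def parts
    by (simp add: prod_powi_distrib prod.distrib power_int_mult_distrib)
qed


text \<open>The direction of \<open>qpoch_shift\<close> depends on the half-plane, since reflection
  turns the step \<open>\<tau> j\<close> into its negative in the lower one. The multiplicative form
  stays valid at zeros.\<close>

lemma num_den_qpoch_shift:
  assumes "nonreal I \<tau>" "j \<in> I"
  shows "Im (\<tau> j) > 0 \<Longrightarrow> num_qpoch I \<tau> (z + \<tau> j) = num_qpoch (I - {j}) \<tau> z * num_qpoch I \<tau> z"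
    and "Im (\<tau> j) > 0 \<Longrightarrow> den_qpoch I \<tau> z = den_qpoch (I - {j}) \<tau> z * den_qpoch I \<tau> (z + \<tau> j)"
    and "Im (\<tau> j) < 0 \<Longrightarrow> num_qpoch I \<tau> z = num_qpoch (I - {j}) \<tau> z * num_qpoch I \<tau> (z + \<tau> j)"
    and "Im (\<tau> j) < 0 \<Longrightarrow> den_qpoch I \<tau> (z + \<tau> j) = den_qpoch (I - {j}) \<tau> z * den_qpoch I \<tau> z"
proof -
  have I: "finite I" using assms by (simp add: nonreal_def)
  note shift = qpoch_shift[OF upper_reflect[OF assms(1)] assms(2)]
  have parts: "pos_part (I - {j}) \<tau> = pos_part I \<tau> - {j}" "neg_part (I - {j}) \<tau> = neg_part I \<tau> - {j}"
    by (auto simp: pos_part_def neg_part_def)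
  have fp: "finite (pos_part I \<tau>)" "finite (neg_part I \<tau>)" using I by (auto simp: pos_part_def neg_part_def)
  {
    assume im: "Im (\<tau> j) > 0"
    have s: "sum \<tau> (pos_part I \<tau>) = \<tau> j + sum \<tau> (pos_part I \<tau> - {j})" "neg_part I \<tau> - {j} = neg_part I \<tau>"
      using im assms(2) sum.remove[OF fp(1), of j \<tau>] by (auto simp: pos_part_def neg_part_def)
    have r: "reflect \<tau> j = \<tau> j" using im by (simp add: reflect_def)
    show "num_qpoch I \<tau> (z + \<tau> j) = num_qpoch (I - {j}) \<tau> z * num_qpoch I \<tau> z"
      unfolding num_qpoch_def parts s shift[of "\<tau> j + sum \<tau> (pos_part I \<tau> - {j}) - (z + \<tau> j)"] r
      by (simp add: algebra_simps)
    show "den_qpoch I \<tau> z = den_qpoch (I - {j}) \<tau> z * den_qpoch I \<tau> (z + \<tau> j)"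
      unfolding den_qpoch_def parts s shift[of "z - sum \<tau> (neg_part I \<tau>)"] r
      by (simp add: algebra_simps)
  }
  {
    assume im: "Im (\<tau> j) < 0"
    have s: "sum \<tau> (neg_part I \<tau>) = \<tau> j + sum \<tau> (neg_part I \<tau> - {j})" "pos_part I \<tau> - {j} = pos_part I \<tau>"
      using im assms(2) sum.remove[OF fp(2), of j \<tau>] by (auto simp: pos_part_def neg_part_def)
    have r: "reflect \<tau> j = - \<tau> j" using im by (simp add: reflect_def)
    show "num_qpoch I \<tau> z = num_qpoch (I - {j}) \<tau> z * num_qpoch I \<tau> (z + \<tau> j)"
      unfolding num_qpoch_def parts s shift[of "sum \<tau> (pos_part I \<tau>) - z"] r
      by (simp add: algebra_simps)
    show "den_qpoch I \<tau> (z + \<tau> j) = den_qpoch (I - {j}) \<tau> z * den_qpoch I \<tau> z"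
      unfolding den_qpoch_def parts s shift[of "z + \<tau> j - (\<tau> j + sum \<tau> (neg_part I \<tau> - {j}))"] r
      by (simp add: algebra_simps)
  }
qed

text \<open>Dividing the shift equations requires that neither point is a zero or a pole. Removing j
  changes the parity of \<open>card I\<close>, and in the lower half-plane also that of
  \<open>card (neg_part I \<tau>)\<close>; this makes the exponents fit.\<close>

lemma gen_G_shift:
  assumes "nonreal I \<tau>" "j \<in> I" "gen_G I \<tau> z \<noteq> 0" "gen_G I \<tau> (z + \<tau> j) \<noteq> 0"
  shows "gen_G I \<tau> (z + \<tau> j) = gen_G I \<tau> z * gen_G (I - {j}) \<tau> z"
proof -
  have I: "finite I" using assms by (simp add: nonreal_def)
  have neg: "neg_part (I - {j}) \<tau> = neg_part I \<tau> - {j}" "finite (neg_part I \<tau>)"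
    using I by (auto simp: neg_part_def)
  have c: "card I = Suc (card (I - {j}))" using card.remove[OF I assms(2)] .
  note nz = assms(3,4)[unfolded gen_G_eq_0_iff]
  show ?thesis
  proof (cases "Im (\<tau> j) > 0")
    case True
    then have n: "neg_part I \<tau> - {j} = neg_part I \<tau>" by (auto simp: neg_part_def)
    show ?thesis
      using num_den_qpoch_shift(1,2)[OF assms(1,2) True, of z] nz
        minus_one_power_cases[of "card (I - {j})"] minus_one_power_cases[of "card (neg_part I \<tau>)"]
      unfolding gen_G_def neg n c by (auto simp: power_int_minus field_simps)
  next
    case False
    then have im: "Im (\<tau> j) < 0" using assms by (auto simp: nonreal_def)
    have n: "card (neg_part I \<tau>) = Suc (card (neg_part I \<tau> - {j}))"
      using im assms(2) by (intro card.remove neg(2)) (simp add: neg_part_def)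
    show ?thesis
      using num_den_qpoch_shift(3,4)[OF assms(1,2) im, of z] nz
        minus_one_power_cases[of "card (I - {j})"] minus_one_power_cases[of "card (neg_part I \<tau> - {j})"]
      unfolding gen_G_def neg(1) n c by (auto simp: power_int_minus field_simps)
  qed
qed

text \<open>With no parameters left, G is \<open>(1 - e2pi (- z)) / (1 - e2pi z)\<close>.\<close>

lemma gen_G_empty:
  assumes "z \<notin> \<int>"
  shows "gen_G {} \<tau> z = - e2pi (- z)"
  using assms e2pi_eq_1_iff[of z]
  by (simp add: gen_G_def num_qpoch_def den_qpoch_def pos_part_def neg_part_def qpoch_empty
      power_int_minus e2pi_minus field_simps)

section \<open>Continuity, holomorphy and zeros of \<open>gen_G\<close>\<close>

lemma tendsto_num_den_qpoch:
  assumes "nonreal I \<tau>0" "(z \<longlongrightarrow> z0) F" "\<And>j. j \<in> I \<Longrightarrow> ((\<lambda>t. \<tau> t j) \<longlongrightarrow> \<tau>0 j) F"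
  shows "((\<lambda>t. num_qpoch I (\<tau> t) (z t)) \<longlongrightarrow> num_qpoch I \<tau>0 z0) F"
    and "((\<lambda>t. den_qpoch I (\<tau> t) (z t)) \<longlongrightarrow> den_qpoch I \<tau>0 z0) F"
    and "eventually (\<lambda>t. nonreal I (\<tau> t) \<and> neg_part I (\<tau> t) = neg_part I \<tau>0) F"
proof -
  have I: "finite I" using assms by (simp add: nonreal_def)
  have "eventually (\<lambda>t. (Im (\<tau> t j) < 0 \<longleftrightarrow> Im (\<tau>0 j) < 0) \<and> (Im (\<tau> t j) > 0 \<longleftrightarrow> Im (\<tau>0 j) > 0)) F"
    if "j \<in> I" for j
  proof -
    note lim = tendsto_Im[OF assms(3)[OF that]]
    have "Im (\<tau>0 j) < 0 \<or> Im (\<tau>0 j) > 0" using assms(1) that by (auto simp: nonreal_def)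
    then show ?thesis
    proof
      assume *: "Im (\<tau>0 j) < 0"
      show ?thesis using order_tendstoD(2)[OF lim *] by eventually_elim (use * in auto)
    next
      assume *: "Im (\<tau>0 j) > 0"
      show ?thesis using order_tendstoD(1)[OF lim *] by eventually_elim (use * in auto)
    qed
  qed
  then have ev: "eventually (\<lambda>t. \<forall>j\<in>I. (Im (\<tau> t j) < 0 \<longleftrightarrow> Im (\<tau>0 j) < 0) \<and> (Im (\<tau> t j) > 0 \<longleftrightarrow> Im (\<tau>0 j) > 0)) F"
    using I by (simp add: eventually_ball_finite)
  \<comment> \<open>Signs of nonzero imaginary parts are eventually constant, so the index sets of
    the two sums do not jump along F.\<close>
  then have parts: "eventually (\<lambda>t. pos_part I (\<tau> t) = pos_part I \<tau>0 \<and> neg_part I (\<tau> t) = neg_part I \<tau>0) F"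
    by eventually_elim (auto simp: pos_part_def neg_part_def)
  from ev parts show "eventually (\<lambda>t. nonreal I (\<tau> t) \<and> neg_part I (\<tau> t) = neg_part I \<tau>0) F"
  proof eventually_elim
    case (elim t)
    then show ?case using assms(1) by (auto simp: nonreal_def neq_iff)
  qed
  have r: "((\<lambda>t. reflect (\<tau> t) j) \<longlongrightarrow> reflect \<tau>0 j) F" if "j \<in> I" for j
  proof (rule Lim_transform_eventually)
    show "((\<lambda>t. if Im (\<tau>0 j) < 0 then - \<tau> t j else \<tau> t j) \<longlongrightarrow> reflect \<tau>0 j) F"
      using assms(3)[OF that] by (auto simp: reflect_def intro: tendsto_minus)
    show "eventually (\<lambda>t. (if Im (\<tau>0 j) < 0 then - \<tau> t j else \<tau> t j) = reflect (\<tau> t) j) F"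
      using ev by eventually_elim (use that in \<open>auto simp: reflect_def\<close>)
  qed
  have sp: "((\<lambda>t. sum (\<tau> t) (pos_part I \<tau>0)) \<longlongrightarrow> sum \<tau>0 (pos_part I \<tau>0)) F"
    "((\<lambda>t. sum (\<tau> t) (neg_part I \<tau>0)) \<longlongrightarrow> sum \<tau>0 (neg_part I \<tau>0)) F"
    using assms(3) by (auto intro!: tendsto_sum simp: pos_part_def neg_part_def)
  have "((\<lambda>t. sum (\<tau> t) (pos_part I (\<tau> t))) \<longlongrightarrow> sum \<tau>0 (pos_part I \<tau>0)) F"
    using sp(1) by (rule Lim_transform_eventually) (use parts in eventually_elim, auto)
  then show "((\<lambda>t. num_qpoch I (\<tau> t) (z t)) \<longlongrightarrow> num_qpoch I \<tau>0 z0) F"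
    unfolding num_qpoch_def
    by (intro tendsto_qpoch upper_reflect assms r tendsto_intros)
  have "((\<lambda>t. sum (\<tau> t) (neg_part I (\<tau> t))) \<longlongrightarrow> sum \<tau>0 (neg_part I \<tau>0)) F"
    using sp(2) by (rule Lim_transform_eventually) (use parts in eventually_elim, auto)
  then show "((\<lambda>t. den_qpoch I (\<tau> t) (z t)) \<longlongrightarrow> den_qpoch I \<tau>0 z0) F"
    unfolding den_qpoch_def
    by (intro tendsto_qpoch upper_reflect assms r tendsto_intros)
qed

lemma tendsto_gen_G:
  assumes "nonreal I \<tau>0" "gen_G I \<tau>0 z0 \<noteq> 0"
    "(z \<longlongrightarrow> z0) F" "\<And>j. j \<in> I \<Longrightarrow> ((\<lambda>t. \<tau> t j) \<longlongrightarrow> \<tau>0 j) F"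
  shows "((\<lambda>t. gen_G I (\<tau> t) (z t)) \<longlongrightarrow> gen_G I \<tau>0 z0) F"
proof -
  note lim = tendsto_num_den_qpoch[OF assms(1,3,4)]
  have nz: "num_qpoch I \<tau>0 z0 \<noteq> 0" "den_qpoch I \<tau>0 z0 \<noteq> 0"
    using assms(2) by (auto simp: gen_G_eq_0_iff)
  have "((\<lambda>t. (num_qpoch I (\<tau> t) (z t) * den_qpoch I (\<tau> t) (z t) powi (- ((-1) ^ card I)))
     powi ((-1) ^ card (neg_part I \<tau>0))) \<longlongrightarrow> gen_G I \<tau>0 z0) F"
    unfolding gen_G_def using nz by (intro tendsto_intros lim) auto
  then show ?thesis
  proof (rule Lim_transform_eventually)
    show "\<forall>\<^sub>F t in F. (num_qpoch I (\<tau> t) (z t) * den_qpoch I (\<tau> t) (z t) powi (- ((-1) ^ card I)))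
       powi ((-1) ^ card (neg_part I \<tau>0)) = gen_G I (\<tau> t) (z t)"
      using tendsto_num_den_qpoch(3)[OF assms(1,3,4)] by (rule eventually_mono) (auto simp: gen_G_def)
  qed
qed

lemma holomorphic_on_gen_G:
  assumes "nonreal I \<tau>" "f holomorphic_on S" "\<And>z. z \<in> S \<Longrightarrow> gen_G I \<tau> (f z) \<noteq> 0"
  shows "(\<lambda>z. gen_G I \<tau> (f z)) holomorphic_on S"
  using assms(3) upper_reflect[OF assms(1)] unfolding gen_G_eq_0_iff gen_G_def num_qpoch_def den_qpoch_def
  by (intro holomorphic_intros assms(2)) auto

text \<open>A vanishing q-Pochhammer product puts z in the integer span of 1 and the \<tau>'s: s
  records the sign of the reflection, p and q are the indicators of the two parts.\<close>

lemma gen_G_nonzero: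
  assumes "nonreal I \<tau>" "\<And>c k. z \<noteq> of_int c + (\<Sum>j\<in>I. of_int (k j) * \<tau> j)"
  shows "gen_G I \<tau> z \<noteq> 0"
proof
  assume "gen_G I \<tau> z = 0"
  have I: "finite I" using assms by (simp add: nonreal_def)
  have up: "upper I (reflect \<tau>)" using assms by (intro upper_reflect)
  define s where "s = (\<lambda>j. if Im (\<tau> j) < 0 then (- 1) else 1 :: int)"
  have r: "reflect \<tau> j = of_int (s j) * \<tau> j" for j by (simp add: s_def reflect_def)
  define p where "p = (\<lambda>j. if Im (\<tau> j) > 0 then 1 else 0 :: int)"
  define q where "q = (\<lambda>j. if Im (\<tau> j) < 0 then 1 else 0 :: int)"
  have sp: "sum \<tau> (pos_part I \<tau>) = (\<Sum>j\<in>I. of_int (p j) * \<tau> j)"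
    unfolding pos_part_def p_def sum.inter_filter[OF I] by (intro sum.cong) auto
  have sq: "sum \<tau> (neg_part I \<tau>) = (\<Sum>j\<in>I. of_int (q j) * \<tau> j)"
    unfolding neg_part_def q_def sum.inter_filter[OF I] by (intro sum.cong) auto
  from \<open>gen_G I \<tau> z = 0\<close> consider "num_qpoch I \<tau> z = 0" | "den_qpoch I \<tau> z = 0"
    by (auto simp: gen_G_eq_0_iff)
  then show False
  proof cases
    case 1
    then obtain m :: "'a \<Rightarrow> nat" and c :: int where
      "sum \<tau> (pos_part I \<tau>) - z + (\<Sum>j\<in>I. of_nat (m j) * reflect \<tau> j) = of_int c"
      unfolding num_qpoch_def qpoch_eq_0_iff[OF up] by (auto elim!: Ints_cases)
    then have "z = of_int (- c) + (\<Sum>j\<in>I. of_int (p j + int (m j) * s j) * \<tau> j)"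
      unfolding sp r by (simp add: algebra_simps sum.distrib)
    with assms(2) show False by metis
  next
    case 2
    then obtain m :: "'a \<Rightarrow> nat" and c :: int where
      "z - sum \<tau> (neg_part I \<tau>) + (\<Sum>j\<in>I. of_nat (m j) * reflect \<tau> j) = of_int c"
      unfolding den_qpoch_def qpoch_eq_0_iff[OF up] by (auto elim!: Ints_cases)
    then have "z = of_int c + (\<Sum>j\<in>I. of_int (q j - int (m j) * s j) * \<tau> j)"
      unfolding sq r by (simp add: algebra_simps sum.distrib sum_subtractf)
    with assms(2) show False by metis
  qed
qed

section \<open>Multiple Bernoulli polynomials\<close>

definition bern_fps :: "complex \<Rightarrow> complex fps" where
  "bern_fps \<omega> = fps_const \<omega> * fps_X / (fps_exp \<omega> - 1)"

text \<open>The multiple Bernoulli polynomial of equal order and degree, divided by the factorial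
  and by the product of the \<omega>'s: taking the plain coefficient cancels the factorial of
  \<open>multiple_bernoulli\<close> against that of \<open>geom_B\<close>.\<close>

definition gen_B :: "'i set \<Rightarrow> ('i \<Rightarrow> complex) \<Rightarrow> complex \<Rightarrow> complex" where
  "gen_B I \<omega> z = fps_nth (fps_exp z * (\<Prod>j\<in>I. bern_fps (\<omega> j))) (card I) / (\<Prod>j\<in>I. \<omega> j)"

lemma fps_exp_minus_1_nonzero: "\<omega> \<noteq> 0 \<Longrightarrow> fps_exp \<omega> - 1 \<noteq> (0 :: complex fps)"
proof
  assume "\<omega> \<noteq> 0" "fps_exp \<omega> - 1 = 0"
  then have "fps_nth (fps_exp \<omega> - 1) 1 = 0" by simp
  with \<open>\<omega> \<noteq> 0\<close> show False by simp
qed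

lemma bern_fps_mult:
  assumes "\<omega> \<noteq> 0"
  shows "bern_fps \<omega> * (fps_exp \<omega> - 1) = fps_const \<omega> * fps_X"
proof -
  have "subdegree (fps_exp \<omega> - 1) = 1"
    using assms by (intro subdegreeI) auto
  moreover have "subdegree (fps_const \<omega> * fps_X) = 1"
    using assms by (intro subdegreeI) auto
  moreover have "fps_const \<omega> * fps_X \<noteq> 0" using assms by auto
  ultimately have "fps_exp \<omega> - 1 dvd fps_const \<omega> * fps_X"
    using fps_exp_minus_1_nonzero[OF assms] by (simp add: fps_dvd_iff)
  then show ?thesis unfolding bern_fps_def by simp
qed

lemma bern_fps_unique:
  assumes "\<omega> \<noteq> 0" "f * (fps_exp \<omega> - 1) = fps_const \<omega> * fps_X"
  shows "f = bern_fps \<omega>"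
  using bern_fps_mult[OF assms(1)] assms fps_exp_minus_1_nonzero[OF assms(1)]
  by (metis mult_right_cancel)

lemma bern_fps_scale:
  assumes "\<omega> \<noteq> 0" "c \<noteq> 0"
  shows "bern_fps (c * \<omega>) = bern_fps \<omega> oo (fps_const c * fps_X)"
proof -
  let ?c = "fps_const c * fps_X"
  have "(bern_fps \<omega> oo ?c) * (fps_exp (c * \<omega>) - 1) = (bern_fps \<omega> * (fps_exp \<omega> - 1)) oo ?c"
    by (simp add: fps_compose_mult_distrib fps_compose_sub_distrib)
  also have "\<dots> = fps_const (c * \<omega>) * fps_X"
    unfolding bern_fps_mult[OF assms(1)] by (simp add: fps_compose_mult_distrib mult_ac flip: fps_const_mult)
  finally show ?thesis using assms by (intro bern_fps_unique[symmetric]) auto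
qed

lemma bern_fps_nth: "\<omega> \<noteq> 0 \<Longrightarrow> fps_nth (bern_fps \<omega>) k = \<omega> ^ k * fps_nth (bern_fps 1) k"
  using bern_fps_scale[of 1 \<omega>] by (simp add: fps_compose_linear)

text \<open>Geometric sum: \<open>exp (N * \<omega> * t) - 1\<close> is
  \<open>exp (\<omega> * t) - 1\<close> times the sum of the
  \<open>exp (i * \<omega> * t)\<close>.\<close>

lemma bern_fps_distribution:
  assumes "\<omega> \<noteq> 0" "N > 0"
  shows "of_nat N * bern_fps \<omega> = bern_fps (of_nat N * \<omega>) * (\<Sum>i<N. fps_exp (of_nat i * \<omega>))"
proof -
  have "bern_fps (of_nat N * \<omega>) * (\<Sum>i<N. fps_exp (of_nat i * \<omega>)) * (fps_exp \<omega> - 1)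
      = bern_fps (of_nat N * \<omega>) * (fps_exp (of_nat N * \<omega>) - 1)"
    unfolding fps_exp_power_mult[symmetric] power_diff_1_eq[of "fps_exp \<omega>"] by (simp add: mult_ac)
  also have "\<dots> = of_nat N * (bern_fps \<omega> * (fps_exp \<omega> - 1))"
    using assms by (simp add: bern_fps_mult fps_of_nat mult.assoc flip: fps_const_mult)
  finally show ?thesis using fps_exp_minus_1_nonzero[OF assms(1)]
    by (metis mult.assoc mult_right_cancel)
qed

text \<open>The difference of the two exponentials cancels one denominator and leaves
  \<open>\<omega> j * t\<close>; the factor t lowers the degree by one, just as the number of
  parameters drops.\<close>

lemma gen_B_shift:
  assumes "finite I" "j \<in> I" "\<omega> j \<noteq> 0"
  shows "gen_B I \<omega> (z + \<omega> j) = gen_B I \<omega> z + gen_B (I - {j}) \<omega> z"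
proof -
  let ?R = "\<Prod>i\<in>I-{j}. bern_fps (\<omega> i)"
  have P: "(\<Prod>i\<in>I. bern_fps (\<omega> i)) = bern_fps (\<omega> j) * ?R" "(\<Prod>i\<in>I. \<omega> i) = \<omega> j * (\<Prod>i\<in>I-{j}. \<omega> i)"
    using prod.remove[OF assms(1,2)] by auto
  have c: "card I = Suc (card (I - {j}))" using card.remove[OF assms(1,2)] .
  have "fps_exp (z + \<omega> j) * (bern_fps (\<omega> j) * ?R) - fps_exp z * (bern_fps (\<omega> j) * ?R)
      = fps_exp z * ?R * (bern_fps (\<omega> j) * (fps_exp (\<omega> j) - 1))"
    by (simp add: fps_exp_add_mult algebra_simps)
  also have "\<dots> = fps_const (\<omega> j) * (fps_X * (fps_exp z * ?R))"
    unfolding bern_fps_mult[OF assms(3)] by (simp add: mult_ac)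
  finally have "fps_nth (fps_exp (z + \<omega> j) * (bern_fps (\<omega> j) * ?R)) (card I)
      - fps_nth (fps_exp z * (bern_fps (\<omega> j) * ?R)) (card I)
      = \<omega> j * fps_nth (fps_exp z * ?R) (card (I - {j}))"
    unfolding fps_sub_nth[symmetric] c by simp
  then show ?thesis
    unfolding gen_B_def P using assms(3) by (simp add: add_divide_distrib algebra_simps)
qed

lemma prod_fun_upd_remove:
  assumes "finite I" "j \<in> I"
  shows "(\<Prod>k\<in>I. f ((m(j := x)) k)) = f x * (\<Prod>k\<in>I-{j}. f (m k))"
  by (subst prod.remove[OF assms]) (auto intro!: prod.cong)

lemma gen_B_distribution:
  assumes "finite I" "j \<in> I" "\<omega> j \<noteq> 0" "N > 0"
  shows "gen_B I \<omega> z = (\<Sum>i<N. gen_B I (\<omega> (j := of_nat N * \<omega> j)) (z + of_nat i * \<omega> j))"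
proof -
  let ?R = "\<Prod>i\<in>I-{j}. bern_fps (\<omega> i)" and ?w = "\<Prod>i\<in>I-{j}. \<omega> i"
  have P: "(\<Prod>i\<in>I. bern_fps (\<omega> i)) = bern_fps (\<omega> j) * ?R" "(\<Prod>i\<in>I. \<omega> i) = \<omega> j * ?w"
    using prod.remove[OF assms(1,2)] by auto
  have P': "(\<Prod>i\<in>I. bern_fps ((\<omega> (j := of_nat N * \<omega> j)) i)) = bern_fps (of_nat N * \<omega> j) * ?R"
    "(\<Prod>i\<in>I. (\<omega> (j := of_nat N * \<omega> j)) i) = (of_nat N * \<omega> j) * ?w"
    using prod_fun_upd_remove[OF assms(1,2), of bern_fps \<omega>] prod_fun_upd_remove[OF assms(1,2), of "\<lambda>x. x" \<omega>]
    by auto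
  have "(\<Sum>i<N. fps_exp (z + of_nat i * \<omega> j) * (bern_fps (of_nat N * \<omega> j) * ?R))
      = fps_exp z * (bern_fps (of_nat N * \<omega> j) * (\<Sum>i<N. fps_exp (of_nat i * \<omega> j))) * ?R"
    by (simp add: fps_exp_add_mult sum_distrib_left sum_distrib_right mult_ac)
  also have "\<dots> = fps_const (of_nat N) * (fps_exp z * (bern_fps (\<omega> j) * ?R))"
    unfolding bern_fps_distribution[OF assms(3,4), symmetric] by (simp add: fps_of_nat mult_ac)
  finally have "(\<Sum>i<N. fps_nth (fps_exp (z + of_nat i * \<omega> j) * (bern_fps (of_nat N * \<omega> j) * ?R)) (card I))
     = of_nat N * fps_nth (fps_exp z * (bern_fps (\<omega> j) * ?R)) (card I)"
    unfolding fps_sum_nth[symmetric] by simp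
  then show ?thesis
    unfolding gen_B_def P P' sum_divide_distrib[symmetric] using assms(3,4) by simp
qed

text \<open>The coefficient in degree \<open>card I\<close> picks up \<open>c ^ card I\<close>,
  which the product of the \<omega>'s in the denominator cancels.\<close>

lemma gen_B_scale:
  assumes "finite I" "\<And>j. j \<in> I \<Longrightarrow> \<omega> j \<noteq> 0" "c \<noteq> 0"
  shows "gen_B I (\<lambda>j. c * \<omega> j) (c * z) = gen_B I \<omega> z"
proof -
  let ?c = "fps_const c * fps_X"
  have "(\<Prod>j\<in>I. bern_fps (c * \<omega> j)) = (\<Prod>j\<in>I. bern_fps (\<omega> j) oo ?c)"
    using assms by (intro prod.cong refl bern_fps_scale) auto
  then have "fps_exp (c * z) * (\<Prod>j\<in>I. bern_fps (c * \<omega> j)) = (fps_exp z * (\<Prod>j\<in>I. bern_fps (\<omega> j))) oo ?c"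
    by (simp add: fps_compose_mult_distrib fps_compose_prod_distrib)
  then show ?thesis
    unfolding gen_B_def using assms(3)
    by (simp add: fps_compose_linear prod.distrib)
qed

lemma gen_B_cong: "(\<And>j. j \<in> I \<Longrightarrow> \<omega> j = \<omega>' j) \<Longrightarrow> gen_B I \<omega> z = gen_B I \<omega>' z"
  unfolding gen_B_def by (simp cong: prod.cong)

lemma tendsto_fps_mult_nth:
  fixes f g :: "'t \<Rightarrow> complex fps"
  assumes "\<And>k. ((\<lambda>t. fps_nth (f t) k) \<longlongrightarrow> fps_nth f0 k) F" "\<And>k. ((\<lambda>t. fps_nth (g t) k) \<longlongrightarrow> fps_nth g0 k) F"
  shows "((\<lambda>t. fps_nth (f t * g t) k) \<longlongrightarrow> fps_nth (f0 * g0) k) F"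
  unfolding fps_mult_nth by (intro tendsto_intros assms)

lemma tendsto_fps_prod_nth:
  fixes f :: "'t \<Rightarrow> 'i \<Rightarrow> complex fps"
  assumes "\<And>k j. j \<in> I \<Longrightarrow> ((\<lambda>t. fps_nth (f t j) k) \<longlongrightarrow> fps_nth (f0 j) k) F"
  shows "((\<lambda>t. fps_nth (\<Prod>j\<in>I. f t j) k) \<longlongrightarrow> fps_nth (\<Prod>j\<in>I. f0 j) k) F"
  using assms
proof (induction I arbitrary: k rule: infinite_finite_induct)
  case (insert x I)
  then show ?case by (auto intro: tendsto_fps_mult_nth)
qed auto

lemma tendsto_gen_B:
  assumes "finite I" "\<And>j. j \<in> I \<Longrightarrow> \<omega>0 j \<noteq> 0" "(z \<longlongrightarrow> z0) F" "\<And>j. j \<in> I \<Longrightarrow> ((\<lambda>t. \<omega> t j) \<longlongrightarrow> \<omega>0 j) F"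
  shows "((\<lambda>t. gen_B I (\<omega> t) (z t)) \<longlongrightarrow> gen_B I \<omega>0 z0) F"
proof -
  \<comment> \<open>For nonzero \<omega> the coefficient of degree k is a constant times
    \<open>\<omega> ^ k\<close>, hence continuous although \<open>bern_fps\<close> is defined by
    division.\<close>
  have bern: "((\<lambda>t. fps_nth (bern_fps (\<omega> t j)) k) \<longlongrightarrow> fps_nth (bern_fps (\<omega>0 j)) k) F" if "j \<in> I" for j k
  proof (rule Lim_transform_eventually)
    show "((\<lambda>t. \<omega> t j ^ k * fps_nth (bern_fps 1) k) \<longlongrightarrow> fps_nth (bern_fps (\<omega>0 j)) k) F"
      unfolding bern_fps_nth[OF assms(2)[OF that]] by (intro tendsto_intros assms that)
    show "\<forall>\<^sub>F t in F. \<omega> t j ^ k * fps_nth (bern_fps 1) k = fps_nth (bern_fps (\<omega> t j)) k"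
      using tendsto_imp_eventually_ne[OF assms(4)[OF that] assms(2)[OF that]]
      by eventually_elim (simp add: bern_fps_nth[symmetric])
  qed
  have "(\<Prod>j\<in>I. \<omega>0 j) \<noteq> 0" using assms by auto
  then show ?thesis
    unfolding gen_B_def
    by (intro tendsto_divide tendsto_fps_mult_nth tendsto_fps_prod_nth bern tendsto_prod assms)
       (auto intro!: tendsto_intros assms)
qed

lemma holomorphic_on_gen_B [holomorphic_intros]: "gen_B I \<omega> holomorphic_on S"
proof -
  have "gen_B I \<omega> = (\<lambda>z. (\<Sum>i=0..card I. z ^ i / fact i * fps_nth (\<Prod>j\<in>I. bern_fps (\<omega> j)) (card I - i))
     * inverse (\<Prod>j\<in>I. \<omega> j))"
    by (simp add: gen_B_def fps_mult_nth fun_eq_iff field_simps)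
  then show ?thesis by (auto intro!: holomorphic_intros)
qed

section \<open>The modular product\<close>

definition adm :: "'i set \<Rightarrow> ('i \<Rightarrow> complex) \<Rightarrow> bool" where
  "adm I \<omega> \<longleftrightarrow> finite I \<and> (\<forall>j\<in>I. \<omega> j \<noteq> 0) \<and> (\<forall>j\<in>I. \<forall>k\<in>I. j \<noteq> k \<longrightarrow> Im (\<omega> j / \<omega> k) \<noteq> 0)"

text \<open>All zeros and poles of the factors lie in this set. With three or more parameters it can
  accumulate.\<close>

definition int_span :: "'i set \<Rightarrow> ('i \<Rightarrow> complex) \<Rightarrow> complex set" where
  "int_span I \<omega> = range (\<lambda>k::'i \<Rightarrow> int. \<Sum>j\<in>I. of_int (k j) * \<omega> j)"

definition modular_factor :: "'i set \<Rightarrow> ('i \<Rightarrow> complex) \<Rightarrow> 'i \<Rightarrow> complex \<Rightarrow> complex" where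
  "modular_factor I \<omega> k z = gen_G (I - {k}) (\<lambda>j. \<omega> j / \<omega> k) (z / \<omega> k)"

definition modular_prod :: "'i set \<Rightarrow> ('i \<Rightarrow> complex) \<Rightarrow> complex \<Rightarrow> complex" where
  "modular_prod I \<omega> z = (\<Prod>k\<in>I. modular_factor I \<omega> k z) * e2pi (gen_B I \<omega> z)"

lemma int_spanI: "(\<Sum>j\<in>I. of_int (k j) * \<omega> j) \<in> int_span I \<omega>"
  by (auto simp: int_span_def)

lemma int_span_add: "x \<in> int_span I \<omega> \<Longrightarrow> y \<in> int_span I \<omega> \<Longrightarrow> x + y \<in> int_span I \<omega>"
proof -
  assume "x \<in> int_span I \<omega>" "y \<in> int_span I \<omega>"
  then obtain k l where "x = (\<Sum>j\<in>I. of_int (k j) * \<omega> j)" "y = (\<Sum>j\<in>I. of_int (l j) * \<omega> j)"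
    by (auto simp: int_span_def)
  then have "x + y = (\<Sum>j\<in>I. of_int (k j + l j) * \<omega> j)" by (simp add: sum.distrib algebra_simps)
  then show ?thesis using int_spanI by metis
qed

lemma int_span_minus: "x \<in> int_span I \<omega> \<Longrightarrow> - x \<in> int_span I \<omega>"
proof -
  assume "x \<in> int_span I \<omega>"
  then obtain k where "x = (\<Sum>j\<in>I. of_int (k j) * \<omega> j)" by (auto simp: int_span_def)
  then have "- x = (\<Sum>j\<in>I. of_int (- k j) * \<omega> j)" by (simp add: sum_negf)
  then show ?thesis using int_spanI by metis
qed

lemma int_span_base: "finite I \<Longrightarrow> j \<in> I \<Longrightarrow> of_int c * \<omega> j \<in> int_span I \<omega>"
  using int_spanI[of "\<lambda>i. if i = j then c else 0" \<omega> I]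
  by (simp add: if_distrib[of of_int] if_distrib[of "\<lambda>x. x * _"] cong: if_cong)

lemma int_span_add_iff: "y \<in> int_span I \<omega> \<Longrightarrow> x + y \<in> int_span I \<omega> \<longleftrightarrow> x \<in> int_span I \<omega>"
  using int_span_add int_span_minus by (metis add_diff_cancel_right' diff_conv_add_uminus)

lemma int_span_mono: "finite I \<Longrightarrow> J \<subseteq> I \<Longrightarrow> int_span J \<omega> \<subseteq> int_span I \<omega>"
proof
  fix x assume I: "finite I" "J \<subseteq> I" and "x \<in> int_span J \<omega>"
  then obtain k where "x = (\<Sum>j\<in>J. of_int (k j) * \<omega> j)" by (auto simp: int_span_def)
  also have "\<dots> = (\<Sum>j\<in>I. of_int (if j \<in> J then k j else 0) * \<omega> j)"
    using I by (intro sum.mono_neutral_cong_left) auto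
  finally show "x \<in> int_span I \<omega>" by (simp only: int_spanI)
qed

lemma int_span_multiple: "int_span I (\<lambda>j. of_nat (M j) * \<omega> j) \<subseteq> int_span I \<omega>"
proof
  fix x assume "x \<in> int_span I (\<lambda>j. of_nat (M j) * \<omega> j)"
  then obtain k where "x = (\<Sum>j\<in>I. of_int (k j) * (of_nat (M j) * \<omega> j))" by (auto simp: int_span_def)
  also have "\<dots> = (\<Sum>j\<in>I. of_int (k j * int (M j)) * \<omega> j)" by (simp add: mult_ac)
  finally show "x \<in> int_span I \<omega>" by (simp only: int_spanI)
qed

lemma countable_int_span: "finite I \<Longrightarrow> countable (int_span I \<omega>)"
proof -
  assume I: "finite I"
  have "int_span I \<omega> \<subseteq> (\<lambda>k. \<Sum>j\<in>I. of_int (k j) * \<omega> j) ` (I \<rightarrow>\<^sub>E (UNIV :: int set))"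
  proof
    fix x assume "x \<in> int_span I \<omega>"
    then obtain k where "x = (\<Sum>j\<in>I. of_int (k j) * \<omega> j)" by (auto simp: int_span_def)
    then have "x = (\<Sum>j\<in>I. of_int (restrict k I j) * \<omega> j)" by simp
    then show "x \<in> (\<lambda>k. \<Sum>j\<in>I. of_int (k j) * \<omega> j) ` (I \<rightarrow>\<^sub>E UNIV)"
      by (rule image_eqI[where x = "restrict k I"]) auto
  qed
  then show ?thesis by (rule countable_subset) (auto intro!: countable_image countable_PiE I)
qed

lemma adm_subset: "adm I \<omega> \<Longrightarrow> J \<subseteq> I \<Longrightarrow> adm J \<omega>"
  unfolding adm_def by (meson finite_subset subsetD)

lemma adm_nonreal: "adm I \<omega> \<Longrightarrow> k \<in> I \<Longrightarrow> nonreal (I - {k}) (\<lambda>j. \<omega> j / \<omega> k)"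
  unfolding adm_def nonreal_def by auto

text \<open>Multiplying by \<open>\<omega> k\<close> maps the integer span of 1 and the ratios
  \<open>\<omega> j / \<omega> k\<close> onto that of the \<omega>'s.\<close>

lemma modular_factor_nonzero:
  assumes "adm I \<omega>" "k \<in> I" "z \<notin> int_span I \<omega>"
  shows "modular_factor I \<omega> k z \<noteq> 0"
  unfolding modular_factor_def
proof (rule gen_G_nonzero[OF adm_nonreal[OF assms(1,2)]])
  fix c :: int and n :: "'a \<Rightarrow> int"
  have k: "\<omega> k \<noteq> 0" and I: "finite I" using assms by (auto simp: adm_def)
  show "z / \<omega> k \<noteq> of_int c + (\<Sum>j\<in>I - {k}. of_int (n j) * (\<omega> j / \<omega> k))"
  proof
    assume "z / \<omega> k = of_int c + (\<Sum>j\<in>I - {k}. of_int (n j) * (\<omega> j / \<omega> k))"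
    then have "z = \<omega> k * (of_int c + (\<Sum>j\<in>I - {k}. of_int (n j) * (\<omega> j / \<omega> k)))"
      using k by (simp add: field_simps)
    also have "\<dots> = of_int c * \<omega> k + (\<Sum>j\<in>I - {k}. of_int (n j) * \<omega> j)"
      using k by (simp add: sum_distrib_left algebra_simps)
    also have "\<dots> = (\<Sum>j\<in>I. of_int ((n(k := c)) j) * \<omega> j)"
      using sum_fun_upd_remove[OF I assms(2), of "\<lambda>j x. of_int x * \<omega> j" n c] by simp
    finally show False using assms(3) int_spanI[of "n(k := c)" \<omega> I] by simp
  qed
qed

lemma modular_prod_nonzero:
  "adm I \<omega> \<Longrightarrow> z \<notin> int_span I \<omega> \<Longrightarrow> modular_prod I \<omega> z \<noteq> 0"
  using modular_factor_nonzero[of I \<omega>] by (auto simp: modular_prod_def adm_def)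

text \<open>The factor k = j is periodic because \<open>z / \<omega> j\<close> moves by 1; each
  other factor gains the corresponding factor of the family without j, and the exponential gains its
  Bernoulli term.\<close>

lemma modular_prod_shift:
  assumes "adm I \<omega>" "j \<in> I" "z \<notin> int_span I \<omega>"
  shows "modular_prod I \<omega> (z + \<omega> j) = modular_prod I \<omega> z * modular_prod (I - {j}) \<omega> z"
proof -
  have I: "finite I" and nz: "\<And>k. k \<in> I \<Longrightarrow> \<omega> k \<noteq> 0" using assms by (auto simp: adm_def)
  have z': "z + \<omega> j \<notin> int_span I \<omega>"
    using assms(3) int_span_add_iff[of "\<omega> j" I \<omega> z] int_span_base[OF I assms(2), of 1 \<omega>] by simp
  have 1: "modular_factor I \<omega> j (z + \<omega> j) = modular_factor I \<omega> j z"
    unfolding modular_factor_def using nz[OF assms(2)] by (intro gen_G_cong) (auto simp: diff_divide_distrib[symmetric])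
  have 2: "modular_factor I \<omega> k (z + \<omega> j) = modular_factor I \<omega> k z * modular_factor (I - {j}) \<omega> k z"
    if "k \<in> I - {j}" for k
  proof -
    have k: "k \<in> I" "k \<noteq> j" using that by auto
    have "I - {k} - {j} = I - {j} - {k}" by auto
    then show ?thesis
      using gen_G_shift[OF adm_nonreal[OF assms(1) k(1)], of j "z / \<omega> k"] k assms(2)
        modular_factor_nonzero[OF assms(1) k(1) assms(3)] modular_factor_nonzero[OF assms(1) k(1) z']
      unfolding modular_factor_def by (simp add: add_divide_distrib)
  qed
  have "(\<Prod>k\<in>I. modular_factor I \<omega> k (z + \<omega> j))
     = modular_factor I \<omega> j z * (\<Prod>k\<in>I-{j}. modular_factor I \<omega> k z * modular_factor (I - {j}) \<omega> k z)"
    unfolding prod.remove[OF I assms(2)] 1 using 2 by simp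
  also have "\<dots> = (\<Prod>k\<in>I. modular_factor I \<omega> k z) * (\<Prod>k\<in>I-{j}. modular_factor (I - {j}) \<omega> k z)"
    unfolding prod.remove[OF I assms(2), of "\<lambda>k. modular_factor I \<omega> k z"] prod.distrib by simp
  finally show ?thesis
    unfolding modular_prod_def gen_B_shift[of I j \<omega> z, OF I assms(2) nz[OF assms(2)]] e2pi_add
    by (simp add: mult_ac)
qed

text \<open>Start of the induction: \<open>gen_B\<close> is \<open>z / \<omega> k - 1/2\<close>, and
  the summand 1/2 produces the sign that cancels the one in \<open>gen_G_empty\<close>.\<close>

lemma modular_prod_singleton:
  assumes "\<omega> k \<noteq> 0" "z \<notin> int_span {k} \<omega>"
  shows "modular_prod {k} \<omega> z = 1"
proof -
  have zi: "z / \<omega> k \<notin> \<int>"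
  proof
    assume "z / \<omega> k \<in> \<int>"
    then obtain c where "z / \<omega> k = of_int c" by (auto elim: Ints_cases)
    then have "z = of_int c * \<omega> k" using assms(1) by (simp add: field_simps)
    then show False using assms(2) int_span_base[of "{k}" k c \<omega>] by simp
  qed
  have B: "fps_nth (bern_fps (\<omega> k) * (fps_exp (\<omega> k) - 1)) m = fps_nth (fps_const (\<omega> k) * fps_X) m" for m
    using bern_fps_mult[OF assms(1)] by simp
  have T0: "fps_nth (bern_fps (\<omega> k)) 0 = 1"
    using B[of 1] assms(1) by (simp add: fps_mult_nth)
  have T1: "fps_nth (bern_fps (\<omega> k)) 1 = - \<omega> k / 2"
  proof -
    have "\<omega> k * (\<omega> k + 2 * fps_nth (bern_fps (\<omega> k)) 1) = 0"
      using B[of 2] T0 by (simp add: fps_mult_nth numeral_2_eq_2 field_simps)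
    then have "2 * fps_nth (bern_fps (\<omega> k)) 1 = - \<omega> k"
      using assms(1) unfolding mult_eq_0_iff by (simp only: eq_neg_iff_add_eq_0 add.commute simp_thms)
    then show ?thesis by (simp add: field_simps)
  qed
  have "gen_B {k} \<omega> z = z / \<omega> k - 1/2"
    using assms(1) T0 T1 by (simp add: gen_B_def fps_mult_nth field_simps)
  moreover have "e2pi (1/2) = -1" by (simp add: e2pi_def)
  ultimately show ?thesis
    unfolding modular_prod_def modular_factor_def
    by (simp add: gen_G_empty[OF zi] e2pi_add e2pi_minus diff_conv_add_uminus[of "z / \<omega> k"] del: add_uminus_conv_diff)
qed

text \<open>Stretching \<open>\<omega> j\<close> acts in two ways: the factor at j has its argument
  and all its moduli divided by N, which is the multiplication formula; the other factors have one
  modulus multiplied by N, which is the distribution formula.\<close>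

lemma modular_prod_distribution:
  assumes "adm I \<omega>" "j \<in> I" "N > 0"
  shows "modular_prod I \<omega> z = (\<Prod>i<N. modular_prod I (\<omega> (j := of_nat N * \<omega> j)) (z + of_nat i * \<omega> j))"
proof -
  let ?\<omega> = "\<omega> (j := of_nat N * \<omega> j)"
  have I: "finite I" and nz: "\<And>k. k \<in> I \<Longrightarrow> \<omega> k \<noteq> 0" using assms by (auto simp: adm_def)
  have "modular_factor I \<omega> k z = (\<Prod>i<N. modular_factor I ?\<omega> k (z + of_nat i * \<omega> j))" if k: "k \<in> I" for k
  proof (cases "k = j")
    case True
    have "modular_factor I \<omega> j z =
        (\<Prod>i<N. gen_G (I - {j}) (\<lambda>l. \<omega> l / \<omega> j / of_nat N) ((z / \<omega> j + of_nat i) / of_nat N))"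
      unfolding modular_factor_def by (rule gen_G_multiplication[OF adm_nonreal[OF assms(1,2)] assms(3)])
    also have "\<dots> = (\<Prod>i<N. modular_factor I ?\<omega> j (z + of_nat i * \<omega> j))"
      unfolding modular_factor_def
      using nz[OF assms(2)] assms(3) by (intro prod.cong refl gen_G_cong) (auto simp: field_simps)
    finally show ?thesis using True by simp
  next
    case False
    have "modular_factor I \<omega> k z = (\<Prod>i<N. gen_G (I - {k}) ((\<lambda>l. \<omega> l / \<omega> k)(j := of_nat N * (\<omega> j / \<omega> k)))
        (z / \<omega> k + of_nat i * (\<omega> j / \<omega> k)))"
      unfolding modular_factor_def using False assms(2)
      by (intro gen_G_distribution[OF adm_nonreal[OF assms(1) k] _ assms(3)]) auto
    also have "\<dots> = (\<Prod>i<N. modular_factor I ?\<omega> k (z + of_nat i * \<omega> j))"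
      unfolding modular_factor_def
      using False by (intro prod.cong refl gen_G_cong) (auto simp: add_divide_distrib)
    finally show ?thesis .
  qed
  then have "(\<Prod>k\<in>I. modular_factor I \<omega> k z) = (\<Prod>i<N. \<Prod>k\<in>I. modular_factor I ?\<omega> k (z + of_nat i * \<omega> j))"
    by (simp add: prod.swap[of _ "{..<N}"])
  moreover have "e2pi (gen_B I \<omega> z) = (\<Prod>i<N. e2pi (gen_B I ?\<omega> (z + of_nat i * \<omega> j)))"
    unfolding gen_B_distribution[of I j \<omega> N z, OF I assms(2) nz[OF assms(2)] assms(3)]
    by (simp add: e2pi_def sum_distrib_left exp_sum)
  ultimately show ?thesis by (simp add: modular_prod_def prod.distrib)
qed

lemma modular_prod_scale:
  assumes "adm I \<omega>" "c \<noteq> 0"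
  shows "modular_prod I (\<lambda>j. c * \<omega> j) (c * z) = modular_prod I \<omega> z"
  using assms gen_B_scale[of I \<omega> c z] by (simp add: modular_prod_def modular_factor_def adm_def)

lemma modular_prod_cong: "(\<And>j. j \<in> I \<Longrightarrow> \<omega> j = \<omega>' j) \<Longrightarrow> modular_prod I \<omega> z = modular_prod I \<omega>' z"
proof -
  assume *: "\<And>j. j \<in> I \<Longrightarrow> \<omega> j = \<omega>' j"
  have "modular_factor I \<omega> k z = modular_factor I \<omega>' k z" if "k \<in> I" for k
    unfolding modular_factor_def using * that by (intro gen_G_cong) auto
  then show ?thesis using gen_B_cong[of I \<omega> \<omega>'] * by (simp add: modular_prod_def)
qed

section \<open>Determination of the constant\<close>

definition modular_const :: "'i set \<Rightarrow> ('i \<Rightarrow> complex) \<Rightarrow> bool" where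
  "modular_const I \<omega> \<longleftrightarrow> (\<exists>c. \<forall>z. z \<notin> int_span I \<omega> \<longrightarrow> modular_prod I \<omega> z = c)"

lemma adm_multiple:
  assumes "adm I \<omega>" "\<And>j. j \<in> I \<Longrightarrow> M j > 0"
  shows "adm I (\<lambda>j. of_nat (M j) * \<omega> j)"
proof -
  have im: "Im (of_real r * w) = r * Im w" for r w by simp
  have "Im (of_nat (M j) * \<omega> j / (of_nat (M k) * \<omega> k)) \<noteq> 0" if "j \<in> I" "k \<in> I" "j \<noteq> k" for j k
  proof -
    have "of_nat (M j) * \<omega> j / (of_nat (M k) * \<omega> k) = of_real (real (M j) / real (M k)) * (\<omega> j / \<omega> k)" by simp
    then have "Im (of_nat (M j) * \<omega> j / (of_nat (M k) * \<omega> k)) = real (M j) / real (M k) * Im (\<omega> j / \<omega> k)"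
      by (simp only: im)
    then show ?thesis using assms that by (auto simp: adm_def)
  qed
  then show ?thesis using assms by (auto simp: adm_def)
qed

text \<open>N = 2 gives c^D = 1 for D = 2^n - 1. Then N = D applies: D divides D^n, so c = c^(D^n) =
  1.\<close>

lemma eq_1_if_power_fixed:
  fixes c :: complex
  assumes "c \<noteq> 0" "n > 0" "\<And>N. N > 0 \<Longrightarrow> c ^ (N ^ n) = c"
  shows "c = 1"
proof -
  define D where "D = (2::nat) ^ n - 1"
  have "(2::nat) ^ n \<ge> 2 ^ 1" using assms(2) by (intro power_increasing) auto
  then have D: "D > 0" "2 ^ n = Suc D" by (auto simp: D_def)
  have "c * c ^ D = c" using assms(3)[of 2] D by simp
  then have "c ^ D = 1" using assms(1) by simp
  moreover have "D ^ n = D * D ^ (n - 1)" using assms(2) by (simp add: power_eq_if)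
  ultimately have "c ^ (D ^ n) = 1" by (simp add: power_mult)
  then show ?thesis using assms(3)[OF D(1)] by simp
qed

text \<open>Stretching the parameters one at a time passes through families with unequal multiples
  of the \<omega>'s; constancy is therefore assumed for every choice of positive multipliers
  M.\<close>

lemma modular_prod_eq_1_if_const:
  assumes "adm I \<omega>" "I \<noteq> {}" "z \<notin> int_span I \<omega>"
    and const: "\<And>M. (\<And>j. j \<in> I \<Longrightarrow> M j > 0) \<Longrightarrow> modular_const I (\<lambda>j. of_nat (M j) * \<omega> j)"
  shows "modular_prod I \<omega> z = 1"
proof -
  have I: "finite I" and nz: "\<And>k. k \<in> I \<Longrightarrow> \<omega> k \<noteq> 0" using assms by (auto simp: adm_def)
  let ?P = "\<lambda>M. modular_prod I (\<lambda>j. of_nat (M j) * \<omega> j)"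
  have eq: "?P M x = ?P M y" if "\<And>j. j \<in> I \<Longrightarrow> M j > 0" "x \<notin> int_span I \<omega>" "y \<notin> int_span I \<omega>" for M x y
    using const[of M] that int_span_multiple[of I M \<omega>] unfolding modular_const_def by blast
  \<comment> \<open>Induction over the set K of parameters already stretched: each further stretch
    gives an N-fold product of equal values, so the exponent is multiplied by N.\<close>
  have step: "?P M z = ?P (\<lambda>j. if j \<in> K then N * M j else M j) z ^ (N ^ card K)"
    if "N > 0" "\<And>j. j \<in> I \<Longrightarrow> M j > 0" "K \<subseteq> I" for N M K
    using finite_subset[OF that(3) I] that(3)
  proof (induction K rule: finite_induct)
    case empty
    then show ?case by simp
  next
    case (insert k K)
    let ?M = "\<lambda>j. if j \<in> K then N * M j else M j" and ?M' = "\<lambda>j. if j \<in> insert k K then N * M j else M j"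
    have pos: "\<And>j. j \<in> I \<Longrightarrow> ?M j > 0" "\<And>j. j \<in> I \<Longrightarrow> ?M' j > 0" using that by auto
    have admM: "adm I (\<lambda>j. of_nat (?M j) * \<omega> j)"
      by (rule adm_multiple[OF assms(1)]) (use pos in auto)
    have fu: "(\<lambda>j. of_nat (?M j) * \<omega> j)(k := of_nat N * (of_nat (?M k) * \<omega> k)) = (\<lambda>j. of_nat (?M' j) * \<omega> j)"
      using insert.hyps by (auto simp: fun_eq_iff)
    have "?P ?M z = (\<Prod>i<N. ?P ?M' (z + of_nat i * (of_nat (?M k) * \<omega> k)))"
      using modular_prod_distribution[OF admM, where j = k and N = N and z = z] insert.prems that(1)
      unfolding fu by simp
    also have "\<dots> = (\<Prod>i<N. ?P ?M' z)"
    proof (intro prod.cong refl eq pos(2) assms(3))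
      fix i
      have "of_int (int i * int (?M k)) * \<omega> k \<in> int_span I \<omega>"
        using insert.prems by (intro int_span_base I) auto
      then show "z + of_nat i * (of_nat (?M k) * \<omega> k) \<notin> int_span I \<omega>"
        using assms(3) int_span_add_iff[of "of_int (int i * int (?M k)) * \<omega> k" I \<omega> z] by (simp add: mult.assoc)
    qed
    finally have "?P ?M z = ?P ?M' z ^ N" by simp
    then show ?case using insert by (simp add: power_mult[symmetric])
  qed
  let ?c = "modular_prod I \<omega> z"
  have "?c ^ (N ^ card I) = ?c" if N: "N > 0" for N
  proof -
    have zz: "of_nat N * (z / of_nat N) = z" using N by simp
    have zN: "z / of_nat N \<notin> int_span I \<omega>"
    proof
      assume "z / of_nat N \<in> int_span I \<omega>"
      then obtain k where "z / of_nat N = (\<Sum>j\<in>I. of_int (k j) * \<omega> j)" by (auto simp: int_span_def)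
      then have "z = of_nat N * (\<Sum>j\<in>I. of_int (k j) * \<omega> j)" using N by (simp add: field_simps)
      also have "\<dots> = (\<Sum>j\<in>I. of_int (int N * k j) * \<omega> j)" by (simp add: sum_distrib_left mult_ac)
      finally show False using assms(3) int_spanI by metis
    qed
    have "?c = ?P (\<lambda>j. if j \<in> I then N * 1 else 1) z ^ (N ^ card I)"
      using step[OF N, of "\<lambda>_. 1" I] by simp
    \<comment> \<open>Once all parameters are stretched equally, homogeneity returns to the family
      \<omega> at z / N, and constancy returns to z.\<close>
    also have "?P (\<lambda>j. if j \<in> I then N * 1 else 1) z = modular_prod I (\<lambda>j. of_nat N * \<omega> j) (of_nat N * (z / of_nat N))"
      unfolding zz by (rule modular_prod_cong) simp
    also have "\<dots> = modular_prod I \<omega> (z / of_nat N)"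
      using N by (intro modular_prod_scale assms) auto
    also have "\<dots> = ?c" using eq[of "\<lambda>_. 1" "z / of_nat N" z] zN assms(3) by simp
    finally show ?thesis ..
  qed
  then show ?thesis
    using modular_prod_nonzero[OF assms(1,3)] assms(2) I
    by (intro eq_1_if_power_fixed[of _ "card I"]) (auto simp: card_gt_0_iff)
qed

section \<open>The modular property of the gamma functions\<close>

text \<open>S collects the periods valid at all points off the span. Translation by a span element
  preserves the complement of the span, so S is closed under sums and negation.\<close>

lemma modular_prod_periodic:
  assumes "\<And>j z. j \<in> I \<Longrightarrow> z \<notin> int_span I \<omega> \<Longrightarrow> f (z + \<omega> j) = f z" and I: "finite I"
    and "l \<in> int_span I \<omega>" "z \<notin> int_span I \<omega>"
  shows "f (z + l) = f z"
proof -
  define S where "S = {l \<in> int_span I \<omega>. \<forall>z. z \<notin> int_span I \<omega> \<longrightarrow> f (z + l) = f z}"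
  have nat: "of_nat n * \<omega> j \<in> S" if "j \<in> I" for j n
  proof (induction n)
    case 0
    have "0 \<in> int_span I \<omega>" using int_span_base[OF I that, of 0] by simp
    then show ?case by (simp add: S_def)
  next
    case (Suc n)
    have mem: "of_nat (Suc n) * \<omega> j \<in> int_span I \<omega>" "of_nat n * \<omega> j \<in> int_span I \<omega>"
      using int_span_base[OF I that, of "int (Suc n)"] int_span_base[OF I that, of "int n"] by auto
    have "f (z + of_nat (Suc n) * \<omega> j) = f z" if z: "z \<notin> int_span I \<omega>" for z
    proof -
      have "z + of_nat n * \<omega> j \<notin> int_span I \<omega>" using int_span_add_iff[OF mem(2)] z by simp
      then have "f ((z + of_nat n * \<omega> j) + \<omega> j) = f (z + of_nat n * \<omega> j)" using assms(1) \<open>j \<in> I\<close> by blast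
      also have "\<dots> = f z" using Suc z by (simp add: S_def)
      finally show ?thesis by (simp add: algebra_simps)
    qed
    then show ?case using mem by (simp add: S_def)
  qed
  have neg: "- l \<in> S" if "l \<in> S" for l
  proof -
    have l: "l \<in> int_span I \<omega>" "- l \<in> int_span I \<omega>" using that int_span_minus by (auto simp: S_def)
    have "f (z + - l) = f z" if z: "z \<notin> int_span I \<omega>" for z
    proof -
      have "z + - l \<notin> int_span I \<omega>" using int_span_add_iff[OF l(2)] z by blast
      then have "f ((z + - l) + l) = f (z + - l)" using \<open>l \<in> S\<close> unfolding S_def by blast
      then show ?thesis by simp
    qed
    then show ?thesis using l by (simp add: S_def)
  qed
  have add: "l + l' \<in> S" if "l \<in> S" "l' \<in> S" for l l'
  proof -
    have "f (z + (l + l')) = f z" if z: "z \<notin> int_span I \<omega>" for z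
    proof -
      have "z + l \<notin> int_span I \<omega>" using int_span_add_iff[of l I \<omega> z] z \<open>l \<in> S\<close> by (simp add: S_def)
      then have "f ((z + l) + l') = f z" using \<open>l \<in> S\<close> \<open>l' \<in> S\<close> z by (simp add: S_def)
      then show ?thesis by (simp add: algebra_simps)
    qed
    then show ?thesis using that int_span_add[of l I \<omega> l'] by (simp add: S_def)
  qed
  have int: "of_int n * \<omega> j \<in> S" if "j \<in> I" for j n
    using nat[OF that, of "nat n"] neg[OF nat[OF that, of "nat (- n)"]] by (cases "n \<ge> 0") auto
  obtain k where k: "l = (\<Sum>j\<in>I. of_int (k j) * \<omega> j)" using assms(3) by (auto simp: int_span_def)
  have S0: "0 \<in> S" by (simp add: S_def) (use int_spanI[of "\<lambda>_. 0" \<omega> I] in simp)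
  have "(\<Sum>j\<in>J. of_int (k j) * \<omega> j) \<in> S" if "J \<subseteq> I" for J
    using finite_subset[OF that I] that by (induction J rule: finite_induct) (auto intro: add int S0)
  from this[OF order.refl] show ?thesis using k assms(4) by (simp add: S_def)
qed

lemma holomorphic_on_modular_factor:
  assumes "adm I \<omega>" "k \<in> I" "\<And>z. z \<in> S \<Longrightarrow> modular_factor I \<omega> k z \<noteq> 0"
  shows "modular_factor I \<omega> k holomorphic_on S"
  using assms(3) unfolding modular_factor_def
  by (intro holomorphic_on_gen_G adm_nonreal assms holomorphic_intros) (use assms in \<open>auto simp: adm_def\<close>)

lemma holomorphic_on_modular_prod:
  assumes "adm I \<omega>" "\<And>k z. k \<in> I \<Longrightarrow> z \<in> S \<Longrightarrow> modular_factor I \<omega> k z \<noteq> 0"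
  shows "modular_prod I \<omega> holomorphic_on S"
  unfolding modular_prod_def using assms by (intro holomorphic_intros holomorphic_on_modular_factor) auto

text \<open>\<open>gen_G\<close> itself may jump to 0 at a pole; the set is open because it is
  described by the two entire functions \<open>num_qpoch\<close> and
  \<open>den_qpoch\<close>.\<close>

lemma open_modular_factor_nonzero:
  assumes "adm I \<omega>" "k \<in> I"
  shows "open {z. modular_factor I \<omega> k z \<noteq> 0}"
proof -
  have k: "\<omega> k \<noteq> 0" using assms by (auto simp: adm_def)
  note up = upper_reflect[OF adm_nonreal[OF assms]]
  have "(\<lambda>z. num_qpoch (I - {k}) (\<lambda>j. \<omega> j / \<omega> k) (z / \<omega> k)) holomorphic_on UNIV"
    "(\<lambda>z. den_qpoch (I - {k}) (\<lambda>j. \<omega> j / \<omega> k) (z / \<omega> k)) holomorphic_on UNIV"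
    unfolding num_qpoch_def den_qpoch_def using k by (auto intro!: holomorphic_intros up)
  then have "continuous_on UNIV (\<lambda>z. num_qpoch (I - {k}) (\<lambda>j. \<omega> j / \<omega> k) (z / \<omega> k))"
    "continuous_on UNIV (\<lambda>z. den_qpoch (I - {k}) (\<lambda>j. \<omega> j / \<omega> k) (z / \<omega> k))"
    by (auto intro: holomorphic_on_imp_continuous_on)
  then show ?thesis
    unfolding modular_factor_def gen_G_eq_0_iff de_Morgan_disj Collect_conj_eq
    by (intro open_Int open_Collect_neq continuous_on_const)
qed

text \<open>As q / p is not real, p and q form a real basis; the coordinates of z are split into
  floor and fractional part.\<close>

lemma lattice_reduction:
  assumes "p \<noteq> 0" "Im (q / p) \<noteq> 0"
  shows "\<exists>(a::int) (b::int) (s::real) (t::real). s \<in> {0..1} \<and> t \<in> {0..1} \<and>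
    z = of_int a * p + of_int b * q + (of_real s * p + of_real t * q)"
proof -
  define w where "w = q / p"
  define v where "v = z / p"
  define y where "y = Im v / Im w"
  define x where "x = Re v - y * Re w"
  have "v = of_real x + of_real y * w"
    using assms(2) by (auto simp: complex_eq_iff x_def y_def w_def[symmetric])
  then have "z / p = of_real x + of_real y * (q / p)" by (simp add: w_def v_def)
  then have "z = of_real x * p + of_real y * q" using assms(1) by (simp add: field_simps)
  moreover have "complex_of_real x = of_int \<lfloor>x\<rfloor> + of_real (frac x)" "complex_of_real y = of_int \<lfloor>y\<rfloor> + of_real (frac y)"
    by (simp_all add: frac_def)
  ultimately have "z = of_int \<lfloor>x\<rfloor> * p + of_int \<lfloor>y\<rfloor> * q + (of_real (frac x) * p + of_real (frac y) * q)"
    by (simp add: algebra_simps)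
  moreover have "frac x \<in> {0..1}" "frac y \<in> {0..1}" by (simp_all add: frac_lt_1 less_imp_le)
  ultimately show ?thesis by blast
qed

lemma Im_inverse_neg_iff: "Im (inverse w) < 0 \<longleftrightarrow> Im w > 0"
proof (cases "w = 0")
  case False
  then have "(Re w)\<^sup>2 + (Im w)\<^sup>2 > 0" by (simp add: sum_power2_gt_zero_iff complex_eq_iff)
  then show ?thesis by (simp add: zero_less_divide_iff)
qed simp

lemma compact_parallelogram:
  "compact ((\<lambda>(s, t). of_real s * p + of_real t * q :: complex) ` ({0..1} \<times> {0..1}))"
  by (intro compact_continuous_image compact_Times compact_Icc)
     (auto simp: case_prod_beta intro!: continuous_intros)

lemma tendsto_one_minus_e2pi_over:
  "((\<lambda>z. (1 - e2pi (a * z)) / z) \<longlongrightarrow> - (2 * \<i> * of_real pi * a)) (at 0)"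
proof -
  have "((\<lambda>z. 1 - e2pi (a * z)) has_field_derivative - (2 * \<i> * of_real pi * a)) (at 0)"
    unfolding e2pi_def by (auto intro!: derivative_eq_intros)
  then show ?thesis by (simp add: has_field_derivative_iff)
qed

text \<open>The p-factor is a theta function; the q-factor, whose modulus lies in the lower
  half-plane, is the inverse of one. Splitting off the vanishing factors at 0 gives a finite limit l
  there, and periodicity carries it to all lattice points, so only the behaviour at 0 has to be
  computed.\<close>

lemma modular_const_pair_pos:
  assumes "adm {p, q} \<omega>" "p \<noteq> q" "Im (\<omega> q / \<omega> p) > 0"
  shows "modular_const {p, q} \<omega>"
proof -
  let ?I = "{p, q}" and ?\<Lambda> = "int_span {p, q} \<omega>" and ?P = "modular_prod {p, q} \<omega>"
  have nz: "\<omega> p \<noteq> 0" "\<omega> q \<noteq> 0" using assms by (auto simp: adm_def)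
  define \<tau> where "\<tau> = (\<lambda>j. \<omega> j / \<omega> p)"
  define \<sigma> where "\<sigma> = (\<lambda>j. \<omega> j / \<omega> q)"
  have I: "?I - {p} = {q}" "?I - {q} = {p}" using assms(2) by auto
  have \<tau>: "Im (\<tau> q) > 0" using assms(3) by (simp add: \<tau>_def)
  have "\<sigma> p = inverse (\<tau> q)" using nz by (simp add: \<tau>_def \<sigma>_def)
  then have \<sigma>: "Im (\<sigma> p) < 0" using \<tau> Im_inverse_neg_iff[of "\<tau> q"] by simp
  have up: "upper {q} (reflect \<tau>)" "upper {p} (reflect \<sigma>)"
    using \<tau> \<sigma> by (auto intro!: upper_reflect simp: nonreal_def)
  have r: "reflect \<tau> q = \<tau> q" "reflect \<sigma> p = - \<sigma> p" using \<tau> \<sigma> by (auto simp: reflect_def)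
  \<comment> \<open>H and D are what remains of numerator and denominator once the factor vanishing
    at 0 is removed. Both are entire, and the limit at 0 rests on
    \<open>D 0 \<noteq> 0\<close>.\<close>
  define H where "H = (\<lambda>z. qpoch {q} (reflect \<tau>) (\<tau> q - z / \<omega> p) * qpoch {q} (reflect \<tau>) (z / \<omega> p + \<tau> q)
     * e2pi (gen_B ?I \<omega> z))"
  define D where "D = (\<lambda>z. qpoch {p} (reflect \<sigma>) (- z / \<omega> q - \<sigma> p) * qpoch {p} (reflect \<sigma>) (z / \<omega> q - \<sigma> p))"
  have parts: "pos_part {q} \<tau> = {q}" "neg_part {q} \<tau> = {}" "pos_part {p} \<sigma> = {}" "neg_part {p} \<sigma> = {p}"
    using \<tau> \<sigma> by (auto simp: pos_part_def neg_part_def)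
  have P: "?P z = (1 - e2pi (1 / \<omega> p * z)) / (1 - e2pi ((- 1 / \<omega> q) * z)) * (H z / D z)" for z
  proof -
    have "modular_factor ?I \<omega> p z = qpoch {q} (reflect \<tau>) (\<tau> q - z / \<omega> p) * qpoch {q} (reflect \<tau>) (z / \<omega> p)"
      unfolding modular_factor_def I \<tau>_def[symmetric] gen_G_def num_qpoch_def den_qpoch_def parts by simp
    also have "qpoch {q} (reflect \<tau>) (z / \<omega> p) = (1 - e2pi (z / \<omega> p)) * qpoch {q} (reflect \<tau>) (z / \<omega> p + \<tau> q)"
      using qpoch_shift[OF up(1), of q "z / \<omega> p"] by (simp add: qpoch_empty r)
    finally have 1: "modular_factor ?I \<omega> p z = (1 - e2pi (z / \<omega> p)) *
      (qpoch {q} (reflect \<tau>) (\<tau> q - z / \<omega> p) * qpoch {q} (reflect \<tau>) (z / \<omega> p + \<tau> q))" by simp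
    have "modular_factor ?I \<omega> q z = inverse (qpoch {p} (reflect \<sigma>) (- z / \<omega> q) * qpoch {p} (reflect \<sigma>) (z / \<omega> q - \<sigma> p))"
      unfolding modular_factor_def I \<sigma>_def[symmetric] gen_G_def num_qpoch_def den_qpoch_def parts
      by (simp add: power_int_minus)
    also have "qpoch {p} (reflect \<sigma>) (- z / \<omega> q) = (1 - e2pi (- z / \<omega> q)) * qpoch {p} (reflect \<sigma>) (- z / \<omega> q - \<sigma> p)"
      using qpoch_shift[OF up(2), of p "- z / \<omega> q"] by (simp add: qpoch_empty r)
    finally have 2: "modular_factor ?I \<omega> q z = inverse ((1 - e2pi (- z / \<omega> q)) * D z)"
      by (simp add: D_def mult_ac)
    show ?thesis unfolding modular_prod_def using assms(2)
      by (simp add: 1 2 H_def divide_inverse mult_ac)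
  qed
  have D0: "D 0 \<noteq> 0"
  proof -
    have "qpoch {p} (reflect \<sigma>) (- \<sigma> p) \<noteq> 0"
    proof
      assume "qpoch {p} (reflect \<sigma>) (- \<sigma> p) = 0"
      then obtain m :: nat and c :: int where "- \<sigma> p + of_nat m * (- \<sigma> p) = of_int c"
        unfolding qpoch_eq_0_iff[OF up(2)] by (auto simp: r elim!: Ints_cases)
      then have "Im (- \<sigma> p + of_nat m * (- \<sigma> p)) = 0" by simp
      then have "Im (\<sigma> p) * (1 + real m) = 0" by (simp add: algebra_simps)
      then show False using \<sigma> by simp
    qed
    then show ?thesis by (simp add: D_def)
  qed
  have "H holomorphic_on UNIV" "D holomorphic_on UNIV"
    unfolding H_def D_def using nz by (auto intro!: holomorphic_intros up holomorphic_on_compose_gen[OF _ holomorphic_on_gen_B, unfolded o_def])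
  then have HD: "(H \<longlongrightarrow> H 0) (at 0)" "(D \<longlongrightarrow> D 0) (at 0)"
    using holomorphic_on_imp_continuous_on continuous_on_eq_continuous_at open_UNIV isContD by blast+
  define l where "l = (- (2 * \<i> * of_real pi * (1 / \<omega> p))) / (- (2 * \<i> * of_real pi * (- 1 / \<omega> q))) * (H 0 / D 0)"
  have lim: "(?P \<longlongrightarrow> l) (at 0)"
  proof (rule Lim_transform_eventually)
    show "((\<lambda>z. ((1 - e2pi (1 / \<omega> p * z)) / z) / ((1 - e2pi ((- 1 / \<omega> q) * z)) / z) * (H z / D z)) \<longlongrightarrow> l) (at 0)"
      unfolding l_def using nz D0 by (intro tendsto_intros tendsto_one_minus_e2pi_over HD) auto
    show "\<forall>\<^sub>F z in at 0. ((1 - e2pi (1 / \<omega> p * z)) / z) / ((1 - e2pi ((- 1 / \<omega> q) * z)) / z) * (H z / D z) = ?P z"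
      unfolding P eventually_at by (intro exI[of _ 1]) auto
  qed
  \<comment> \<open>Removing either parameter leaves a one-parameter product, which is 1, so both
    \<omega>'s are periods.\<close>
  have per: "?P (z + x) = ?P z" if "z \<notin> ?\<Lambda>" "x \<in> ?\<Lambda>" for z x
  proof (rule modular_prod_periodic[OF _ _ that(2,1)])
    fix j z assume j: "j \<in> ?I" and z: "z \<notin> ?\<Lambda>"
    obtain k where k: "?I - {j} = {k}" "k \<in> ?I" using j assms(2) by auto
    have "z \<notin> int_span {k} \<omega>" using z int_span_mono[of ?I "{k}" \<omega>] k by auto
    then have "modular_prod {k} \<omega> z = 1" using nz k by (intro modular_prod_singleton) auto
    then show "?P (z + \<omega> j) = ?P z"
      using modular_prod_shift[OF assms(1) j z] k(1) by simp
  qed auto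
  \<comment> \<open>Below d a lattice point has both coefficients 0: after division by
    \<open>\<omega> p\<close>, the imaginary part excludes a multiple of \<open>\<tau> q\<close>,
    and then the norm excludes a nonzero integer.\<close>
  define d where "d = norm (\<omega> p) * min 1 (Im (\<tau> q))"
  have d: "d > 0" using nz \<tau> by (simp add: d_def)
  have disc: "x = 0" if x: "x \<in> ?\<Lambda>" "norm x < d" for x
  proof -
    obtain k where "x = (\<Sum>j\<in>?I. of_int (k j) * \<omega> j)" using x by (auto simp: int_span_def)
    then have "x = of_int (k p) * \<omega> p + of_int (k q) * \<omega> q" using assms(2) by simp
    then have xp: "x / \<omega> p = of_int (k p) + of_int (k q) * \<tau> q"
      using nz by (simp add: \<tau>_def field_simps)
    have "norm (x / \<omega> p) < min 1 (Im (\<tau> q))"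
      unfolding norm_divide using x(2) nz
      by (subst pos_divide_less_eq) (simp_all only: d_def mult.commute zero_less_norm_iff not_False_eq_True)
    then have n: "norm (x / \<omega> p) < 1" "norm (x / \<omega> p) < Im (\<tau> q)" by auto
    have "\<bar>real_of_int (k q)\<bar> * Im (\<tau> q) = \<bar>Im (x / \<omega> p)\<bar>"
      unfolding xp using \<tau> by (simp add: abs_mult)
    also have "\<dots> < 1 * Im (\<tau> q)" using n(2) abs_Im_le_cmod[of "x / \<omega> p"] by linarith
    finally have "\<bar>real_of_int (k q)\<bar> < 1" using \<tau> mult_less_cancel_right_pos by blast
    then have kq: "k q = 0" by linarith
    then have "\<bar>real_of_int (k p)\<bar> < 1" using n(1) unfolding xp by simp
    then have "k p = 0" by linarith
    with xp kq nz show ?thesis by simp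
  qed
  have sep: "y = x" if "x \<in> ?\<Lambda>" "y \<in> ?\<Lambda>" "norm (y - x) < d" for x y
    using disc[of "y - x"] int_span_add[OF that(2) int_span_minus[OF that(1)]] that(3) by simp
  have closed: "closed ?\<Lambda>" using discrete_imp_closed[OF d] sep by (metis dist_norm)
  \<comment> \<open>At lattice points \<open>?P\<close> may have a mere conventional value; it is
    replaced by the common limit l.\<close>
  define Q where "Q = (\<lambda>z. if z \<in> ?\<Lambda> then l else ?P z)"
  have "?P holomorphic_on - ?\<Lambda>"
    using modular_factor_nonzero[OF assms(1)] by (intro holomorphic_on_modular_prod[OF assms(1)]) auto
  then have Qhol: "Q holomorphic_on - ?\<Lambda>"
    by (rule holomorphic_transform) (simp add: Q_def)
  have Qper: "Q (z + x) = Q z" if "x \<in> ?\<Lambda>" for z x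
    using per that by (simp add: Q_def int_span_add_iff)
  have z0: "0 \<in> ?\<Lambda>" using int_spanI[of "\<lambda>_. 0" \<omega> ?I] by simp
  have Q0: "(Q \<longlongrightarrow> Q 0) (at 0)"
  proof (rule Lim_transform_eventually)
    show "(?P \<longlongrightarrow> Q 0) (at 0)" using lim z0 by (simp add: Q_def)
    show "\<forall>\<^sub>F z in at 0. ?P z = Q z"
      unfolding eventually_at using d disc by (auto simp: Q_def dist_norm)
  qed
  have Qc: "isCont Q x" if "x \<in> ?\<Lambda>" for x
  proof -
    have "((\<lambda>h. Q (x + h)) \<longlongrightarrow> Q (x + 0)) (at 0)"
      using Q0 Qper[OF that] Qper[OF that, of 0] by (simp add: add.commute[of x])
    then show ?thesis by (simp add: LIM_isCont_iff isCont_iff)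
  qed
  have Qd: "Q field_differentiable (at x)" for x
  proof (cases "x \<in> ?\<Lambda>")
    case False
    then show ?thesis using Qhol closed by (intro holomorphic_on_imp_differentiable_at[of Q "- ?\<Lambda>"]) auto
  next
    case True
    have sub: "ball x d - {x} \<subseteq> - ?\<Lambda>"
      using sep[OF True] by (auto simp: dist_norm norm_minus_commute)
    have "Q holomorphic_on ball x d"
    proof (rule no_isolated_singularity)
      show h: "Q holomorphic_on (ball x d - {x})" using Qhol sub by (rule holomorphic_on_subset)
      show "continuous_on (ball x d) Q"
      proof (rule continuous_at_imp_continuous_on, rule ballI)
        fix y assume "y \<in> ball x d"
        then show "isCont Q y"
          using Qc[OF True] holomorphic_on_imp_continuous_on[OF h] continuous_on_eq_continuous_at[of "ball x d - {x}" Q]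
          by (cases "y = x") (auto simp: open_delete)
      qed
    qed auto
    then show ?thesis using d by (intro holomorphic_on_imp_differentiable_at[of Q "ball x d"]) auto
  qed
  then have Qh: "Q holomorphic_on UNIV" by (simp add: holomorphic_on_def)
  \<comment> \<open>Every value of Q is already taken on this closed fundamental parallelogram, so Q
    is bounded.\<close>
  let ?K = "(\<lambda>(s, t). of_real s * \<omega> p + of_real t * \<omega> q :: complex) ` ({0..1} \<times> {0..1})"
  have "continuous_on ?K Q"
    by (rule continuous_on_subset[OF holomorphic_on_imp_continuous_on[OF Qh]]) simp
  then have "compact (Q ` ?K)" by (rule compact_continuous_image) (rule compact_parallelogram)
  moreover have "range Q \<subseteq> Q ` ?K"
  proof (rule image_subsetI)
    fix z
    have im: "Im (\<omega> q / \<omega> p) \<noteq> 0" using assms(3) by simp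
    obtain a b :: int and s t :: real where st: "s \<in> {0..1}" "t \<in> {0..1}"
      "z = of_int a * \<omega> p + of_int b * \<omega> q + (of_real s * \<omega> p + of_real t * \<omega> q)"
      using lattice_reduction[OF nz(1) im, of z] by (elim exE conjE) (rule that)
    have "of_int a * \<omega> p + of_int b * \<omega> q \<in> ?\<Lambda>" by (intro int_span_add int_span_base) auto
    then have "Q z = Q (of_real s * \<omega> p + of_real t * \<omega> q)"
      using Qper st(3) by (simp add: add.commute)
    moreover have "of_real s * \<omega> p + of_real t * \<omega> q \<in> ?K"
      by (rule image_eqI[where x = "(s, t)"]) (use st in auto)
    ultimately show "Q z \<in> Q ` ?K" by (rule image_eqI)
  qed
  ultimately have "bounded (range Q)" using bounded_subset compact_imp_bounded by blast
  then have "Q constant_on UNIV" using Liouville_theorem[OF Qh] by (simp add: constant_on_def)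
  then obtain c where "\<And>z. Q z = c" by (auto simp: constant_on_def)
  then have "?P z = c" if "z \<notin> ?\<Lambda>" for z using that by (metis Q_def)
  then show ?thesis by (auto simp: modular_const_def)
qed

lemma modular_const_pair:
  assumes "adm {p, q} \<omega>" "p \<noteq> q"
  shows "modular_const {p, q} \<omega>"
proof -
  have "Im (\<omega> q / \<omega> p) \<noteq> 0" using assms by (auto simp: adm_def)
  then consider "Im (\<omega> q / \<omega> p) > 0" | "Im (\<omega> q / \<omega> p) < 0" by linarith
  then show ?thesis
  proof cases
    case 1
    then show ?thesis by (intro modular_const_pair_pos assms)
  next
    case 2
    have "inverse (\<omega> p / \<omega> q) = \<omega> q / \<omega> p" using assms by (simp add: adm_def)
    then have "Im (\<omega> p / \<omega> q) > 0" using 2 Im_inverse_neg_iff[of "\<omega> p / \<omega> q"] by simp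
    then show ?thesis using modular_const_pair_pos[of q p \<omega>] assms by (simp add: insert_commute)
  qed
qed

text \<open>The multiples \<open>k * \<omega> r\<close>, reduced modulo \<open>\<omega> p\<close>
  and \<open>\<omega> q\<close>, lie in one compact parallelogram. By \<open>irr\<close> they are
  pairwise distinct, so they accumulate, and differences of two of them are short nonzero span
  elements.\<close>

lemma int_span_accumulates:
  assumes "adm I \<omega>" "p \<in> I" "q \<in> I" "r \<in> I" "p \<noteq> q"
    and irr: "\<And>a b. \<omega> r \<noteq> of_rat a * \<omega> p + of_rat b * \<omega> q"
    and "e > 0"
  obtains l where "l \<in> int_span I \<omega>" "l \<noteq> 0" "norm l < e"
proof -
  have I: "finite I" and p: "\<omega> p \<noteq> 0" "Im (\<omega> q / \<omega> p) \<noteq> 0" using assms by (auto simp: adm_def)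
  let ?K = "(\<lambda>(s, t). of_real s * \<omega> p + of_real t * \<omega> q :: complex) ` ({0..1} \<times> {0..1})"
  have "\<exists>a b :: int. of_nat k * \<omega> r - of_int a * \<omega> p - of_int b * \<omega> q \<in> ?K" for k :: nat
  proof -
    obtain a b :: int and s t :: real where st: "s \<in> {0..1}" "t \<in> {0..1}"
      "of_nat k * \<omega> r = of_int a * \<omega> p + of_int b * \<omega> q + (of_real s * \<omega> p + of_real t * \<omega> q)"
      using lattice_reduction[OF p, of "of_nat k * \<omega> r"] by (elim exE conjE) (rule that)
    then have "of_nat k * \<omega> r - of_int a * \<omega> p - of_int b * \<omega> q = (\<lambda>(s, t). of_real s * \<omega> p + of_real t * \<omega> q) (s, t)"
      by simp
    then show ?thesis using st(1,2) by (metis (no_types, lifting) SigmaI image_eqI)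
  qed
  then obtain a b :: "nat \<Rightarrow> int" where ab: "\<And>k. of_nat k * \<omega> r - of_int (a k) * \<omega> p - of_int (b k) * \<omega> q \<in> ?K"
    by metis
  define f where "f = (\<lambda>k. of_nat k * \<omega> r - of_int (a k) * \<omega> p - of_int (b k) * \<omega> q)"
  have "inj f"
  proof (rule injI, rule ccontr)
    fix k k' assume eq: "f k = f k'" "k \<noteq> k'"
    define c where "c = int k - int k'"
    have c: "c \<noteq> 0" using eq(2) by (simp add: c_def)
    have "of_int c * \<omega> r = of_int (a k - a k') * \<omega> p + of_int (b k - b k') * \<omega> q"
      using eq(1) by (simp add: f_def c_def algebra_simps)
    then have "\<omega> r = of_rat (of_int (a k - a k') / of_int c) * \<omega> p + of_rat (of_int (b k - b k') / of_int c) * \<omega> q"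
      using c by (simp add: of_rat_divide field_simps del: of_int_diff)
    then show False using irr by blast
  qed
  then have "infinite (range f)" by (simp add: range_inj_infinite)
  moreover have "range f \<subseteq> ?K" using ab by (auto simp: f_def)
  ultimately obtain x where x: "x islimpt range f"
    using compact_parallelogram unfolding compact_eq_Bolzano_Weierstrass by metis
  obtain y where y: "y \<in> range f" "y \<noteq> x" "dist y x < e / 2"
    using x assms(7) unfolding islimpt_approachable by (meson half_gt_zero)
  \<comment> \<open>Being strictly nearer to x than y is what makes y' different from y.\<close>
  obtain y' where y': "y' \<in> range f" "y' \<noteq> x" "dist y' x < min (e / 2) (dist y x)"
    using x assms(7) y unfolding islimpt_approachable by (meson half_gt_zero min_less_iff_conj zero_less_dist_iff)
  have mem: "f k \<in> int_span I \<omega>" for k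
  proof -
    have "of_int (int k) * \<omega> r + of_int (- a k) * \<omega> p + of_int (- b k) * \<omega> q \<in> int_span I \<omega>"
      using assms by (intro int_span_add int_span_base I)
    then show ?thesis by (simp add: f_def)
  qed
  show ?thesis
  proof
    show "y - y' \<in> int_span I \<omega>"
      using y(1) y'(1) int_span_add[OF mem int_span_minus[OF mem]] by auto
    show "y - y' \<noteq> 0" using y'(3) by auto
    show "norm (y - y') < e"
      using y(3) y'(3) dist_triangle2[of y y' x] by (simp add: dist_norm[symmetric])
  qed
qed

text \<open>\<open>modular_prod\<close> takes its value at z0 on all of
  \<open>z0 + ?\<Lambda>\<close>, and these points accumulate at z0; the identity theorem spreads
  the value.\<close>

lemma modular_const_generic:
  assumes "adm I \<omega>" "p \<in> I" "q \<in> I" "r \<in> I" "p \<noteq> q"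
    and "\<And>a b. \<omega> r \<noteq> of_rat a * \<omega> p + of_rat b * \<omega> q"
    and per: "\<And>j z. j \<in> I \<Longrightarrow> z \<notin> int_span I \<omega> \<Longrightarrow> modular_prod I \<omega> (z + \<omega> j) = modular_prod I \<omega> z"
  shows "modular_const I \<omega>"
proof -
  let ?\<Lambda> = "int_span I \<omega>" and ?P = "modular_prod I \<omega>"
  have I: "finite I" using assms by (auto simp: adm_def)
  \<comment> \<open>The span accumulates, so it cannot be cut out as a closed set. Z contains only
    the points where some factor vanishes; it is closed, and being countable it leaves a connected
    complement.\<close>
  define Z where "Z = {z. \<exists>k\<in>I. modular_factor I \<omega> k z = 0}"
  have "- Z = (\<Inter>k\<in>I. {z. modular_factor I \<omega> k z \<noteq> 0})" by (auto simp: Z_def)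
  then have op: "open (- Z)" using I open_modular_factor_nonzero[OF assms(1)] by auto
  have ZL: "Z \<subseteq> ?\<Lambda>" using modular_factor_nonzero[OF assms(1)] by (auto simp: Z_def)
  then have "countable Z" using countable_int_span[OF I] countable_subset by blast
  then have con: "connected (UNIV - Z)" by (intro connected_open_diff_countable) auto
  have hol: "?P holomorphic_on (UNIV - Z)"
    by (intro holomorphic_on_modular_prod assms) (auto simp: Z_def)
  have "?P z = ?P z0" if z: "z \<notin> ?\<Lambda>" "z0 \<notin> ?\<Lambda>" for z z0
  proof -
    let ?U = "(+) z0 ` ?\<Lambda>"
    have "(\<lambda>w. ?P w - ?P z0) z = 0"
    proof (rule analytic_continuation[of "\<lambda>w. ?P w - ?P z0" "UNIV - Z" ?U z0])
      show "(\<lambda>w. ?P w - ?P z0) holomorphic_on (UNIV - Z)" using hol by (intro holomorphic_intros)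
      show "open (UNIV - Z)" using op by (simp add: Compl_eq_Diff_UNIV)
      show "?U \<subseteq> UNIV - Z"
      proof
        fix w assume "w \<in> ?U"
        then obtain l where "l \<in> ?\<Lambda>" "w = z0 + l" by auto
        then have "w \<notin> ?\<Lambda>" using int_span_add_iff[of l I \<omega> z0] z(2) by simp
        then show "w \<in> UNIV - Z" using ZL by blast
      qed
      show "z0 islimpt ?U"
        unfolding islimpt_approachable
      proof (intro allI impI)
        fix e :: real assume "e > 0"
        then obtain l where "l \<in> ?\<Lambda>" "l \<noteq> 0" "norm l < e"
          using int_span_accumulates[OF assms(1-6)] by blast
        then show "\<exists>x'\<in>?U. x' \<noteq> z0 \<and> dist x' z0 < e"
          by (intro bexI[of _ "z0 + l"]) (auto simp: dist_norm)
      qed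
      show "\<And>w. w \<in> ?U \<Longrightarrow> ?P w - ?P z0 = 0"
        using modular_prod_periodic[OF per I _ z(2)] by auto
    qed (use con z ZL in auto)
    then show ?thesis by simp
  qed
  then show ?thesis unfolding modular_const_def by blast
qed

lemma tendsto_modular_factor:
  assumes "adm I \<omega>0" "k \<in> I" "modular_factor I \<omega>0 k z0 \<noteq> 0"
    "\<And>j. j \<in> I \<Longrightarrow> ((\<lambda>t. \<omega> t j) \<longlongrightarrow> \<omega>0 j) F" "(z \<longlongrightarrow> z0) F"
  shows "((\<lambda>t. modular_factor I (\<omega> t) k (z t)) \<longlongrightarrow> modular_factor I \<omega>0 k z0) F"
  using assms(3) unfolding modular_factor_def
  by (intro tendsto_gen_G adm_nonreal tendsto_divide assms) (use assms in \<open>auto simp: adm_def\<close>)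

lemma tendsto_modular_prod:
  assumes "adm I \<omega>0" "\<And>k. k \<in> I \<Longrightarrow> modular_factor I \<omega>0 k z0 \<noteq> 0"
    "\<And>j. j \<in> I \<Longrightarrow> ((\<lambda>t. \<omega> t j) \<longlongrightarrow> \<omega>0 j) F" "(z \<longlongrightarrow> z0) F"
  shows "((\<lambda>t. modular_prod I (\<omega> t) (z t)) \<longlongrightarrow> modular_prod I \<omega>0 z0) F"
  unfolding modular_prod_def
  by (intro tendsto_intros tendsto_modular_factor tendsto_gen_B assms) (use assms in \<open>auto simp: adm_def\<close>)

lemma eventually_adm:
  assumes "adm I \<omega>0" "\<And>j. j \<in> I \<Longrightarrow> ((\<lambda>t. \<omega> t j) \<longlongrightarrow> \<omega>0 j) F"
  shows "eventually (\<lambda>t. adm I (\<omega> t)) F"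
proof -
  have I: "finite I" and nz: "\<And>j. j \<in> I \<Longrightarrow> \<omega>0 j \<noteq> 0" using assms by (auto simp: adm_def)
  have "eventually (\<lambda>t. \<forall>j\<in>I. \<omega> t j \<noteq> 0) F"
    by (intro eventually_ball_finite I ballI) (rule tendsto_imp_eventually_ne[OF assms(2) nz])
  moreover have "eventually (\<lambda>t. j \<noteq> k \<longrightarrow> Im (\<omega> t j / \<omega> t k) \<noteq> 0) F" if "j \<in> I" "k \<in> I" for j k
  proof (cases "j = k")
    case False
    then have "Im (\<omega>0 j / \<omega>0 k) \<noteq> 0" using assms that by (auto simp: adm_def)
    moreover have "((\<lambda>t. Im (\<omega> t j / \<omega> t k)) \<longlongrightarrow> Im (\<omega>0 j / \<omega>0 k)) F"
      using nz that by (intro tendsto_intros assms) auto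
    ultimately show ?thesis by (auto dest: tendsto_imp_eventually_ne elim: eventually_mono)
  qed auto
  then have "eventually (\<lambda>t. \<forall>j\<in>I. \<forall>k\<in>I. j \<noteq> k \<longrightarrow> Im (\<omega> t j / \<omega> t k) \<noteq> 0) F"
    using I by (auto simp: eventually_ball_finite)
  ultimately show ?thesis by eventually_elim (use I in \<open>auto simp: adm_def\<close>)
qed

lemma avoid_countable_sequence:
  fixes x :: complex
  assumes "\<And>n. countable (C n)"
  shows "\<exists>y :: nat \<Rightarrow> complex. (\<forall>n. y n \<notin> C n) \<and> y \<longlonglongrightarrow> x"
proof -
  have "\<exists>y. y \<notin> C n \<and> dist y x < inverse (real (Suc n))" for n
  proof -
    have "uncountable (ball x (inverse (real (Suc n))))" by (intro uncountable_ball) auto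
    then have "\<not> ball x (inverse (real (Suc n))) \<subseteq> C n" using assms countable_subset by blast
    then show ?thesis by (auto simp: dist_commute)
  qed
  then obtain y where y: "\<And>n. y n \<notin> C n" "\<And>n. dist (y n) x < inverse (real (Suc n))" by metis
  have "(\<lambda>n. dist (y n) x) \<longlonglongrightarrow> 0"
    using y(2) LIMSEQ_inverse_real_of_nat
    by (rule_tac tendsto_sandwich[of "\<lambda>_. 0" _ _ "\<lambda>n. inverse (real (Suc n))"]) (auto simp: less_imp_le)
  then have "y \<longlonglongrightarrow> x" by (rule tendsto_dist_iff[THEN iffD2])
  then show ?thesis using y(1) by blast
qed

text \<open>Serves two purposes: with a constant sequence of parameters it reaches points of the
  span where no factor vanishes, with a varying one it reaches nongeneric parameters. The
  approximating points avoid the countable spans.\<close>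

lemma modular_prod_eq_1_limit:
  assumes "adm I \<omega>0" "\<And>k. k \<in> I \<Longrightarrow> modular_factor I \<omega>0 k z0 \<noteq> 0"
    "\<And>j. j \<in> I \<Longrightarrow> (\<lambda>n. \<omega> n j) \<longlonglongrightarrow> \<omega>0 j"
    "\<And>n z. adm I (\<omega> n) \<Longrightarrow> z \<notin> int_span I (\<omega> n) \<Longrightarrow> modular_prod I (\<omega> n) z = 1"
  shows "modular_prod I \<omega>0 z0 = 1"
proof -
  have I: "finite I" using assms by (auto simp: adm_def)
  obtain z where z: "\<And>n. z n \<notin> int_span I (\<omega> n)" "z \<longlonglongrightarrow> z0"
    using avoid_countable_sequence[of "\<lambda>n. int_span I (\<omega> n)" z0, OF countable_int_span[OF I]] by metis
  have "(\<lambda>n. modular_prod I (\<omega> n) (z n)) \<longlonglongrightarrow> modular_prod I \<omega>0 z0"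
    by (intro tendsto_modular_prod assms z) auto
  moreover have "eventually (\<lambda>n. modular_prod I (\<omega> n) (z n) = 1) sequentially"
    using eventually_adm[OF assms(1,3)] by (rule eventually_mono) (use assms(4) z(1) in auto)
  then have "(\<lambda>n. modular_prod I (\<omega> n) (z n)) \<longlonglongrightarrow> 1" by (rule tendsto_eventually)
  ultimately show ?thesis using LIMSEQ_unique by blast
qed

text \<open>Nonvanishing of the factors, in place of z lying off the span, is an open condition in z
  and \<omega> together, as the domain of the modular property requires.\<close>

theorem modular_prod_eq_1:
  assumes "adm I \<omega>" "I \<noteq> {}" "\<And>k. k \<in> I \<Longrightarrow> modular_factor I \<omega> k z \<noteq> 0"
  shows "modular_prod I \<omega> z = 1"
  using assms
proof (induction "card I" arbitrary: I \<omega> z rule: less_induct)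
  case less
  have I: "finite I" using less.prems by (auto simp: adm_def)
  \<comment> \<open>The induction hypothesis is consumed here. The parameters are arbitrary because
    the later steps rescale and perturb them.\<close>
  have per: "modular_prod I \<omega>' (z + \<omega>' j) = modular_prod I \<omega>' z"
    if "adm I \<omega>'" "card I \<ge> 2" "j \<in> I" "z \<notin> int_span I \<omega>'" for j \<omega>' z
  proof -
    have lt: "card (I - {j}) < card I" and sub: "I - {j} \<subseteq> I"
      using that card_Diff1_less[OF I] by auto
    have "card (I - {j}) \<noteq> 0" using that card_Diff_singleton[of j I] by simp
    then have ne: "I - {j} \<noteq> {}" by (metis card.empty)
    have adm: "adm (I - {j}) \<omega>'" using adm_subset[OF that(1) sub] .
    have "z \<notin> int_span (I - {j}) \<omega>'" using that(4) int_span_mono[OF I sub] by blast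
    then have "modular_prod (I - {j}) \<omega>' z = 1"
      using less.hyps[OF lt adm ne] modular_factor_nonzero[OF adm] by blast
    then show ?thesis using modular_prod_shift[OF that(1,3,4)] by simp
  qed
  have "card I > 0" using I less.prems by (simp add: card_gt_0_iff)
  then consider "card I = 1" | "card I = 2" | "card I \<ge> 3" by linarith
  then show ?case
  proof cases
    case 1
    then obtain k where k: "I = {k}" by (auto simp: card_1_singleton_iff)
    show ?thesis
    proof (rule modular_prod_eq_1_limit[OF less.prems(1,3), of "\<lambda>_. \<omega>"])
      show "modular_prod I \<omega> y = 1" if "y \<notin> int_span I \<omega>" for y
        using that less.prems(1) unfolding k by (intro modular_prod_singleton) (auto simp: adm_def)
    qed auto
  next
    case 2
    then obtain p q where pq: "I = {p, q}" "p \<noteq> q" by (auto simp: card_2_iff)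
    show ?thesis
    proof (rule modular_prod_eq_1_limit[OF less.prems(1,3), of "\<lambda>_. \<omega>"])
      show "modular_prod I \<omega> y = 1" if "y \<notin> int_span I \<omega>" for y
      proof (rule modular_prod_eq_1_if_const[OF less.prems(1,2) that])
        fix M :: "'a \<Rightarrow> nat" assume M: "\<And>j. j \<in> I \<Longrightarrow> M j > 0"
        have "adm I (\<lambda>j. of_nat (M j) * \<omega> j)" by (rule adm_multiple[OF less.prems(1)]) (use M in auto)
        then show "modular_const I (\<lambda>j. of_nat (M j) * \<omega> j)"
          unfolding pq(1) by (rule modular_const_pair[OF _ pq(2)])
      qed
    qed auto
  next
    case 3
    obtain J where J: "J \<subseteq> I" "card J = 3" using obtain_subset_with_card_n[OF 3] by metis
    then obtain p q r where pqr: "J = {p, q, r}" "p \<noteq> q" "q \<noteq> r" "p \<noteq> r" by (auto simp: card_3_iff)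
    have mem: "p \<in> I" "q \<in> I" "r \<in> I" using J pqr by auto
    \<comment> \<open>Genericity means that \<open>\<omega>' r\<close> lies outside the rational
      span of \<open>\<omega>' p\<close> and \<open>\<omega>' q\<close>; it is inherited by all
      positive integer multiples of the parameters.\<close>
    have generic: "modular_prod I \<omega>' y = 1"
      if adm: "adm I \<omega>'" and y: "y \<notin> int_span I \<omega>'" and irr: "\<And>a b. \<omega>' r \<noteq> of_rat a * \<omega>' p + of_rat b * \<omega>' q" for \<omega>' y
    proof (rule modular_prod_eq_1_if_const[OF adm less.prems(2) y])
      fix M :: "'a \<Rightarrow> nat" assume M: "\<And>j. j \<in> I \<Longrightarrow> M j > 0"
      have admM: "adm I (\<lambda>j. of_nat (M j) * \<omega>' j)" by (rule adm_multiple[OF adm]) (use M in auto)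
      show "modular_const I (\<lambda>j. of_nat (M j) * \<omega>' j)"
      proof (rule modular_const_generic[OF admM mem pqr(2)])
        fix a b
        show "of_nat (M r) * \<omega>' r \<noteq> of_rat a * (of_nat (M p) * \<omega>' p) + of_rat b * (of_nat (M q) * \<omega>' q)"
        proof
          assume "of_nat (M r) * \<omega>' r = of_rat a * (of_nat (M p) * \<omega>' p) + of_rat b * (of_nat (M q) * \<omega>' q)"
          then have "\<omega>' r = of_rat (a * of_nat (M p) / of_nat (M r)) * \<omega>' p + of_rat (b * of_nat (M q) / of_nat (M r)) * \<omega>' q"
            using M[OF mem(3)] by (simp add: of_rat_divide of_rat_mult field_simps)
          then show False using irr by blast
        qed
      next
        fix j z assume "j \<in> I" "z \<notin> int_span I (\<lambda>j. of_nat (M j) * \<omega>' j)"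
        then show "modular_prod I (\<lambda>j. of_nat (M j) * \<omega>' j) (z + of_nat (M j) * \<omega>' j)
          = modular_prod I (\<lambda>j. of_nat (M j) * \<omega>' j) z"
          using per[OF admM] 3 by simp
      qed
    qed
    \<comment> \<open>A countable set, so \<open>\<omega> r\<close> is a limit of values for which
      the family is generic; all other parameters stay fixed.\<close>
    define C where "C = range (\<lambda>(a, b). of_rat a * \<omega> p + of_rat b * \<omega> q)"
    have "countable C" unfolding C_def by (intro countable_image) auto
    then have "\<exists>t. (\<forall>n::nat. t n \<notin> C) \<and> t \<longlonglongrightarrow> \<omega> r"
      by (rule avoid_countable_sequence)
    then obtain t where t: "\<forall>n::nat. t n \<notin> C" "t \<longlonglongrightarrow> \<omega> r"
      by (elim exE conjE) (rule that)
    show ?thesis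
    proof (rule modular_prod_eq_1_limit[OF less.prems(1,3), of "\<lambda>n. \<omega> (r := t n)"])
      show "(\<lambda>n. (\<omega> (r := t n)) j) \<longlonglongrightarrow> \<omega> j" for j
        using t(2) by (cases "j = r") auto
      show "modular_prod I (\<omega> (r := t n)) y = 1"
        if "adm I (\<omega> (r := t n))" "y \<notin> int_span I (\<omega> (r := t n))" for n y
      proof (rule generic[OF that])
        fix a b
        have "of_rat a * \<omega> p + of_rat b * \<omega> q \<in> C"
          unfolding C_def by (rule range_eqI[where x = "(a, b)"]) simp
        then have "t n \<noteq> of_rat a * \<omega> p + of_rat b * \<omega> q" using t(1) by metis
        then show "(\<omega> (r := t n)) r \<noteq> of_rat a * (\<omega> (r := t n)) p + of_rat b * (\<omega> (r := t n)) q"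
          using pqr by simp
      qed
    qed auto
  qed
qed

section \<open>Lattices with a basis\<close>

lemma det_in_Ints:
  fixes A :: "rat mat"
  assumes "A \<in> carrier_mat n n" "\<And>i j. i < n \<Longrightarrow> j < n \<Longrightarrow> A $$ (i, j) \<in> \<int>"
  shows "Determinant.det A \<in> \<int>"
  unfolding det_def'[OF assms(1)]
proof (intro Ints_sum Ints_mult Ints_prod)
  fix p and i assume "p \<in> {p. p permutes {0..<n}}" "i \<in> {0..<n}"
  then show "A $$ (i, p i) \<in> \<int>" using assms(2) permutes_in_image[of p "{0..<n}" i] by auto
qed (auto simp: sign_def)

lemma common_denominator:
  fixes c :: "nat \<Rightarrow> rat"
  obtains D :: int where "D > 0" "\<And>i. i < n \<Longrightarrow> of_int D * c i \<in> \<int>"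
proof
  let ?d = "\<lambda>i. snd (quotient_of (c i))"
  show "(\<Prod>i<n. ?d i) > 0" by (intro prod_pos) (simp add: quotient_of_denom_pos')
  fix i assume i: "i < n"
  obtain p q where pq: "quotient_of (c i) = (p, q)" by fastforce
  then have "c i = of_int p / of_int q" "q > 0" by (auto simp: quotient_of_div quotient_of_denom_pos)
  then have "of_int (?d i) * c i = of_int p" using pq by simp
  moreover have "(\<Prod>i<n. ?d i) = ?d i * (\<Prod>k\<in>{..<n}-{i}. ?d k)" using i by (intro prod.remove) auto
  ultimately have "of_int (\<Prod>i<n. ?d i) * c i = of_int ((\<Prod>k\<in>{..<n}-{i}. ?d k) * p)"
    by (simp add: mult_ac)
  then show "of_int (\<Prod>i<n. ?d i) * c i \<in> \<int>" by (simp only: Ints_of_int)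
qed

context based_lattice
begin

text \<open>Through \<open>of_rat\<close> one notion serves both the rational forms of
  \<open>dual_lattice\<close> and the complex ones of \<open>HomC\<close>.\<close>

definition lin_form :: "('v \<Rightarrow> 'k::field_char_0) \<Rightarrow> bool" where
  "lin_form x \<longleftrightarrow> (\<forall>u v. x (u + v) = x u + x v) \<and> (\<forall>r u. x (scale r u) = of_rat r * x u)"

lemma lin_form_add: "lin_form x \<Longrightarrow> x (u + v) = x u + x v"
  and lin_form_scale: "lin_form x \<Longrightarrow> x (scale r u) = of_rat r * x u"
  by (auto simp: lin_form_def)

lemma lin_form_scale_int: "lin_form x \<Longrightarrow> x (scale (of_int k) u) = of_int k * x u"
  by (simp add: lin_form_scale)

lemma lin_form_0: "lin_form x \<Longrightarrow> x 0 = 0"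
  using lin_form_scale[of x 0 0] by simp

lemma lin_form_minus: "lin_form x \<Longrightarrow> x (- u) = - x u"
  using lin_form_scale[of x "-1" u] by simp

lemma lin_form_diff: "lin_form x \<Longrightarrow> x (u - v) = x u - x v"
  using lin_form_add[of x u "- v"] by (simp add: lin_form_minus)

lemma lin_form_sum: "lin_form x \<Longrightarrow> x (\<Sum>i\<in>A. f i) = (\<Sum>i\<in>A. x (f i))"
  by (induction A rule: infinite_finite_induct) (simp_all add: lin_form_0 lin_form_add)

lemma HomC_iff: "x \<in> HomC \<longleftrightarrow> lin_form x"
  unfolding HomC_def lin_form_def Vector_Spaces.linear_iff
  by (auto intro!: vector_space_axioms simp: vector_space_def algebra_simps of_rat_add of_rat_mult)

lemma dual_lattice_iff: "y \<in> dual_lattice \<longleftrightarrow> lin_form y \<and> (\<forall>u\<in>L. y u \<in> \<int>)"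
  unfolding dual_lattice_def lin_form_def Vector_Spaces.linear_iff
  by (auto intro!: vector_space_axioms simp: vector_space_def algebra_simps)

lemma coord_sum: "(\<Sum>i<n. scale (coord u i) (e i)) = u"
proof -
  have "(\<Sum>b\<in>e ` {..<n}. scale (representation (e ` {..<n}) u b) b) = u"
    using independent_e span_e by (intro sum_representation_eq) auto
  then show ?thesis unfolding coord_def by (simp add: sum.reindex[OF inj_e] o_def)
qed

lemma lin_form_coord: "lin_form (\<lambda>u. coord u i)"
  unfolding lin_form_def coord_def using independent_e span_e
  by (auto simp: representation_add representation_scale)

lemma coord_e: "i < n \<Longrightarrow> k < n \<Longrightarrow> coord (e k) i = (if i = k then 1 else 0)"
  unfolding coord_def using independent_e inj_e
  by (subst representation_basis) (auto simp: inj_on_eq_iff)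

lemma coord_sum_scale: "k < n \<Longrightarrow> coord (\<Sum>i<n. scale (c i) (e i)) k = c k"
proof -
  assume k: "k < n"
  have "coord (\<Sum>i<n. scale (c i) (e i)) k = (\<Sum>i<n. c i * coord (e i) k)"
    by (simp add: lin_form_sum[OF lin_form_coord] lin_form_scale[OF lin_form_coord])
  also have "\<dots> = (\<Sum>i<n. if i = k then c i else 0)"
    using k by (intro sum.cong) (auto simp: coord_e)
  also have "\<dots> = c k" using k by simp
  finally show ?thesis .
qed

lemma eq_coordI: "(\<And>i. i < n \<Longrightarrow> coord u i = coord v i) \<Longrightarrow> u = v"
proof -
  assume "\<And>i. i < n \<Longrightarrow> coord u i = coord v i"
  then have "(\<Sum>i<n. scale (coord u i) (e i)) = (\<Sum>i<n. scale (coord v i) (e i))"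
    by (intro sum.cong) auto
  then show "u = v" by (simp only: coord_sum)
qed

lemma lin_form_expand: "lin_form x \<Longrightarrow> x u = (\<Sum>i<n. of_rat (coord u i) * x (e i))"
  using lin_form_sum[of x "\<lambda>i. scale (coord u i) (e i)" "{..<n}"] by (simp add: coord_sum lin_form_scale)

lemma mem_L_iff: "u \<in> L \<longleftrightarrow> (\<forall>i<n. coord u i \<in> \<int>)"
proof
  assume "u \<in> L"
  then obtain c :: "nat \<Rightarrow> int" where "u = (\<Sum>i<n. scale (of_int (c i)) (e i))" by (auto simp: L_def)
  then show "\<forall>i<n. coord u i \<in> \<int>" by (simp add: coord_sum_scale)
next
  assume *: "\<forall>i<n. coord u i \<in> \<int>"
  have "(\<Sum>i<n. scale (coord u i) (e i)) = (\<Sum>i<n. scale (of_int \<lfloor>coord u i\<rfloor>) (e i))"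
    using * by (intro sum.cong) auto
  then have "u = (\<Sum>i<n. scale (of_int \<lfloor>coord u i\<rfloor>) (e i))" by (simp only: coord_sum)
  then show "u \<in> L" by (auto simp: L_def)
qed

lemma e_in_L: "i < n \<Longrightarrow> e i \<in> L"
  by (auto simp: mem_L_iff coord_e)

lemma L_add: "u \<in> L \<Longrightarrow> v \<in> L \<Longrightarrow> u + v \<in> L"
  by (auto simp: mem_L_iff lin_form_add[OF lin_form_coord])

lemma L_diff: "u \<in> L \<Longrightarrow> v \<in> L \<Longrightarrow> u - v \<in> L"
  by (auto simp: mem_L_iff lin_form_diff[OF lin_form_coord])

lemma L_scale: "r \<in> \<int> \<Longrightarrow> u \<in> L \<Longrightarrow> scale r u \<in> L"
  by (auto simp: mem_L_iff lin_form_scale[OF lin_form_coord])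

lemma L_0: "0 \<in> L"
  by (auto simp: mem_L_iff lin_form_0[OF lin_form_coord])

lemma dual_lattice_iff_e: "y \<in> dual_lattice \<longleftrightarrow> lin_form y \<and> (\<forall>i<n. y (e i) \<in> \<int>)"
  unfolding dual_lattice_iff
  by (auto simp: e_in_L) (subst lin_form_expand, auto intro!: Ints_sum Ints_mult simp: mem_L_iff)

lemma coord_dual: "i < n \<Longrightarrow> (\<lambda>u. coord u i) \<in> dual_lattice"
  unfolding dual_lattice_iff_e by (auto simp: lin_form_coord coord_e)

section \<open>Primitive lattice vectors\<close>

lemma primitive_L_iff:
  "primitive_L u \<longleftrightarrow> u \<in> L \<and> (\<forall>(k::int). \<forall>u'\<in>L. u = scale (of_int k) u' \<longrightarrow> \<bar>k\<bar> = 1)"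
  by (simp add: primitive_L_def primitive_in_def)

text \<open>For r = p / q in lowest terms, Bezout coefficients combine \<open>scale r u\<close> and
  u to \<open>scale (1 / q) u\<close>, a lattice vector of which u is the q-fold; primitivity gives
  q = 1.\<close>

lemma primitive_L_scale_Ints:
  assumes "primitive_L u" "scale r u \<in> L"
  shows "r \<in> \<int>"
proof -
  obtain p q where pq: "quotient_of r = (p, q)" by fastforce
  then have r: "r = of_int p / of_int q" "q > 0" "coprime p q"
    by (auto simp: quotient_of_div quotient_of_denom_pos quotient_of_coprime)
  obtain x y where xy: "x * p + y * q = 1" using bezout_int[of p q] r(3) by auto
  define w where "w = scale (of_int x) (scale r u) + scale (of_int y) u"
  have w: "w \<in> L" unfolding w_def using assms by (auto intro!: L_add L_scale[OF Ints_of_int] simp: primitive_L_iff simp del: scale_scale)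
  have "of_int x * r + of_int y = (of_int (x * p + y * q) :: rat) / of_int q"
    using r by (simp add: field_simps)
  then have "w = scale (1 / of_int q) u"
    unfolding w_def scale_scale scale_left_distrib[symmetric] xy by simp
  then have "u = scale (of_int q) w" using r(2) by simp
  then have "\<bar>q\<bar> = 1" using assms(1) w unfolding primitive_L_iff by blast
  then show ?thesis using r by simp
qed

lemma primitive_L_unique:
  assumes "primitive_L u" "primitive_L (scale r u)" "r > 0"
  shows "r = 1"
proof -
  have L: "u \<in> L" "scale r u \<in> L" using assms by (auto simp: primitive_L_iff)
  have "r \<in> \<int>" using primitive_L_scale_Ints[OF assms(1) L(2)] .
  moreover have "1 / r \<in> \<int>"
    using primitive_L_scale_Ints[OF assms(2), of "1 / r"] L(1) assms(3) by simp
  ultimately obtain a b :: int where ab: "r = of_int a" "1 / r = of_int b" by (auto elim!: Ints_cases)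
  then have "of_int (a * b) = (1::rat)" using assms(3) by (simp flip: ab)
  then have "a * b = 1" by linarith
  moreover have "a > 0" using ab assms(3) by simp
  ultimately have "a = 1" using zmult_eq_1_iff by auto
  then show ?thesis using ab by simp
qed

lemma exists_scale_mem_L: "\<exists>D::int. D > 0 \<and> scale (of_int D) u \<in> L"
proof -
  obtain D :: int where "D > 0" "\<And>i. i < n \<Longrightarrow> of_int D * coord u i \<in> \<int>"
    using common_denominator[of n "coord u"] by metis
  then show ?thesis by (auto simp: mem_L_iff lin_form_scale[OF lin_form_coord])
qed

text \<open>Descent on a nonzero coordinate: among the positive multiples of u in L, one with the
  least absolute value of that coordinate is primitive, since a proper divisor would have a smaller
  one.\<close>

lemma exists_primitive_multiple:
  assumes "u \<noteq> 0"
  obtains r where "r > 0" "primitive_L (scale r u)"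
proof -
  obtain i where i: "i < n" "coord u i \<noteq> 0"
    using eq_coordI[of u 0] assms by (auto simp: lin_form_0[OF lin_form_coord])
  define P where "P = (\<lambda>m::nat. \<exists>r>0. scale r u \<in> L \<and> \<bar>r * coord u i\<bar> = of_nat m)"
  obtain D :: int where D: "D > 0" "scale (of_int D) u \<in> L" using exists_scale_mem_L by metis
  then have "of_int D * coord u i \<in> \<int>" using i by (auto simp: mem_L_iff lin_form_scale[OF lin_form_coord])
  then obtain c where "of_int D * coord u i = of_int c" by (auto elim: Ints_cases)
  then have "P (nat \<bar>c\<bar>)" unfolding P_def using D by (intro exI[of _ "of_int D"]) auto
  then have "P (LEAST m. P m)" by (rule LeastI)
  then obtain r where r: "r > 0" "scale r u \<in> L" "\<bar>r * coord u i\<bar> = of_nat (LEAST m. P m)"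
    by (auto simp: P_def)
  have "\<bar>k\<bar> = 1" if k: "u' \<in> L" "scale r u = scale (of_int k) u'" for k :: int and u'
  proof (rule ccontr)
    assume k1: "\<bar>k\<bar> \<noteq> 1"
    have k0: "k \<noteq> 0" using k r assms by auto
    have "scale (r / of_int \<bar>k\<bar>) u = scale (1 / of_int \<bar>k\<bar>) (scale r u)" by simp
    also have "\<dots> = scale (of_int (sgn k)) u'"
      unfolding k(2) scale_scale using k0 by (auto simp: sgn_if)
    finally have mem: "scale (r / of_int \<bar>k\<bar>) u \<in> L" using k(1) by (simp add: L_scale)
    then have "(r / of_int \<bar>k\<bar>) * coord u i \<in> \<int>" using i by (auto simp: mem_L_iff lin_form_scale[OF lin_form_coord])
    then obtain c where c: "(r / of_int \<bar>k\<bar>) * coord u i = of_int c" by (auto elim: Ints_cases)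
    have "P (nat \<bar>c\<bar>)" unfolding P_def
      using r k0 mem c by (intro exI[of _ "r / of_int \<bar>k\<bar>"]) auto
    then have "(LEAST m. P m) \<le> nat \<bar>c\<bar>" by (rule Least_le)
    then have "\<bar>r * coord u i\<bar> \<le> \<bar>of_int c\<bar>" using r(3) by linarith
    also have "\<bar>of_int c\<bar> = \<bar>r * coord u i\<bar> / of_int \<bar>k\<bar>"
      unfolding c[symmetric] using k0 by (simp add: abs_mult)
    finally have "\<bar>r * coord u i\<bar> * of_int \<bar>k\<bar> \<le> \<bar>r * coord u i\<bar> * 1" using k0 by (simp add: field_simps)
    moreover have "\<bar>r * coord u i\<bar> > 0" using r(1) i(2) by simp
    ultimately have "of_int \<bar>k\<bar> \<le> (1::rat)" by (simp only: mult_le_cancel_left_pos)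
    then show False using k0 k1 by linarith
  qed
  then have "primitive_L (scale r u)" using r by (auto simp: primitive_L_iff)
  then show ?thesis using that r by blast
qed

subsection \<open>Determinants and dual families\<close>

definition form_matrix :: "(nat \<Rightarrow> 'v \<Rightarrow> rat) \<Rightarrow> rat mat" where
  "form_matrix a = mat n n (\<lambda>(i, j). a i (e j))"

lemma form_matrix_carrier [simp]: "form_matrix a \<in> carrier_mat n n"
  by (simp add: form_matrix_def)

lemma det_forms_eq: "det_forms a = Determinant.det (form_matrix a)"
  by (simp add: det_forms_def form_matrix_def)

definition regular_forms :: "(nat \<Rightarrow> 'v \<Rightarrow> rat) \<Rightarrow> bool" where
  "regular_forms a \<longleftrightarrow> (\<forall>j<n. a j \<in> dual_lattice) \<and> det_forms a \<noteq> 0"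

lemma regular_forms_lin_form: "regular_forms a \<Longrightarrow> j < n \<Longrightarrow> lin_form (a j)"
  by (auto simp: regular_forms_def dual_lattice_iff)

text \<open>A vanishing determinant gives a rational relation among the forms; clearing denominators
  makes it an integer one, which \<open>lin_indep_forms\<close> excludes.\<close>

lemma det_forms_nonzero:
  assumes a: "\<And>j. j < n \<Longrightarrow> a j \<in> dual_lattice" and ind: "lin_indep_forms n a"
  shows "det_forms a \<noteq> 0"
proof
  let ?A = "form_matrix a"
  assume "det_forms a = 0"
  then have "Determinant.det (transpose_mat ?A) = 0"
    by (simp add: det_forms_eq det_transpose[OF form_matrix_carrier])
  then obtain v where v: "v \<in> carrier_vec n" "v \<noteq> 0\<^sub>v n" "transpose_mat ?A *\<^sub>v v = 0\<^sub>v n"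
    using det_0_iff_vec_prod_zero[of "transpose_mat ?A" n] by auto
  have col: "(\<Sum>i<n. a i (e j) * vec_index v i) = 0" if j: "j < n" for j
  proof -
    have "vec_index (transpose_mat ?A *\<^sub>v v) j = (\<Sum>i<n. a i (e j) * vec_index v i)"
      using v(1) j by (simp add: form_matrix_def scalar_prod_def lessThan_atLeast0)
    then show ?thesis using v(3) j by simp
  qed
  obtain D :: int where D: "D > 0" "\<And>i. i < n \<Longrightarrow> of_int D * vec_index v i \<in> \<int>"
    using common_denominator[of n "vec_index v"] by metis
  define c where "c = (\<lambda>i. \<lfloor>of_int D * vec_index v i\<rfloor>)"
  have c: "of_int (c i) = of_int D * vec_index v i" if "i < n" for i
    using D(2)[OF that] by (simp add: c_def of_int_floor_cancel)
  have "(\<Sum>i<n. of_int (c i) * a i u) = 0" for u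
  proof -
    have "(\<Sum>i<n. of_int (c i) * a i u) = (\<Sum>i<n. \<Sum>j<n. of_int D * (coord u j * (a i (e j) * vec_index v i)))"
    proof (intro sum.cong refl)
      fix i assume i: "i \<in> {..<n}"
      have "a i u = (\<Sum>j<n. coord u j * a i (e j))"
        using lin_form_expand[of "a i" u] a i by (simp add: dual_lattice_iff)
      then show "of_int (c i) * a i u = (\<Sum>j<n. of_int D * (coord u j * (a i (e j) * vec_index v i)))"
        using c i by (simp add: sum_distrib_left mult_ac)
    qed
    also have "\<dots> = (\<Sum>j<n. of_int D * (coord u j * (\<Sum>i<n. a i (e j) * vec_index v i)))"
      by (subst sum.swap) (simp add: sum_distrib_left)
    finally show ?thesis using col by simp
  qed
  then have "c i = 0" if "i < n" for i using ind that unfolding lin_indep_forms_def by blast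
  then have "vec_index v i = 0" if "i < n" for i using c[OF that] D(1) that by simp
  then have "v = 0\<^sub>v n" using v(1) by (intro eq_vecI) auto
  with v(2) show False by simp
qed

lemma regular_forms_eq_0:
  assumes "regular_forms a" "\<And>i. i < n \<Longrightarrow> a i u = 0"
  shows "u = 0"
proof -
  let ?A = "form_matrix a" and ?v = "Matrix.vec n (coord u)"
  have "?A *\<^sub>v ?v = 0\<^sub>v n"
  proof (rule eq_vecI)
    fix i assume "i < dim_vec (0\<^sub>v n)"
    then have i: "i < n" by simp
    have "vec_index (?A *\<^sub>v ?v) i = (\<Sum>j<n. coord u j * a i (e j))"
      using i by (simp add: form_matrix_def scalar_prod_def lessThan_atLeast0 mult.commute)
    also have "\<dots> = a i u" using lin_form_expand[OF regular_forms_lin_form[OF assms(1) i], of u] by simp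
    finally show "vec_index (?A *\<^sub>v ?v) i = vec_index (0\<^sub>v n) i" using assms(2) i by simp
  qed (simp add: form_matrix_def)
  moreover have "Determinant.det ?A \<noteq> 0" using assms(1) by (simp add: regular_forms_def det_forms_eq)
  ultimately have "?v = 0\<^sub>v n"
    using det_0_iff_vec_prod_zero[OF form_matrix_carrier[of a]] carrier_vecI[of ?v n] dim_vec[of n] by blast
  then have "coord u i = 0" if "i < n" for i using that by (metis index_vec index_zero_vec(1))
  then show ?thesis using eq_coordI[of u 0] by (simp add: lin_form_0[OF lin_form_coord])
qed

text \<open>The columns of the inverse matrix, written as adjugate over determinant.\<close>

lemma exists_dual_basis:
  assumes "regular_forms a"
  obtains \<beta> where "\<And>j k. j < n \<Longrightarrow> k < n \<Longrightarrow> a k (\<beta> j) = (if k = j then 1 else 0)"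
proof
  let ?A = "form_matrix a" and ?d = "Determinant.det (form_matrix a)"
  have d: "?d \<noteq> 0" using assms by (simp add: regular_forms_def det_forms_eq)
  let ?\<beta> = "\<lambda>j. \<Sum>i<n. scale (adj_mat ?A $$ (i, j) / ?d) (e i)"
  fix j k assume jk: "j < n" "k < n"
  note lf = regular_forms_lin_form[OF assms jk(2)]
  have "a k (?\<beta> j) = (\<Sum>i<n. a k (e i) * adj_mat ?A $$ (i, j)) / ?d"
    by (simp add: lin_form_sum[OF lf] lin_form_scale[OF lf] sum_divide_distrib mult_ac)
  also have "(\<Sum>i<n. a k (e i) * adj_mat ?A $$ (i, j)) = (?A * adj_mat ?A) $$ (k, j)"
    using jk adj_mat(1)[OF form_matrix_carrier[of a]]
    by (simp add: form_matrix_def scalar_prod_def lessThan_atLeast0)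
  also have "\<dots> = ?d * (if k = j then 1 else 0)"
    unfolding adj_mat(2)[OF form_matrix_carrier] using jk by simp
  finally show "a k (?\<beta> j) = (if k = j then 1 else 0)" using d by simp
qed

text \<open>Existence by rescaling a dual basis to primitive vectors; uniqueness because two dual
  vectors for the same j are positive multiples of each other. This gives the \<open>THE\<close> in
  \<open>primitive_pos_dual\<close> its meaning.\<close>

lemma primitive_pos_dual_spec:
  assumes "regular_forms a"
  shows "pos_dual_family n a (primitive_pos_dual a)" "\<And>j. j < n \<Longrightarrow> primitive_L (primitive_pos_dual a j)"
    and "\<And>\<alpha>. pos_dual_family n a \<alpha> \<Longrightarrow> (\<And>j. j < n \<Longrightarrow> primitive_L (\<alpha> j)) \<Longrightarrow> primitive_pos_dual a = \<alpha>"
proof -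
  obtain \<beta> where \<beta>: "\<And>j k. j < n \<Longrightarrow> k < n \<Longrightarrow> a k (\<beta> j) = (if k = j then 1 else 0)"
    using exists_dual_basis[OF assms] by metis
  note lf = regular_forms_lin_form[OF assms]
  have "\<beta> j \<noteq> 0" if "j < n" for j using \<beta>[OF that that] lin_form_0[OF lf[OF that]] by auto
  then have "\<exists>r>0. primitive_L (scale r (\<beta> j))" if "j < n" for j
    using exists_primitive_multiple[of "\<beta> j"] that by metis
  then obtain r where r: "\<And>j. j < n \<Longrightarrow> r j > 0 \<and> primitive_L (scale (r j) (\<beta> j))" by metis
  define \<alpha> where "\<alpha> = restrict (\<lambda>j. scale (r j) (\<beta> j)) {..<n}"
  have \<alpha>: "pos_dual_family n a \<alpha>" "\<And>j. j < n \<Longrightarrow> primitive_L (\<alpha> j)"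
    unfolding pos_dual_family_def \<alpha>_def using r \<beta>
    by (auto simp: primitive_L_iff lin_form_scale[OF lf])
  have uniq: "\<alpha>' = \<alpha>" if \<alpha>': "pos_dual_family n a \<alpha>'" "\<forall>j<n. primitive_L (\<alpha>' j)" for \<alpha>'
  proof
    fix j
    show "\<alpha>' j = \<alpha> j"
    proof (cases "j < n")
      case True
      define t where "t = a j (\<alpha>' j) / a j (\<alpha> j)"
      have pos: "a j (\<alpha> j) > 0" "a j (\<alpha>' j) > 0" using \<alpha>(1) \<alpha>'(1) True by (auto simp: pos_dual_family_def)
      have "\<alpha>' j - scale t (\<alpha> j) = 0"
      proof (rule regular_forms_eq_0[OF assms])
        fix i assume i: "i < n"
        have "a i (\<alpha>' j - scale t (\<alpha> j)) = a i (\<alpha>' j) - t * a i (\<alpha> j)"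
          by (simp add: lin_form_diff[OF lf[OF i]] lin_form_scale[OF lf[OF i]])
        also have "\<dots> = 0"
          using \<alpha>(1) \<alpha>'(1) True i pos by (cases "i = j") (auto simp: pos_dual_family_def t_def)
        finally show "a i (\<alpha>' j - scale t (\<alpha> j)) = 0" .
      qed
      then have eq: "\<alpha>' j = scale t (\<alpha> j)" by simp
      have "t = 1" using primitive_L_unique[of "\<alpha> j" t] \<alpha>(2)[OF True] \<alpha>'(2) True pos
        unfolding eq[symmetric] by (simp add: t_def)
      then show ?thesis using eq by simp
    next
      case False
      then show ?thesis using \<alpha>(1) \<alpha>'(1) by (auto simp: pos_dual_family_def PiE_def extensional_def)
    qed
  qed
  have eq: "primitive_pos_dual a = \<alpha>"
    unfolding primitive_pos_dual_def
  proof (rule the_equality)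
    show "pos_dual_family n a \<alpha> \<and> (\<forall>j<n. primitive_L (\<alpha> j))" using \<alpha> by simp
  qed (rule uniq; simp)
  show "pos_dual_family n a (primitive_pos_dual a)" "\<And>j. j < n \<Longrightarrow> primitive_L (primitive_pos_dual a j)"
    unfolding eq using \<alpha> by auto
  show "primitive_pos_dual a = \<alpha>'" if "pos_dual_family n a \<alpha>'" "\<And>j. j < n \<Longrightarrow> primitive_L (\<alpha>' j)" for \<alpha>'
    unfolding eq using uniq that by auto
qed

lemma primitive_pos_dual:
  assumes "regular_forms a" "j < n"
  shows "primitive_pos_dual a j \<in> L" "a j (primitive_pos_dual a j) > 0"
    "\<And>k. k < n \<Longrightarrow> k \<noteq> j \<Longrightarrow> a k (primitive_pos_dual a j) = 0"
    "primitive_L (primitive_pos_dual a j)"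
  using primitive_pos_dual_spec(1,2)[OF assms(1)] assms(2) by (auto simp: pos_dual_family_def)

lemma dual_expand:
  assumes "regular_forms a"
  shows "u = (\<Sum>j<n. scale (a j u / a j (primitive_pos_dual a j)) (primitive_pos_dual a j))" (is "u = ?s")
proof -
  note lf = regular_forms_lin_form[OF assms] and pd = primitive_pos_dual[OF assms]
  have "u - ?s = 0"
  proof (rule regular_forms_eq_0[OF assms])
    fix i assume i: "i < n"
    have "a i ?s = (\<Sum>j<n. if i = j then a i u else 0)"
      unfolding lin_form_sum[OF lf[OF i]] lin_form_scale[OF lf[OF i]]
    proof (intro sum.cong refl)
      fix j assume j: "j \<in> {..<n}"
      have "a i (primitive_pos_dual a i) \<noteq> 0" using pd(2)[OF i] by simp
      then show "of_rat (a j u / a j (primitive_pos_dual a j)) * a i (primitive_pos_dual a j) = (if i = j then a i u else 0)"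
        using pd(3)[of j i] i j by auto
    qed
    also have "\<dots> = a i u" using i by simp
    finally show "a i (u - ?s) = 0" by (simp add: lin_form_diff[OF lf[OF i]])
  qed
  then show ?thesis by simp
qed

text \<open>The family without \<open>a j\<close>, completed by y, is C times the family a: all rows
  of C but the last are unit rows that skip j (the map \<iota>), and the last holds the coefficients
  of y with respect to a. Column j of C is zero above the last row, and the minor there is the
  identity.\<close>

lemma det_forms_omit:
  assumes "regular_forms a" "j < n" "lin_form y"
  shows "det_forms ((omit j a)(n - 1 := y)) =
    y (primitive_pos_dual a j) / a j (primitive_pos_dual a j) * (-1) ^ (n - 1 + j) * det_forms a"
proof -
  let ?\<alpha> = "primitive_pos_dual a"
  define \<iota> where "\<iota> = (\<lambda>i. if i < j then i else Suc i)"
  have inj: "\<iota> i = \<iota> k \<longleftrightarrow> i = k" for i k by (auto simp: \<iota>_def)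
  have ij: "\<iota> i \<noteq> j" for i by (auto simp: \<iota>_def)
  define c where "c = (\<lambda>k. y (?\<alpha> k) / a k (?\<alpha> k))"
  define C where "C = mat n n (\<lambda>(i, k). if i < n - 1 then (if k = \<iota> i then 1 else 0) else c k)"
  have C: "C \<in> carrier_mat n n" by (simp add: C_def)
  have "form_matrix ((omit j a)(n - 1 := y)) = C * form_matrix a"
  proof (rule eq_matI)
    fix i l assume "i < dim_row (C * form_matrix a)" "l < dim_col (C * form_matrix a)"
    then have il: "i < n" "l < n" by (auto simp: C_def form_matrix_def)
    have prod: "(C * form_matrix a) $$ (i, l) = (\<Sum>k<n. C $$ (i, k) * a k (e l))"
      using il C by (simp add: form_matrix_def scalar_prod_def lessThan_atLeast0)
    show "form_matrix ((omit j a)(n - 1 := y)) $$ (i, l) = (C * form_matrix a) $$ (i, l)"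
    proof (cases "i < n - 1")
      case True
      then have "\<iota> i < n" by (auto simp: \<iota>_def)
      have "(\<Sum>k<n. C $$ (i, k) * a k (e l)) = (\<Sum>k<n. if k = \<iota> i then a k (e l) else 0)"
        using True il by (intro sum.cong) (auto simp: C_def)
      also have "\<dots> = a (\<iota> i) (e l)" using \<open>\<iota> i < n\<close> by simp
      finally show ?thesis unfolding prod using True il by (simp add: form_matrix_def omit_def \<iota>_def)
    next
      case False
      then have i: "i = n - 1" using il by linarith
      have "y (e l) = (\<Sum>k<n. c k * a k (e l))"
        using arg_cong[OF dual_expand[OF assms(1), of "e l"], of y]
        by (simp add: lin_form_sum[OF assms(3)] lin_form_scale[OF assms(3)] c_def mult_ac)
      also have "\<dots> = (\<Sum>k<n. C $$ (i, k) * a k (e l))"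
        using i il by (intro sum.cong) (auto simp: C_def)
      finally show ?thesis unfolding prod using i il by (simp add: form_matrix_def)
    qed
  qed (auto simp: C_def form_matrix_def)
  then have det: "det_forms ((omit j a)(n - 1 := y)) = Determinant.det C * det_forms a"
    unfolding det_forms_eq using det_mult[OF C form_matrix_carrier] by simp
  have "Determinant.det C = (\<Sum>i<n. C $$ (i, j) * cofactor C i j)"
    by (rule laplace_expansion_column[OF C assms(2)])
  also have "\<dots> = (\<Sum>i<n. if i = n - 1 then c j * cofactor C i j else 0)"
    using assms(2) ij by (intro sum.cong) (auto simp: C_def dest: not_sym)
  also have "\<dots> = c j * cofactor C (n - 1) j" using assms(2) by simp
  also have "mat_delete C (n - 1) j = 1\<^sub>m (n - 1)"
  proof (rule eq_matI)
    fix i k assume "i < dim_row (1\<^sub>m (n - 1) :: rat mat)" "k < dim_col (1\<^sub>m (n - 1) :: rat mat)"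
    then have ik: "i < n - 1" "k < n - 1" by auto
    then have "\<iota> k < n" by (auto simp: \<iota>_def)
    then have "mat_delete C (n - 1) j $$ (i, k) = (if \<iota> k = \<iota> i then 1 else 0)"
      using ik by (simp add: mat_delete_def C_def \<iota>_def)
    then show "mat_delete C (n - 1) j $$ (i, k) = 1\<^sub>m (n - 1) $$ (i, k)" using ik inj by auto
  qed (auto simp: mat_delete_def C_def)
  then have "cofactor C (n - 1) j = (-1) ^ (n - 1 + j)" by (simp add: cofactor_def)
  finally show ?thesis unfolding det by (simp add: c_def)
qed

text \<open>Testing against the coordinate forms shows that two candidates are positive multiples of
  each other, hence equal as both are primitive.\<close>

lemma normal_vector_eqI:
  assumes "primitive_L \<gamma>" "s > 0" "\<And>y. y \<in> dual_lattice \<Longrightarrow> det_forms (b(n - 1 := y)) = of_int s * y \<gamma>"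
  shows "normal_vector b = \<gamma>"
  unfolding normal_vector_def
proof (rule the_equality)
  show "primitive_L \<gamma> \<and> (\<exists>s::int. s > 0 \<and> (\<forall>y\<in>dual_lattice. det_forms (b(n - 1 := y)) = of_int s * y \<gamma>))"
    using assms by blast
  fix \<gamma>' assume "primitive_L \<gamma>' \<and> (\<exists>s::int. s > 0 \<and> (\<forall>y\<in>dual_lattice. det_forms (b(n - 1 := y)) = of_int s * y \<gamma>'))"
  then obtain s' :: int where s': "primitive_L \<gamma>'" "s' > 0" "\<And>y. y \<in> dual_lattice \<Longrightarrow> det_forms (b(n - 1 := y)) = of_int s' * y \<gamma>'"
    by blast
  have "coord \<gamma>' i = coord (scale (of_int s / of_int s') \<gamma>) i" if "i < n" for i
    using assms(3)[OF coord_dual[OF that]] s'(3)[OF coord_dual[OF that]] s'(2)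
    by (simp add: lin_form_scale[OF lin_form_coord] field_simps)
  then have eq: "\<gamma>' = scale (of_int s / of_int s') \<gamma>" by (rule eq_coordI)
  have "of_int s / of_int s' = (1::rat)"
    using primitive_L_unique[OF assms(1), of "of_int s / of_int s'"] s'(1,2) assms(2) unfolding eq[symmetric] by simp
  then show "\<gamma>' = \<gamma>" using eq by simp
qed

text \<open>For regular a, the sign of the determinant of the family in which \<open>a j\<close> is
  moved to the last place.\<close>

definition omit_sign :: "(nat \<Rightarrow> 'v \<Rightarrow> rat) \<Rightarrow> nat \<Rightarrow> int" where
  "omit_sign a j = (if (-1) ^ (n - 1 + j) * det_forms a > 0 then 1 else - 1)"

text \<open>As a function of y the determinant is \<kappa> times evaluation at the dual vector.
  Integer matrices have integer determinants, so \<kappa> times the dual vector lies in L, and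
  primitivity makes \<kappa> an integer. Its absolute value is the s of
  \<open>normal_vector\<close>, its sign is \<open>omit_sign\<close>.\<close>

lemma normal_vector_omit:
  assumes "regular_forms a" "j < n"
  shows "normal_vector (omit j a) = scale (of_int (omit_sign a j)) (primitive_pos_dual a j)"
proof -
  let ?\<alpha> = "primitive_pos_dual a"
  note pd = primitive_pos_dual[OF assms]
  define \<kappa> where "\<kappa> = (-1) ^ (n - 1 + j) * det_forms a / a j (?\<alpha> j)"
  have det: "det_forms ((omit j a)(n - 1 := y)) = \<kappa> * y (?\<alpha> j)" if "lin_form y" for y
    unfolding det_forms_omit[OF assms that] by (simp add: \<kappa>_def)
  have k0: "\<kappa> \<noteq> 0" using assms(1) pd(2) by (simp add: \<kappa>_def regular_forms_def)
  have "scale \<kappa> (?\<alpha> j) \<in> L"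
    unfolding mem_L_iff
  proof (intro allI impI)
    fix i assume i: "i < n"
    have "\<kappa> * coord (?\<alpha> j) i = det_forms ((omit j a)(n - 1 := (\<lambda>u. coord u i)))"
      using det[OF lin_form_coord] by simp
    also have "\<dots> \<in> \<int>"
      unfolding det_forms_eq
    proof (rule det_in_Ints[OF form_matrix_carrier])
      fix k l assume kl: "k < n" "l < n"
      then have "((omit j a)(n - 1 := (\<lambda>u. coord u i))) k \<in> dual_lattice"
        using coord_dual[OF i] assms(1) by (auto simp: omit_def regular_forms_def)
      then show "form_matrix ((omit j a)(n - 1 := (\<lambda>u. coord u i))) $$ (k, l) \<in> \<int>"
        unfolding form_matrix_def using kl by (simp add: dual_lattice_iff_e)
    qed
    finally show "coord (scale \<kappa> (?\<alpha> j)) i \<in> \<int>" by (simp add: lin_form_scale[OF lin_form_coord])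
  qed
  then have "\<kappa> \<in> \<int>" by (rule primitive_L_scale_Ints[OF pd(4)])
  then obtain k where k: "\<kappa> = of_int k" by (auto elim: Ints_cases)
  have sg: "omit_sign a j = sgn k"
  proof -
    have "(-1) ^ (n - 1 + j) * det_forms a > 0 \<longleftrightarrow> \<kappa> > 0"
      unfolding \<kappa>_def using pd(2) by (simp add: zero_less_divide_iff)
    then show ?thesis unfolding omit_sign_def using k k0 by (auto simp: sgn_if)
  qed
  show ?thesis
  proof (rule normal_vector_eqI)
    show "\<bar>k\<bar> > 0" using k k0 by simp
    have "sgn k = 1 \<or> sgn k = -1" using k k0 by (auto simp: sgn_if)
    moreover have "primitive_L (scale (-1) (?\<alpha> j))"
      unfolding primitive_L_iff
    proof (intro conjI allI ballI impI)
      show "scale (-1) (?\<alpha> j) \<in> L" using pd(1) by (intro L_scale) auto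
      fix m :: int and u' assume "u' \<in> L" "scale (-1) (?\<alpha> j) = scale (of_int m) u'"
      then have "?\<alpha> j = scale (of_int (- m)) u'" by (metis minus_equation_iff of_int_minus scale_minus_left scale_one)
      then have "\<bar>- m\<bar> = 1" using pd(4) \<open>u' \<in> L\<close> unfolding primitive_L_iff by blast
      then show "\<bar>m\<bar> = 1" by simp
    qed
    ultimately show "primitive_L (scale (of_int (omit_sign a j)) (?\<alpha> j))" using pd(4) sg by auto
    fix y assume y: "y \<in> dual_lattice"
    then have lf: "lin_form y" by (simp add: dual_lattice_iff)
    have "of_int k = of_int \<bar>k\<bar> * (of_int (sgn k) :: rat)" by (simp add: sgn_if)
    then show "det_forms ((omit j a)(n - 1 := y)) = of_int \<bar>k\<bar> * y (scale (of_int (omit_sign a j)) (?\<alpha> j))"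
      unfolding det[OF lf] k lin_form_scale_int[OF lf] sg by (simp only: mult.assoc)
  qed
qed

lemma pos_dual_family_omit:
  assumes "regular_forms a" "j < n"
  shows "pos_dual_family (n - 1) (omit j a) (restrict (omit j (primitive_pos_dual a)) {..<n - 1})"
  using primitive_pos_dual[OF assms(1)] assms(2) unfolding pos_dual_family_def
  by (auto simp: omit_def)

end

section \<open>Independence of the dual family\<close>

lemma bij_betw_omit:
  assumes "j < n" "2 \<le> n"
  shows "bij_betw (omit j id) {..n - 2} ({..<n} - {j})"
  by (rule bij_betwI[where g = "\<lambda>k. if k < j then k else k - 1"])
     (use assms in \<open>auto simp: omit_def split: if_splits\<close>)

lemma omit_apply: "omit j a i = a (omit j id i)"
  by (simp add: omit_def)

context based_lattice
begin

lemma V_mod_L_add: "v \<in> V_mod_L \<Longrightarrow> \<delta> \<in> v \<Longrightarrow> l \<in> L \<Longrightarrow> \<delta> + l \<in> v"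
  by (auto simp: V_mod_L_def add.assoc intro!: imageI L_add)

lemma regular_forms_L: "regular_forms a \<Longrightarrow> j < n \<Longrightarrow> u \<in> L \<Longrightarrow> a j u \<in> \<int>"
  by (auto simp: regular_forms_def dual_lattice_iff)

text \<open>The integers \<open>a k (\<delta> - u)\<close> lie in bounded ranges and determine
  \<delta>, as the forms are regular.\<close>

lemma finite_box:
  assumes "regular_forms a" "v \<in> V_mod_L"
  shows "finite {\<delta> \<in> v. \<forall>k<n. 0 \<le> a k \<delta> \<and> a k \<delta> < M k}"
proof -
  obtain u where u: "v = (+) u ` L" using assms(2) by (auto simp: V_mod_L_def)
  note lf = regular_forms_lin_form[OF assms(1)]
  let ?S = "{\<delta> \<in> v. \<forall>k<n. 0 \<le> a k \<delta> \<and> a k \<delta> < M k}"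
  define \<Phi> where "\<Phi> = (\<lambda>\<delta>. \<lambda>k\<in>{..<n}. \<lfloor>a k (\<delta> - u)\<rfloor>)"
  have eq: "of_int (\<Phi> \<delta> k) = a k \<delta> - a k u" if "\<delta> \<in> v" "k < n" for \<delta> k
  proof -
    have "\<delta> - u \<in> L" using that(1) u by auto
    then have "a k (\<delta> - u) \<in> \<int>" using regular_forms_L[OF assms(1)] that by blast
    then show ?thesis using that(2) by (simp add: \<Phi>_def of_int_floor_cancel lin_form_diff[OF lf[OF that(2)]])
  qed
  have "inj_on \<Phi> ?S"
  proof (rule inj_onI)
    fix \<delta> \<delta>' assume "\<delta> \<in> ?S" "\<delta>' \<in> ?S" "\<Phi> \<delta> = \<Phi> \<delta>'"
    then have "a k (\<delta> - \<delta>') = 0" if "k < n" for k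
      using eq[of \<delta> k] eq[of \<delta>' k] that by (simp add: lin_form_diff[OF lf[OF that]])
    then have "\<delta> - \<delta>' = 0" by (rule regular_forms_eq_0[OF assms(1)])
    then show "\<delta> = \<delta>'" by simp
  qed
  moreover have "\<Phi> ` ?S \<subseteq> Pi\<^sub>E {..<n} (\<lambda>k. {\<lfloor>- a k u\<rfloor>..\<lceil>M k - a k u\<rceil>})"
  proof (rule image_subsetI)
    fix \<delta> assume d: "\<delta> \<in> ?S"
    have "\<lfloor>- a k u\<rfloor> \<le> \<Phi> \<delta> k \<and> \<Phi> \<delta> k \<le> \<lceil>M k - a k u\<rceil>" if k: "k < n" for k
    proof -
      have "- a k u \<le> of_int (\<Phi> \<delta> k)" "of_int (\<Phi> \<delta> k) \<le> M k - a k u" using eq[of \<delta> k] d k by force+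
      then show ?thesis by linarith
    qed
    then show "\<Phi> \<delta> \<in> Pi\<^sub>E {..<n} (\<lambda>k. {\<lfloor>- a k u\<rfloor>..\<lceil>M k - a k u\<rceil>})"
      by (auto simp: PiE_iff) (simp add: \<Phi>_def)
  qed
  ultimately show ?thesis
    by (rule inj_on_finite) (auto intro!: finite_PiE)
qed

text \<open>With \<open>dual_factor\<close> and \<open>dual_prod\<close> this restates
  \<open>geom_G\<close> for an arbitrary \<beta> in place of the family fixed by
  \<open>SOME\<close>, so that different choices can be compared.\<close>

definition dual_region :: "(nat \<Rightarrow> 'v \<Rightarrow> rat) \<Rightarrow> (nat \<Rightarrow> 'v) \<Rightarrow> 'v set \<Rightarrow> 'v set" where
  "dual_region b \<beta> v = {\<delta> \<in> v. \<forall>j<n-1. 0 \<le> b j \<delta> \<and> b j \<delta> < b j (\<beta> j)}"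

definition dual_factor :: "'v \<Rightarrow> (nat \<Rightarrow> 'v) \<Rightarrow> complex \<Rightarrow> ('v \<Rightarrow> complex) \<Rightarrow> 'v \<Rightarrow> complex" where
  "dual_factor \<gamma> \<beta> w x \<delta> = nishizawa_G (n - 2) ((w + x \<delta>) / x \<gamma>) (\<lambda>j. x (\<beta> j) / x \<gamma>)"

definition dual_prod :: "'v \<Rightarrow> (nat \<Rightarrow> 'v \<Rightarrow> rat) \<Rightarrow> (nat \<Rightarrow> 'v) \<Rightarrow> 'v set \<Rightarrow> complex \<Rightarrow> ('v \<Rightarrow> complex) \<Rightarrow> complex" where
  "dual_prod \<gamma> b \<beta> v w x =
     (\<Prod>D \<in> dual_region b \<beta> v // translation_rel \<gamma>. dual_factor \<gamma> \<beta> w x (SOME \<delta>. \<delta> \<in> D))"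

lemma geom_G_eq: "geom_G b v w x = dual_prod (normal_vector b) b (chosen_dual b) v w x"
  by (simp add: geom_G_def dual_prod_def dual_factor_def dual_region_def G_region_def Let_def)

text \<open>Representatives of R modulo integer multiples of \<gamma>. The separate index set T
  allows products of sets and images under the group action as parametrizations.\<close>

definition transversal :: "'t set \<Rightarrow> ('t \<Rightarrow> 'v) \<Rightarrow> 'v set \<Rightarrow> 'v \<Rightarrow> bool" where
  "transversal T g R \<gamma> \<longleftrightarrow> g ` T \<subseteq> R \<and>
     (\<forall>\<delta>\<in>R. \<exists>!t. t \<in> T \<and> (\<exists>k::int. \<delta> = g t + scale (of_int k) \<gamma>))"

text \<open>Classes of \<open>translation_rel\<close> are full orbits in V, so the representative
  picked by \<open>SOME\<close> differs from \<open>g t\<close> by a multiple of \<gamma>, which f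
  does not notice.\<close>

lemma prod_quotient_transversal:
  fixes f :: "'v \<Rightarrow> complex"
  assumes T: "transversal T g R \<gamma>" and per: "\<And>\<delta> k. f (\<delta> + scale (of_int k) \<gamma>) = f \<delta>"
  shows "(\<Prod>D\<in>R // translation_rel \<gamma>. f (SOME \<delta>. \<delta> \<in> D)) = (\<Prod>t\<in>T. f (g t))"
proof -
  define h where "h = (\<lambda>t. translation_rel \<gamma> `` {g t})"
  have h: "h t = range (\<lambda>k::int. g t + scale (of_int k) \<gamma>)" for t
    by (auto simp: h_def translation_rel_def)
  have self: "g t \<in> h t" for t unfolding h by (rule range_eqI[of _ _ 0]) simp
  have cls: "translation_rel \<gamma> `` {\<delta>} = h t" if "\<delta> = g t + scale (of_int k) \<gamma>" for \<delta> t and k :: int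
  proof -
    have "translation_rel \<gamma> `` {\<delta>} = range (\<lambda>l::int. \<delta> + scale (of_int l) \<gamma>)"
      by (auto simp: translation_rel_def)
    also have "\<dots> = range ((\<lambda>l::int. g t + scale (of_int l) \<gamma>) \<circ> (\<lambda>l. k + l))"
      by (simp add: that scale_left_distrib add.assoc o_def)
    also have "\<dots> = h t"
      unfolding h image_comp[symmetric] using surj_plus[of k] by simp
    finally show ?thesis .
  qed
  have "bij_betw h T (R // translation_rel \<gamma>)"
    unfolding bij_betw_def
  proof (intro conjI inj_onI)
    fix t t' assume t: "t \<in> T" "t' \<in> T" "h t = h t'"
    have "g t \<in> R" using T t by (auto simp: transversal_def)
    moreover have "g t \<in> h t'" using self[of t] t(3) by simp
    then have "\<exists>k::int. g t = g t' + scale (of_int k) \<gamma>" unfolding h[of t'] by (simp add: image_iff)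
    moreover have "\<exists>k::int. g t = g t + scale (of_int k) \<gamma>" by (rule exI[of _ 0]) simp
    ultimately show "t = t'" using T t unfolding transversal_def by blast
  next
    show "h ` T = R // translation_rel \<gamma>"
    proof
      show "h ` T \<subseteq> R // translation_rel \<gamma>"
        using T by (auto simp: h_def transversal_def quotient_def)
      show "R // translation_rel \<gamma> \<subseteq> h ` T"
      proof
        fix D assume "D \<in> R // translation_rel \<gamma>"
        then obtain \<delta> where d: "\<delta> \<in> R" "D = translation_rel \<gamma> `` {\<delta>}" by (auto simp: quotient_def)
        then obtain t k where "t \<in> T" "\<delta> = g t + scale (of_int k) \<gamma>"
          using T unfolding transversal_def by metis
        then show "D \<in> h ` T" using cls[of \<delta> t k] d(2) by simp
      qed
    qed
  qed
  then have "(\<Prod>D\<in>R // translation_rel \<gamma>. f (SOME \<delta>. \<delta> \<in> D)) = (\<Prod>t\<in>T. f (SOME \<delta>. \<delta> \<in> h t))"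
    by (rule prod.reindex_bij_betw[symmetric])
  also have "\<dots> = (\<Prod>t\<in>T. f (g t))"
  proof (intro prod.cong refl)
    fix t
    have "(SOME \<delta>. \<delta> \<in> h t) \<in> h t" using self by (rule someI)
    then show "f (SOME \<delta>. \<delta> \<in> h t) = f (g t)" using per unfolding h by auto
  qed
  finally show ?thesis .
qed

definition dual_nonreal :: "'v \<Rightarrow> (nat \<Rightarrow> 'v) \<Rightarrow> ('v \<Rightarrow> complex) \<Rightarrow> bool" where
  "dual_nonreal \<gamma> \<beta> x \<longleftrightarrow> x \<gamma> \<noteq> 0 \<and> (\<forall>j<n-1. Im (x (\<beta> j) / x \<gamma>) \<noteq> 0)"

lemma geom_G_defined_iff: "geom_G_defined b x \<longleftrightarrow> dual_nonreal (normal_vector b) (chosen_dual b) x"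
  by (simp add: geom_G_defined_def dual_nonreal_def complex_is_Real_iff)

text \<open>\<open>pos_dual_family\<close> without the convention about values outside the index
  range, which would be lost under composition with the group action.\<close>

definition is_dual :: "(nat \<Rightarrow> 'v \<Rightarrow> rat) \<Rightarrow> (nat \<Rightarrow> 'v) \<Rightarrow> bool" where
  "is_dual b \<beta> \<longleftrightarrow> (\<forall>j<n-1. \<beta> j \<in> L \<and> b j (\<beta> j) > 0 \<and> (\<forall>k<n-1. k \<noteq> j \<longrightarrow> b k (\<beta> j) = 0))"

lemma pos_dual_is_dual: "pos_dual_family (n - 1) b \<beta> \<Longrightarrow> is_dual b \<beta>"
  by (auto simp: pos_dual_family_def is_dual_def)

lemma is_dual_upd:
  assumes "is_dual b \<beta>" "is_dual b \<beta>'"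
  shows "is_dual b (\<beta>(i := \<beta>' i))"
  using assms by (auto simp: is_dual_def)

end

text \<open>Every family of n - 1 forms that occurs is treated as \<open>omit j a\<close> for a
  regular a, so that its normal vector and dual vectors can be read off from the dual family of
  a.\<close>

locale omitted_forms = based_lattice +
  fixes a :: "nat \<Rightarrow> 'a \<Rightarrow> rat" and j :: nat
  assumes n2: "2 \<le> n" and reg: "regular_forms a" and j: "j < n"
begin

abbreviation "b \<equiv> omit j a"
abbreviation "\<alpha> \<equiv> primitive_pos_dual a"
abbreviation "\<gamma> \<equiv> normal_vector (omit j a)"

lemma gamma_eq: "\<gamma> = scale (of_int (omit_sign a j)) (\<alpha> j)"
  by (rule normal_vector_omit[OF reg j])

lemma omit_sign_cases: "omit_sign a j = 1 \<or> omit_sign a j = - 1"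
  by (auto simp: omit_sign_def)

lemma omit_index: "i < n - 1 \<Longrightarrow> omit j id i < n \<and> omit j id i \<noteq> j"
  by (auto simp: omit_def)

lemma omit_index_surj: "k < n \<Longrightarrow> k \<noteq> j \<Longrightarrow> \<exists>i<n-1. k = omit j id i"
  using j by (intro exI[of _ "if k < j then k else k - 1"]) (auto simp: omit_def)

lemma lin_form_b: "i < n - 1 \<Longrightarrow> lin_form (b i)"
  unfolding omit_apply[of j a] using regular_forms_lin_form[OF reg] omit_index by blast

lemma b_Ints: "i < n - 1 \<Longrightarrow> u \<in> L \<Longrightarrow> b i u \<in> \<int>"
  unfolding omit_apply[of j a] using regular_forms_L[OF reg] omit_index by blast

lemma b_gamma: "i < n - 1 \<Longrightarrow> b i \<gamma> = 0"
proof -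
  assume i: "i < n - 1"
  have "b i (\<alpha> j) = 0"
    unfolding omit_apply[of j a] using primitive_pos_dual(3)[OF reg j] omit_index[OF i] by blast
  then show ?thesis by (simp only: gamma_eq lin_form_scale[OF lin_form_b[OF i]] mult_zero_right)
qed

lemma b_add_gamma: "i < n - 1 \<Longrightarrow> b i (\<delta> + scale r \<gamma>) = b i \<delta>"
  by (simp add: lin_form_add[OF lin_form_b] lin_form_scale[OF lin_form_b] b_gamma)

lemma gamma_L: "\<gamma> \<in> L"
  unfolding gamma_eq using primitive_pos_dual(1)[OF reg j] by (intro L_scale) auto

text \<open>A vector killed by all of b differs from a rational multiple of
  \<open>\<alpha> j\<close> by a vector killed by all of a, that is by 0. Primitivity of
  \<open>\<alpha> j\<close> makes the multiple an integer, and \<gamma> is \<open>\<alpha> j\<close>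
  up to sign.\<close>

lemma kernel_b:
  assumes "u \<in> L" "\<And>i. i < n - 1 \<Longrightarrow> b i u = 0"
  obtains k :: int where "u = scale (of_int k) \<gamma>"
proof -
  define r where "r = a j u / a j (\<alpha> j)"
  have "u - scale r (\<alpha> j) = 0"
  proof (rule regular_forms_eq_0[OF reg])
    fix k assume k: "k < n"
    have lin: "a k (u - scale r (\<alpha> j)) = a k u - r * a k (\<alpha> j)"
      using regular_forms_lin_form[OF reg k] by (simp add: lin_form_diff lin_form_scale)
    show "a k (u - scale r (\<alpha> j)) = 0"
    proof (cases "k = j")
      case True
      then show ?thesis unfolding lin using primitive_pos_dual(2)[OF reg j] by (simp add: r_def)
    next
      case False
      then obtain i where "i < n - 1" "k = omit j id i" using omit_index_surj[OF k] by blast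
      then have "a k u = 0" using assms(2) by (simp add: omit_apply[of j a])
      then show ?thesis unfolding lin using primitive_pos_dual(3)[OF reg j k False] by simp
    qed
  qed
  then have u: "u = scale r (\<alpha> j)" by simp
  then have "r \<in> \<int>" using primitive_L_scale_Ints[OF primitive_pos_dual(4)[OF reg j]] assms(1) by simp
  then obtain m where m: "r = of_int m" by (auto elim: Ints_cases)
  have "of_int (m * omit_sign a j) * of_int (omit_sign a j) = (of_int m :: rat)"
    using omit_sign_cases by auto
  then have "u = scale (of_int (m * omit_sign a j)) \<gamma>"
    unfolding u gamma_eq scale_scale m by simp
  then show ?thesis by (rule that)
qed

text \<open>Translation by \<gamma> fixes the values of b and moves that of \<open>a j\<close> by
  \<open>a j (\<alpha> j)\<close> up to sign, so each class meets the half-open interval for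
  \<open>a j\<close> exactly once.\<close>

lemma transversal_box:
  assumes "v \<in> V_mod_L"
  shows "transversal {\<delta> \<in> dual_region b \<beta> v. 0 \<le> a j \<delta> \<and> a j \<delta> < a j (\<alpha> j)} id (dual_region b \<beta> v) \<gamma>"
  unfolding transversal_def
proof (intro conjI ballI)
  let ?m = "a j (\<alpha> j)"
  have m: "?m > 0" by (rule primitive_pos_dual(2)[OF reg j])
  note lf = regular_forms_lin_form[OF reg j]
  have aj: "a j (\<delta> + scale (of_int k) \<gamma>) = a j \<delta> + of_int (k * omit_sign a j) * ?m" for \<delta> and k :: int
    by (simp add: gamma_eq lin_form_add[OF lf] lin_form_scale[OF lf])
  fix \<delta> assume d: "\<delta> \<in> dual_region b \<beta> v"
  define q where "q = \<lfloor>a j \<delta> / ?m\<rfloor>"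
  define k where "k = - q * omit_sign a j"
  define \<delta>' where "\<delta>' = \<delta> + scale (of_int k) \<gamma>"
  have ks: "k * omit_sign a j = - q" using omit_sign_cases by (auto simp: k_def)
  have "0 \<le> a j \<delta> - of_int q * ?m" "a j \<delta> - of_int q * ?m < ?m"
    unfolding q_def using m floor_divide_lower[OF m, of "a j \<delta>"] floor_divide_upper[OF m, of "a j \<delta>"]
    by (simp_all add: algebra_simps)
  then have bd: "0 \<le> a j \<delta>'" "a j \<delta>' < ?m" unfolding \<delta>'_def aj ks by simp_all
  have mem: "\<delta>' \<in> dual_region b \<beta> v"
    using d V_mod_L_add[OF assms _ L_scale[OF Ints_of_int gamma_L], of \<delta> k] b_add_gamma
    by (auto simp: dual_region_def \<delta>'_def)
  have \<delta>: "\<delta> = \<delta>' + scale (of_int (- k)) \<gamma>" by (simp add: \<delta>'_def)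
  show "\<exists>!t. t \<in> {\<delta> \<in> dual_region b \<beta> v. 0 \<le> a j \<delta> \<and> a j \<delta> < ?m} \<and> (\<exists>k::int. \<delta> = id t + scale (of_int k) \<gamma>)"
  proof (rule ex1I[of _ \<delta>'])
    show "\<delta>' \<in> {\<delta> \<in> dual_region b \<beta> v. 0 \<le> a j \<delta> \<and> a j \<delta> < ?m} \<and> (\<exists>k::int. \<delta> = id \<delta>' + scale (of_int k) \<gamma>)"
      using mem bd \<delta> by (auto intro!: exI[of _ "- k"] simp del: of_int_minus)
    fix t assume t: "t \<in> {\<delta> \<in> dual_region b \<beta> v. 0 \<le> a j \<delta> \<and> a j \<delta> < ?m} \<and> (\<exists>k::int. \<delta> = id t + scale (of_int k) \<gamma>)"
    then obtain l :: int where l: "\<delta> = t + scale (of_int l) \<gamma>" by auto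
    have t': "t = \<delta>' + scale (of_int (- k - l)) \<gamma>"
      using l \<delta> by (simp add: algebra_simps scale_left_diff_distrib)
    \<comment> \<open>Two points of the half-open interval differ by less than its length, so this
      integer is 0.\<close>
    define p where "p = (- k - l) * omit_sign a j"
    have at: "a j t = a j \<delta>' + of_int p * ?m" unfolding t' aj p_def ..
    have "0 \<le> a j t" "a j t < ?m" using t by auto
    then have "of_int p * ?m < 1 * ?m" "(-1) * ?m < of_int p * ?m" using bd at by linarith+
    then have "of_int p < (1::rat)" "(-1::rat) < of_int p" using m by (simp_all only: mult_less_cancel_right_pos)
    then have "p = 0" by linarith
    then have "- k - l = 0" using omit_sign_cases by (auto simp: p_def)
    then show "t = \<delta>'" using t' by simp
  qed
qed auto

lemma nonreal_dual:
  assumes "dual_nonreal \<gamma> \<beta> x"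
  shows "nonreal {..n - 2} (\<lambda>i. x (\<beta> i) / x \<gamma>)"
  using assms n2 by (auto simp: dual_nonreal_def nonreal_def)

lemma dual_factor_eq:
  assumes "dual_nonreal \<gamma> \<beta> x"
  shows "dual_factor \<gamma> \<beta> w x \<delta> = gen_G {..n - 2} (\<lambda>i. x (\<beta> i) / x \<gamma>) ((w + x \<delta>) / x \<gamma>)"
  unfolding dual_factor_def by (rule nishizawa_G_eq_gen_G[OF nonreal_dual[OF assms]])

lemma dual_factor_periodic:
  assumes "lin_form x" "dual_nonreal \<gamma> \<beta> x"
  shows "dual_factor \<gamma> \<beta> w x (\<delta> + scale (of_int k) \<gamma>) = dual_factor \<gamma> \<beta> w x \<delta>"
  unfolding dual_factor_eq[OF assms(2)]
proof (rule gen_G_cong)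
  have "x \<gamma> \<noteq> 0" using assms(2) by (simp add: dual_nonreal_def)
  then have "(w + x (\<delta> + scale (of_int k) \<gamma>)) / x \<gamma> - (w + x \<delta>) / x \<gamma> = of_int k"
    by (simp add: lin_form_add[OF assms(1)] lin_form_scale_int[OF assms(1)] add_divide_distrib)
  then show "(w + x (\<delta> + scale (of_int k) \<gamma>)) / x \<gamma> - (w + x \<delta>) / x \<gamma> \<in> \<int>" by simp
qed simp

lemma dual_prod_transversal:
  assumes "lin_form x" "dual_nonreal \<gamma> \<beta> x" "transversal T g (dual_region b \<beta> v) \<gamma>"
  shows "dual_prod \<gamma> b \<beta> v w x = (\<Prod>t\<in>T. dual_factor \<gamma> \<beta> w x (g t))"
  unfolding dual_prod_def
  by (rule prod_quotient_transversal[OF assms(3) dual_factor_periodic[OF assms(1,2)]])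

text \<open>Stretching \<open>\<beta> i\<close> by N makes the region N times as long in the
  direction measured by \<open>b i\<close>; it is cut into N translates by multiples of
  \<open>\<beta> i\<close>.\<close>

lemma transversal_multiple:
  assumes \<beta>: "is_dual b \<beta>" and i: "i < n - 1" and v: "v \<in> V_mod_L"
    and T: "transversal T g (dual_region b \<beta> v) \<gamma>" and N: "N > 0"
  shows "transversal (T \<times> {..<N}) (\<lambda>(t, m). g t + scale (of_nat m) (\<beta> i))
    (dual_region b (\<beta>(i := scale (of_nat N) (\<beta> i))) v) \<gamma>"
  unfolding transversal_def
proof (intro conjI ballI)
  let ?R = "dual_region b \<beta> v" and ?R' = "dual_region b (\<beta>(i := scale (of_nat N) (\<beta> i))) v"
  let ?m = "b i (\<beta> i)"
  have m: "?m > 0" and bL: "\<beta> i \<in> L" using \<beta> i by (auto simp: is_dual_def)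
  have bi: "b i (\<delta> + scale r (\<beta> i)) = b i \<delta> + r * ?m" for \<delta> r
    by (simp add: lin_form_add[OF lin_form_b[OF i]] lin_form_scale[OF lin_form_b[OF i]])
  have bk: "b k (\<delta> + scale r (\<beta> i)) = b k \<delta>" if "k < n - 1" "k \<noteq> i" for \<delta> r k
    using \<beta> i that by (simp add: lin_form_add[OF lin_form_b[OF that(1)]] lin_form_scale[OF lin_form_b[OF that(1)]] is_dual_def)
  have R': "\<delta> \<in> ?R' \<longleftrightarrow> \<delta> \<in> v \<and> (\<forall>k<n-1. 0 \<le> b k \<delta> \<and> (k \<noteq> i \<longrightarrow> b k \<delta> < b k (\<beta> k))) \<and> b i \<delta> < of_nat N * ?m" for \<delta>
    using i by (auto simp: dual_region_def lin_form_scale[OF lin_form_b[OF i]])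
  have vL: "\<delta> \<in> v \<Longrightarrow> \<delta> + scale (of_int k) (\<beta> i) \<in> v" for \<delta> and k :: int
    by (rule V_mod_L_add[OF v _ L_scale[OF Ints_of_int bL]])
  show "(\<lambda>(t, m). g t + scale (of_nat m) (\<beta> i)) ` (T \<times> {..<N}) \<subseteq> ?R'"
  proof clarify
    fix t k assume t: "t \<in> T" and k: "k < N"
    have gt: "g t \<in> ?R" using T t by (auto simp: transversal_def)
    have lt: "b i (g t) < ?m" and ge: "0 \<le> b i (g t)" using gt i by (auto simp: dual_region_def)
    have "of_nat k * ?m + ?m = (of_nat (Suc k)) * ?m" by (simp add: algebra_simps)
    also have "\<dots> \<le> of_nat N * ?m" using k m by (intro mult_right_mono) (auto simp del: of_nat_Suc)
    finally have "b i (g t) + of_nat k * ?m < of_nat N * ?m" using lt by linarith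
    moreover have "0 \<le> b i (g t) + of_nat k * ?m" using ge m by simp
    moreover have "g t + scale (of_nat k) (\<beta> i) \<in> v" using vL[of "g t" "int k"] gt by (simp add: dual_region_def)
    ultimately show "g t + scale (of_nat k) (\<beta> i) \<in> ?R'"
      unfolding R' using gt bi bk by (auto simp: dual_region_def) (metis bi bk)+
  qed
  fix \<delta> assume d: "\<delta> \<in> ?R'"
  define q where "q = \<lfloor>b i \<delta> / ?m\<rfloor>"
  have q: "of_int q * ?m \<le> b i \<delta>" "b i \<delta> < (of_int q + 1) * ?m"
    unfolding q_def using floor_divide_lower[OF m, of "b i \<delta>"] floor_divide_upper[OF m, of "b i \<delta>"] by auto
  have "0 \<le> b i \<delta>" "b i \<delta> < of_nat N * ?m" using d i unfolding R' by auto
  then have "0 * ?m < (of_int q + 1) * ?m" "of_int q * ?m < of_nat N * ?m" using q by linarith+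
  then have "(0::rat) < of_int q + 1" "of_int q < (of_nat N :: rat)"
    using m by (simp_all only: mult_less_cancel_right_pos)
  then have q0: "0 \<le> q" "nat q < N" by linarith+
  then have qn: "of_nat (nat q) = (of_int q :: rat)" by simp
  define \<delta>' where "\<delta>' = \<delta> + scale (- of_int q) (\<beta> i)"
  have \<delta>: "\<delta> = \<delta>' + scale (of_int q) (\<beta> i)" by (simp add: \<delta>'_def)
  have bi': "b i \<delta>' = b i \<delta> - of_int q * ?m" unfolding \<delta>'_def bi by simp
  have "\<delta>' \<in> v" using vL[of \<delta> "- q"] d unfolding R' \<delta>'_def by simp
  moreover have "0 \<le> b k \<delta>' \<and> b k \<delta>' < b k (\<beta> k)" if k: "k < n - 1" for k
  proof (cases "k = i")
    case True
    then show ?thesis using q bi' by (auto simp: algebra_simps)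
  next
    case False
    have "b k \<delta>' = b k \<delta>" unfolding \<delta>'_def by (rule bk[OF k False])
    then show ?thesis using d k False unfolding R' by simp
  qed
  ultimately have mem: "\<delta>' \<in> ?R" by (simp add: dual_region_def)
  then have ex1: "\<exists>!t. t \<in> T \<and> (\<exists>k::int. \<delta>' = g t + scale (of_int k) \<gamma>)"
    using T by (auto simp: transversal_def)
  then obtain t k where t: "t \<in> T" "\<delta>' = g t + scale (of_int k) \<gamma>" by blast
  show "\<exists>!s. s \<in> T \<times> {..<N} \<and> (\<exists>k::int. \<delta> = (case s of (t, m) \<Rightarrow> g t + scale (of_nat m) (\<beta> i)) + scale (of_int k) \<gamma>)"
  proof (rule ex1I[of _ "(t, nat q)"])
    show "(t, nat q) \<in> T \<times> {..<N} \<and> (\<exists>k::int. \<delta> = (case (t, nat q) of (t, m) \<Rightarrow> g t + scale (of_nat m) (\<beta> i)) + scale (of_int k) \<gamma>)"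
      using t q0 \<delta> qn by (auto intro!: exI[of _ k] simp: algebra_simps)
    fix s assume s: "s \<in> T \<times> {..<N} \<and> (\<exists>k::int. \<delta> = (case s of (t, m) \<Rightarrow> g t + scale (of_nat m) (\<beta> i)) + scale (of_int k) \<gamma>)"
    then obtain t' m' and k' :: int where s': "s = (t', m')" "t' \<in> T" "m' < N"
      "\<delta> = g t' + scale (of_nat m') (\<beta> i) + scale (of_int k') \<gamma>" by auto
    have gt: "0 \<le> b i (g t')" "b i (g t') < ?m" using T s'(2) i by (auto simp: transversal_def dual_region_def)
    have "b i \<delta> = b i (g t') + of_nat m' * ?m"
      unfolding s'(4) b_add_gamma[OF i] bi ..
    then have "of_int q * ?m < (of_int (int m') + 1) * ?m" "of_int (int m') * ?m < (of_int q + 1) * ?m"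
      using q gt by (simp_all add: algebra_simps)
    then have "(of_int q :: rat) < of_int (int m') + 1" "(of_int (int m') :: rat) < of_int q + 1"
      using m by (simp_all only: mult_less_cancel_right_pos)
    then have mq: "int m' = q" by linarith
    then have "\<delta>' = g t' + scale (of_int k') \<gamma>"
      unfolding \<delta>'_def s'(4) by (auto simp: algebra_simps)
    then have "t' = t" using ex1 t s'(2) by blast
    then show "s = (t, nat q)" using s'(1) mq by auto
  qed
qed

text \<open>The N translates in the region are compensated by the distribution relation of
  \<open>gen_G\<close> for the modulus i, which is multiplied by N.\<close>

lemma dual_prod_multiple:
  assumes \<beta>: "is_dual b \<beta>" and i: "i < n - 1" and v: "v \<in> V_mod_L" and N: "N > 0"
    and x: "lin_form x" and nr: "dual_nonreal \<gamma> \<beta> x"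
  shows "dual_nonreal \<gamma> (\<beta>(i := scale (of_nat N) (\<beta> i))) x"
    and "dual_prod \<gamma> b (\<beta>(i := scale (of_nat N) (\<beta> i))) v w x = dual_prod \<gamma> b \<beta> v w x"
proof -
  let ?\<beta> = "\<beta>(i := scale (of_nat N) (\<beta> i))"
  let ?\<tau> = "\<lambda>k. x (\<beta> k) / x \<gamma>"
  define T where "T = {\<delta> \<in> dual_region b \<beta> v. 0 \<le> a j \<delta> \<and> a j \<delta> < a j (\<alpha> j)}"
  have xs: "x (scale (of_nat m) u) = of_nat m * x u" for m u
    using lin_form_scale_int[OF x, of "int m"] by simp
  have tau: "(\<lambda>k. x (?\<beta> k) / x \<gamma>) = ?\<tau>(i := of_nat N * ?\<tau> i)"
    by (auto simp: fun_eq_iff xs)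
  show nr': "dual_nonreal \<gamma> ?\<beta> x"
  proof -
    have im: "Im (of_nat N * u) = real N * Im u" for u by simp
    have "Im (x (?\<beta> k) / x \<gamma>) \<noteq> 0" if k: "k < n - 1" for k
    proof (cases "k = i")
      case True
      have "x (?\<beta> i) / x \<gamma> = of_nat N * ?\<tau> i" using fun_cong[OF tau, of i] by simp
      then have "Im (x (?\<beta> i) / x \<gamma>) = real N * Im (?\<tau> i)" by (simp only: im)
      then show ?thesis using nr k N True by (simp add: dual_nonreal_def)
    qed (use nr k in \<open>simp add: dual_nonreal_def\<close>)
    then show ?thesis using nr by (auto simp: dual_nonreal_def)
  qed
  have T: "transversal T id (dual_region b \<beta> v) \<gamma>" unfolding T_def by (rule transversal_box[OF v])
  have mem: "i \<in> {..n - 2}" using i by auto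
  have "dual_prod \<gamma> b ?\<beta> v w x = (\<Prod>(t, m)\<in>T \<times> {..<N}. dual_factor \<gamma> ?\<beta> w x (t + scale (of_nat m) (\<beta> i)))"
    using dual_prod_transversal[OF x nr' transversal_multiple[OF \<beta> i v T N]] by (simp add: case_prod_beta)
  also have "\<dots> = (\<Prod>t\<in>T. \<Prod>m<N. dual_factor \<gamma> ?\<beta> w x (t + scale (of_nat m) (\<beta> i)))"
    by (rule prod.cartesian_product[symmetric])
  also have "\<dots> = (\<Prod>t\<in>T. dual_factor \<gamma> \<beta> w x t)"
  proof (intro prod.cong refl)
    fix t
    have "(\<Prod>m<N. dual_factor \<gamma> ?\<beta> w x (t + scale (of_nat m) (\<beta> i)))
       = (\<Prod>m<N. gen_G {..n-2} (?\<tau>(i := of_nat N * ?\<tau> i)) ((w + x t) / x \<gamma> + of_nat m * ?\<tau> i))"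
      unfolding dual_factor_eq[OF nr'] tau
      by (simp add: lin_form_add[OF x] xs add_divide_distrib add.assoc)
    also have "\<dots> = dual_factor \<gamma> \<beta> w x t"
      unfolding dual_factor_eq[OF nr]
      by (rule gen_G_distribution[OF nonreal_dual[OF nr] mem N, symmetric])
    finally show "(\<Prod>m<N. dual_factor \<gamma> ?\<beta> w x (t + scale (of_nat m) (\<beta> i))) = dual_factor \<gamma> \<beta> w x t" .
  qed
  also have "\<dots> = dual_prod \<gamma> b \<beta> v w x"
    using dual_prod_transversal[OF x nr T] by simp
  finally show "dual_prod \<gamma> b ?\<beta> v w x = dual_prod \<gamma> b \<beta> v w x" .
qed

text \<open>The forms b vanish on \<gamma>, so the region is unchanged, and the modulus i moves by
  the integer k, which \<open>gen_G\<close> does not see.\<close>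

lemma dual_prod_add_gamma:
  assumes i: "i < n - 1" and x: "lin_form x" and nr: "dual_nonreal \<gamma> \<beta> x"
  shows "dual_nonreal \<gamma> (\<beta>(i := \<beta> i + scale (of_int k) \<gamma>)) x"
    and "dual_prod \<gamma> b (\<beta>(i := \<beta> i + scale (of_int k) \<gamma>)) v w x = dual_prod \<gamma> b \<beta> v w x"
proof -
  let ?\<beta> = "\<beta>(i := \<beta> i + scale (of_int k) \<gamma>)"
  have x0: "x \<gamma> \<noteq> 0" using nr by (simp add: dual_nonreal_def)
  have tau: "x (?\<beta> l) / x \<gamma> - x (\<beta> l) / x \<gamma> = (if l = i then of_int k else 0)" for l
    using x0 by (simp add: lin_form_add[OF x] lin_form_scale_int[OF x] add_divide_distrib)
  then have tau': "x (?\<beta> l) / x \<gamma> = x (\<beta> l) / x \<gamma> + (if l = i then of_int k else 0)" for l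
    unfolding diff_eq_eq by (simp only: add.commute)
  show nr': "dual_nonreal \<gamma> ?\<beta> x"
    using nr unfolding dual_nonreal_def tau' by auto
  have "dual_region b ?\<beta> v = dual_region b \<beta> v"
    unfolding dual_region_def using b_add_gamma[OF i] by auto
  moreover have "dual_factor \<gamma> ?\<beta> w x = dual_factor \<gamma> \<beta> w x"
    unfolding dual_factor_eq[OF nr'] dual_factor_eq[OF nr] fun_eq_iff
    by (intro allI gen_G_cong) (simp_all only: tau, auto)
  ultimately show "dual_prod \<gamma> b ?\<beta> v w x = dual_prod \<gamma> b \<beta> v w x" by (simp add: dual_prod_def)
qed

text \<open>Suitable positive multiples of \<open>\<beta> i\<close> and \<open>\<beta>' i\<close>
  agree under \<open>b i\<close>, and the other forms vanish on both; by \<open>kernel_b\<close>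
  they differ by a multiple of \<gamma>. Stretching, adding this multiple and undoing the other
  stretch connects the two families.\<close>

lemma dual_prod_change_one:
  assumes \<beta>: "is_dual b \<beta>" and \<beta>': "is_dual b \<beta>'" and i: "i < n - 1" and v: "v \<in> V_mod_L"
    and x: "lin_form x" and nr: "dual_nonreal \<gamma> \<beta> x"
  shows "dual_nonreal \<gamma> (\<beta>(i := \<beta>' i)) x \<and> dual_prod \<gamma> b (\<beta>(i := \<beta>' i)) v w x = dual_prod \<gamma> b \<beta> v w x"
proof -
  let ?\<beta> = "\<beta>(i := \<beta>' i)"
  have d: "is_dual b ?\<beta>" using is_dual_upd[OF \<beta> \<beta>'] .
  have pos: "b i (\<beta> i) > 0" "b i (\<beta>' i) > 0" and mem: "\<beta> i \<in> L" "\<beta>' i \<in> L"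
    using \<beta> \<beta>' i by (auto simp: is_dual_def)
  obtain p where p: "b i (\<beta>' i) = of_int p" using b_Ints[OF i mem(2)] by (auto elim: Ints_cases)
  obtain q where q: "b i (\<beta> i) = of_int q" using b_Ints[OF i mem(1)] by (auto elim: Ints_cases)
  \<comment> \<open>Crosswise: N is the value of \<open>b i\<close> at \<open>\<beta>' i\<close>,
    and N' the value at \<open>\<beta> i\<close>.\<close>
  define N where "N = nat p"
  define N' where "N' = nat q"
  have N: "N > 0" "N' > 0" "of_nat N = (of_int p :: rat)" "of_nat N' = (of_int q :: rat)"
    using pos p q by (auto simp: N_def N'_def)
  have "scale (of_nat N) (\<beta> i) - scale (of_nat N') (\<beta>' i) \<in> L"
    using mem by (intro L_diff L_scale) auto
  moreover have "b k (scale (of_nat N) (\<beta> i) - scale (of_nat N') (\<beta>' i)) = 0" if k: "k < n - 1" for k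
  proof -
    have "b k (scale (of_nat N) (\<beta> i) - scale (of_nat N') (\<beta>' i)) = of_nat N * b k (\<beta> i) - of_nat N' * b k (\<beta>' i)"
      using lin_form_b[OF k] by (simp add: lin_form_diff lin_form_scale)
    then show ?thesis using \<beta> \<beta>' i k p q N by (cases "k = i") (auto simp: is_dual_def)
  qed
  ultimately obtain k :: int where "scale (of_nat N) (\<beta> i) - scale (of_nat N') (\<beta>' i) = scale (of_int k) \<gamma>"
    by (rule kernel_b)
  then have k: "scale (of_nat N) (\<beta> i) = scale (of_nat N') (\<beta>' i) + scale (of_int k) \<gamma>"
    by (simp add: algebra_simps)
  have x0: "x \<gamma> \<noteq> 0" using nr by (simp add: dual_nonreal_def)
  have "of_nat N * x (\<beta> i) = of_nat N' * x (\<beta>' i) + of_int k * x \<gamma>"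
    using arg_cong[OF k, of x] by (simp add: lin_form_add[OF x] lin_form_scale[OF x])
  then have "of_nat N * (x (\<beta> i) / x \<gamma>) = of_nat N' * (x (\<beta>' i) / x \<gamma>) + of_int k"
    using x0 by (simp add: field_simps)
  moreover have "real N * Im u = real N' * Im u'" if "of_nat N * u = of_nat N' * u' + of_int k" for u u'
    using arg_cong[OF that, of Im] by simp
  ultimately have "real N * Im (x (\<beta> i) / x \<gamma>) = real N' * Im (x (\<beta>' i) / x \<gamma>)" by blast
  \<comment> \<open>Up to a positive factor the two imaginary parts agree, so nonreality passes to
    the new family, as \<open>dual_prod_multiple\<close> demands for it.\<close>
  then have "Im (x (\<beta>' i) / x \<gamma>) \<noteq> 0" using nr i N by (auto simp: dual_nonreal_def)
  then have nr': "dual_nonreal \<gamma> ?\<beta> x" using nr by (auto simp: dual_nonreal_def)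
  have "dual_prod \<gamma> b \<beta> v w x = dual_prod \<gamma> b (\<beta>(i := scale (of_nat N) (\<beta> i))) v w x"
    using dual_prod_multiple(2)[OF \<beta> i v N(1) x nr] by simp
  also have "\<beta>(i := scale (of_nat N) (\<beta> i)) = (?\<beta>(i := scale (of_nat N') (?\<beta> i)))(i := (?\<beta>(i := scale (of_nat N') (?\<beta> i))) i + scale (of_int k) \<gamma>)"
    using k by simp
  also have "dual_prod \<gamma> b \<dots> v w x = dual_prod \<gamma> b (?\<beta>(i := scale (of_nat N') (?\<beta> i))) v w x"
    by (rule dual_prod_add_gamma(2)[OF i x dual_prod_multiple(1)[OF d i v N(2) x nr']])
  also have "\<dots> = dual_prod \<gamma> b ?\<beta> v w x"
    by (rule dual_prod_multiple(2)[OF d i v N(2) x nr'])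
  finally show ?thesis using nr' by simp
qed

text \<open>The vectors are exchanged one at a time; nonreality has to travel along, since
  \<open>geom_G_defined\<close> speaks only of the chosen family.\<close>

lemma dual_prod_independent:
  assumes \<beta>: "is_dual b \<beta>" and \<beta>': "is_dual b \<beta>'" and v: "v \<in> V_mod_L"
    and x: "lin_form x" and nr: "dual_nonreal \<gamma> \<beta> x"
  shows "dual_nonreal \<gamma> \<beta>' x \<and> dual_prod \<gamma> b \<beta>' v w x = dual_prod \<gamma> b \<beta> v w x"
proof -
  let ?B = "\<lambda>m i. if i < m then \<beta>' i else \<beta> i"
  have "is_dual b (?B m) \<and> dual_nonreal \<gamma> (?B m) x \<and> dual_prod \<gamma> b (?B m) v w x = dual_prod \<gamma> b \<beta> v w x"
    if "m \<le> n - 1" for m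
    using that
  proof (induction m)
    case 0
    then show ?case using \<beta> nr by simp
  next
    case (Suc m)
    then have IH: "is_dual b (?B m)" "dual_nonreal \<gamma> (?B m) x" "dual_prod \<gamma> b (?B m) v w x = dual_prod \<gamma> b \<beta> v w x"
      by auto
    have eq: "?B (Suc m) = (?B m)(m := \<beta>' m)" by (auto simp: fun_eq_iff less_Suc_eq)
    show ?case
      unfolding eq using dual_prod_change_one[OF IH(1) \<beta>' _ v x IH(2), of m] is_dual_upd[OF IH(1) \<beta>', of m] IH(3) Suc.prems
      by auto
  qed
  from this[of "n - 1"] have B: "dual_nonreal \<gamma> (?B (n - 1)) x" "dual_prod \<gamma> b (?B (n - 1)) v w x = dual_prod \<gamma> b \<beta> v w x"
    by auto
  have nr': "dual_nonreal \<gamma> \<beta>' x" using B(1) by (auto simp: dual_nonreal_def)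
  have "dual_region b (?B (n - 1)) v = dual_region b \<beta>' v" by (auto simp: dual_region_def)
  moreover have "dual_factor \<gamma> (?B (n - 1)) w x = dual_factor \<gamma> \<beta>' w x"
    unfolding dual_factor_eq[OF B(1)] dual_factor_eq[OF nr'] fun_eq_iff
    using n2 by (intro allI gen_G_cong') auto
  ultimately have "dual_prod \<gamma> b \<beta>' v w x = dual_prod \<gamma> b (?B (n - 1)) v w x" by (simp add: dual_prod_def)
  then show ?thesis using B(2) nr' by simp
qed

lemma chosen_dual_is_dual: "is_dual b (chosen_dual b)"
proof -
  have "pos_dual_family (n - 1) b (chosen_dual b)"
    unfolding chosen_dual_def by (rule someI[of "pos_dual_family (n - 1) b", OF pos_dual_family_omit[OF reg j]])
  then show ?thesis by (rule pos_dual_is_dual)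
qed

lemma geom_G_defined_dual:
  assumes "is_dual b \<beta>" "lin_form x" "v \<in> V_mod_L"
  shows "geom_G_defined b x \<longleftrightarrow> dual_nonreal \<gamma> \<beta> x"
  unfolding geom_G_defined_iff
  using dual_prod_independent[OF assms(1) chosen_dual_is_dual assms(3,2)]
    dual_prod_independent[OF chosen_dual_is_dual assms(1,3,2)] by blast

lemma geom_G_dual:
  assumes "is_dual b \<beta>" "lin_form x" "v \<in> V_mod_L" "dual_nonreal \<gamma> \<beta> x"
  shows "geom_G b v w x = dual_prod \<gamma> b \<beta> v w x"
  unfolding geom_G_eq using dual_prod_independent[OF assms(1) chosen_dual_is_dual assms(3,2,4)] by blast

end

section \<open>The modular property of the geometric functions\<close>

context omitted_forms
begin

abbreviation omega :: "('a \<Rightarrow> complex) \<Rightarrow> nat \<Rightarrow> complex" where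
  "omega x \<equiv> \<lambda>k. x (\<alpha> k)"

lemma is_dual_omit: "is_dual b (omit j \<alpha>)"
  using pos_dual_is_dual[OF pos_dual_family_omit[OF reg j]] by (auto simp: is_dual_def)

lemma dual_nonreal_omit:
  assumes "adm {..<n} (omega x)" "lin_form x"
  shows "dual_nonreal \<gamma> (omit j \<alpha>) x"
proof -
  have xg: "x \<gamma> = of_int (omit_sign a j) * omega x j"
    by (simp add: gamma_eq lin_form_scale_int[OF assms(2)])
  have "Im (x (omit j \<alpha> i) / x \<gamma>) \<noteq> 0" if i: "i < n - 1" for i
  proof -
    have "Im (omega x (omit j id i) / omega x j) \<noteq> 0"
      using assms(1) omit_index[OF i] j by (auto simp: adm_def)
    moreover have "x (omit j \<alpha> i) = omega x (omit j id i)" by (simp only: omit_apply[of j \<alpha>])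
    ultimately show ?thesis using omit_sign_cases unfolding xg by auto
  qed
  then show ?thesis using assms(1) j omit_sign_cases unfolding dual_nonreal_def xg by (auto simp: adm_def)
qed

lemma B_region_eq:
  "{\<delta> \<in> dual_region b (omit j \<alpha>) v. 0 \<le> a j \<delta> \<and> a j \<delta> < a j (\<alpha> j)} = B_region a v"
proof (intro subset_antisym subsetI)
  fix \<delta> assume d: "\<delta> \<in> {\<delta> \<in> dual_region b (omit j \<alpha>) v. 0 \<le> a j \<delta> \<and> a j \<delta> < a j (\<alpha> j)}"
  have "0 \<le> a k \<delta> \<and> a k \<delta> < a k (\<alpha> k)" if k: "k < n" for k
  proof (cases "k = j")
    case False
    then obtain i where "i < n - 1" "k = omit j id i" using omit_index_surj[OF k] by blast
    then show ?thesis using d by (auto simp: dual_region_def omit_apply[of j a] omit_apply[of j \<alpha>])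
  qed (use d in auto)
  then show "\<delta> \<in> B_region a v" using d by (auto simp: B_region_def dual_region_def)
next
  fix \<delta> assume d: "\<delta> \<in> B_region a v"
  then show "\<delta> \<in> {\<delta> \<in> dual_region b (omit j \<alpha>) v. 0 \<le> a j \<delta> \<and> a j \<delta> < a j (\<alpha> j)}"
    using omit_index j by (auto simp: B_region_def dual_region_def omit_apply[of j a] omit_apply[of j \<alpha>])
qed

text \<open>The normal vector is \<open>\<alpha> j\<close> up to sign. With the minus sign all
  arguments of G are negated, which inverts it by \<open>gen_G_minus\<close>; this accounts for the
  exponent \<open>omit_sign a j\<close>.\<close>

lemma geom_G_omit:
  assumes "adm {..<n} (omega x)" "lin_form x" "v \<in> V_mod_L"
  shows "geom_G_defined b x"
    and "geom_G b v w x = (\<Prod>\<delta>\<in>B_region a v. modular_factor {..<n} (omega x) j (w + x \<delta>) powi omit_sign a j)"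
proof -
  note nr = dual_nonreal_omit[OF assms(1,2)]
  show "geom_G_defined b x" using geom_G_defined_dual[OF is_dual_omit assms(2,3)] nr by blast
  have xg: "x \<gamma> = of_int (omit_sign a j) * omega x j"
    by (simp add: gamma_eq lin_form_scale_int[OF assms(2)])
  have xa: "x (omit j \<alpha> i) = omega x (omit j id i)" for i by (simp only: omit_apply[of j \<alpha>])
  have re: "gen_G {..n-2} (\<lambda>i. omega x (omit j id i) / omega x j) z
      = gen_G ({..<n} - {j}) (\<lambda>k. omega x k / omega x j) z" for z
    by (rule gen_G_reindex[OF bij_betw_omit[OF j n2], of "\<lambda>k. omega x k / omega x j"])
  have nonr: "nonreal {..n-2} (\<lambda>i. omega x (omit j id i) / omega x j)"
    using assms(1) omit_index j n2 by (auto simp: nonreal_def adm_def)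
  have "dual_factor \<gamma> (omit j \<alpha>) w x \<delta> = modular_factor {..<n} (omega x) j (w + x \<delta>) powi omit_sign a j" for \<delta>
  proof (cases "omit_sign a j = 1")
    case True
    then show ?thesis
      unfolding dual_factor_eq[OF nr] xg xa modular_factor_def re[symmetric] by simp
  next
    case False
    then have s: "omit_sign a j = - 1" using omit_sign_cases by blast
    show ?thesis
      using gen_G_minus[OF nonr, of "(w + x \<delta>) / omega x j"]
      unfolding dual_factor_eq[OF nr] xg xa modular_factor_def re[symmetric] s by (simp add: power_int_minus)
  qed
  moreover have "dual_prod \<gamma> b (omit j \<alpha>) v w x = (\<Prod>\<delta>\<in>B_region a v. dual_factor \<gamma> (omit j \<alpha>) w x \<delta>)"
    using dual_prod_transversal[OF assms(2) nr transversal_box[OF assms(3)]] unfolding B_region_eq by simp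
  ultimately show "geom_G b v w x = (\<Prod>\<delta>\<in>B_region a v. modular_factor {..<n} (omega x) j (w + x \<delta>) powi omit_sign a j)"
    unfolding geom_G_dual[OF is_dual_omit assms(2,3) nr] by simp
qed

end

lemma e2pi_sum: "e2pi (\<Sum>i\<in>A. f i) = (\<Prod>i\<in>A. e2pi (f i))"
  by (induction A rule: infinite_finite_induct) (auto simp: e2pi_add)

lemma powi_sign:
  fixes c :: complex
  assumes "s = 1 \<or> s = (-1::int)" "t = 1 \<or> t = (-1::int)"
  shows "(c powi s) powi t = c powi (s * t)"
  using assms by (auto simp: power_int_minus)

context based_lattice
begin

definition geom_B_sign :: "(nat \<Rightarrow> 'v \<Rightarrow> rat) \<Rightarrow> int" where
  "geom_B_sign a = (if (-1) ^ n * det_forms a > 0 then 1 else - 1)"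

text \<open>The alternating exponent and the orientation of the normal vector combine to a sign
  independent of j, so the factors for different j can be collected into one power.\<close>

lemma omit_sign_mult:
  assumes "n \<ge> 1" "regular_forms a"
  shows "omit_sign a j * (-1) ^ j = - geom_B_sign a"
proof -
  have p: "(-1) ^ n = - ((-1) ^ (n - 1) :: rat)" using assms(1) by (cases n) auto
  have "det_forms a \<noteq> 0" using assms(2) by (simp add: regular_forms_def)
  then show ?thesis unfolding omit_sign_def geom_B_sign_def p power_add
    by (cases "even j"; cases "even (n - 1)") auto
qed

lemma geom_B_eq:
  assumes "regular_forms a"
  shows "geom_B a v w x = of_int (geom_B_sign a) *
    (\<Sum>\<delta>\<in>B_region a v. gen_B {..<n} (\<lambda>k. x (primitive_pos_dual a k)) (w + x \<delta>))"
proof -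
  have "det_forms a \<noteq> 0" using assms(1) by (simp add: regular_forms_def)
  then have "(of_rat (sgn ((-1) ^ n * det_forms a)) :: complex) = of_int (geom_B_sign a)"
    by (auto simp: geom_B_sign_def sgn_if)
  then show ?thesis
    unfolding geom_B_def Let_def multiple_bernoulli_def gen_B_def bern_fps_def sum_distrib_left[symmetric]
      sum_divide_distrib[symmetric]
    by (simp add: field_simps)
qed

text \<open>With indices starting at 0, the exponent \<open>(-1) ^ j\<close> is the alternating sign
  that begins with +1. Interchanging the two products leaves one \<open>modular_prod\<close> for
  each \<delta> in \<open>B_region a v\<close>.\<close>

lemma geom_modular:
  assumes "n \<ge> 2" "regular_forms a" "v \<in> V_mod_L" "lin_form x"
    and adm: "adm {..<n} (\<lambda>k. x (primitive_pos_dual a k))"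
    and nz: "\<And>\<delta> k. \<delta> \<in> B_region a v \<Longrightarrow> k < n \<Longrightarrow> modular_factor {..<n} (\<lambda>k. x (primitive_pos_dual a k)) k (w + x \<delta>) \<noteq> 0"
  shows "\<forall>j<n. geom_G_defined (omit j a) x" "geom_B_defined a x"
    "(\<Prod>j<n. geom_G (omit j a) v w x powi ((-1) ^ j)) = exp (2 * \<i> * of_real pi * geom_B a v w x)"
proof -
  let ?\<omega> = "\<lambda>k. x (primitive_pos_dual a k)"
  have om: "omitted_forms scale n e a j" if "j < n" for j
    using assms that by unfold_locales auto
  note G = omitted_forms.geom_G_omit[OF om adm assms(4,3)]
  show "\<forall>j<n. geom_G_defined (omit j a) x" using G(1) by blast
  show "geom_B_defined a x" using adm by (auto simp: geom_B_defined_def adm_def)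
  have sg: "geom_B_sign a = 1 \<or> geom_B_sign a = - 1" by (auto simp: geom_B_sign_def)
  have os: "omit_sign a j = 1 \<or> omit_sign a j = - 1" for j by (auto simp: omit_sign_def)
  have "(\<Prod>j<n. geom_G (omit j a) v w x powi ((-1) ^ j)) =
      (\<Prod>j<n. \<Prod>\<delta>\<in>B_region a v. modular_factor {..<n} ?\<omega> j (w + x \<delta>) powi (- geom_B_sign a))"
  proof (intro prod.cong refl)
    fix j assume "j \<in> {..<n}"
    then have j: "j < n" by simp
    show "geom_G (omit j a) v w x powi ((-1) ^ j) =
        (\<Prod>\<delta>\<in>B_region a v. modular_factor {..<n} ?\<omega> j (w + x \<delta>) powi (- geom_B_sign a))"
      unfolding G(2)[OF j] prod_powi_distrib powi_sign[OF os minus_one_power_cases]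
      using omit_sign_mult[of a j] assms(1,2) by simp
  qed
  also have "\<dots> = (\<Prod>\<delta>\<in>B_region a v. (\<Prod>j<n. modular_factor {..<n} ?\<omega> j (w + x \<delta>)) powi (- geom_B_sign a))"
    unfolding prod_powi_distrib by (rule prod.swap)
  also have "\<dots> = (\<Prod>\<delta>\<in>B_region a v. e2pi (of_int (geom_B_sign a) * gen_B {..<n} ?\<omega> (w + x \<delta>)))"
  proof (intro prod.cong refl)
    fix \<delta> assume d: "\<delta> \<in> B_region a v"
    have "modular_prod {..<n} ?\<omega> (w + x \<delta>) = 1"
      using nz[OF d] assms(1) by (intro modular_prod_eq_1[OF adm]) (auto simp: lessThan_empty_iff)
    then have "(\<Prod>j<n. modular_factor {..<n} ?\<omega> j (w + x \<delta>)) = inverse (e2pi (gen_B {..<n} ?\<omega> (w + x \<delta>)))"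
      unfolding modular_prod_def by (metis inverse_unique mult.commute)
    then show "(\<Prod>j<n. modular_factor {..<n} ?\<omega> j (w + x \<delta>)) powi (- geom_B_sign a) =
        e2pi (of_int (geom_B_sign a) * gen_B {..<n} ?\<omega> (w + x \<delta>))"
      using sg by (auto simp: power_int_minus e2pi_minus)
  qed
  also have "\<dots> = e2pi (geom_B a v w x)"
    unfolding geom_B_eq[OF assms(2)]
    by (simp add: e2pi_sum sum_distrib_left)
  finally show "(\<Prod>j<n. geom_G (omit j a) v w x powi ((-1) ^ j)) = exp (2 * \<i> * of_real pi * geom_B a v w x)"
    by (simp add: e2pi_def)
qed

subsection \<open>The domain of the modular property\<close>

lemma topspace_HomC_topology [simp]: "topspace HomC_topology = HomC"
  unfolding HomC_topology_def topspace_pullback_topology by auto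

abbreviation WX :: "(complex \<times> ('v \<Rightarrow> complex)) topology" where
  "WX \<equiv> prod_topology euclidean HomC_topology"

text \<open>\<open>HomC_topology\<close> is an explicit topology on a carrier set; the filter
  \<open>nhdsin\<close> makes the limit lemmas for z and \<omega> applicable to it.\<close>

lemma tendsto_nhdsin:
  assumes "continuous_map X euclidean f" "p \<in> topspace X"
  shows "(f \<longlongrightarrow> f p) (nhdsin X p)"
proof (rule topological_tendstoI)
  fix S assume "open S" "f p \<in> S"
  then have "openin X {q \<in> topspace X. f q \<in> S}"
    using assms(1) by (intro openin_continuous_map_preimage[of X euclidean]) auto
  then show "eventually (\<lambda>q. f q \<in> S) (nhdsin X p)"
    unfolding eventually_nhdsin using \<open>f p \<in> S\<close> assms(2) by blast
qed

lemma continuous_map_eval_e: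
  assumes "i < n"
  shows "continuous_map HomC_topology euclidean (\<lambda>x. x (e i))"
proof -
  have "continuous_map HomC_topology euclidean ((\<lambda>c. c i) \<circ> (\<lambda>x. \<lambda>i\<in>{..<n}. x (e i)))"
    unfolding HomC_topology_def using assms
    by (intro continuous_map_pullback) (auto intro: continuous_map_product_projection)
  then show ?thesis using assms by (simp add: o_def)
qed

text \<open>Evaluation at u is a finite combination of the coordinates \<open>x (e i)\<close>, but
  only for linear x; hence the two agree only eventually near p.\<close>

lemma tendsto_WX:
  assumes "p \<in> topspace WX"
  shows "(fst \<longlongrightarrow> fst p) (nhdsin WX p)" "((\<lambda>q. snd q u) \<longlongrightarrow> snd p u) (nhdsin WX p)"
    and "eventually (\<lambda>q. q \<in> topspace WX) (nhdsin WX p)"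
proof -
  show "(fst \<longlongrightarrow> fst p) (nhdsin WX p)"
    using assms by (intro tendsto_nhdsin continuous_map_fst)
  show ev: "eventually (\<lambda>q. q \<in> topspace WX) (nhdsin WX p)"
    unfolding eventually_nhdsin by (metis openin_topspace)
  have "((\<lambda>q. snd q (e i)) \<longlongrightarrow> snd p (e i)) (nhdsin WX p)" if "i < n" for i
    using continuous_map_compose[OF continuous_map_snd continuous_map_eval_e[OF that]] assms
    by (intro tendsto_nhdsin) (auto simp: o_def)
  then have "((\<lambda>q. \<Sum>i<n. of_rat (coord u i) * snd q (e i)) \<longlongrightarrow> (\<Sum>i<n. of_rat (coord u i) * snd p (e i))) (nhdsin WX p)"
    by (intro tendsto_intros) auto
  also have "(\<Sum>i<n. of_rat (coord u i) * snd p (e i)) = snd p u"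
    using assms by (intro lin_form_expand[symmetric]) (auto simp: HomC_iff)
  finally show "((\<lambda>q. snd q u) \<longlongrightarrow> snd p u) (nhdsin WX p)"
  proof (rule Lim_transform_eventually)
    show "\<forall>\<^sub>F q in nhdsin WX p. (\<Sum>i<n. of_rat (coord u i) * snd q (e i)) = snd q u"
      using ev by (rule eventually_mono) (auto simp: HomC_iff intro: lin_form_expand[symmetric])
  qed
qed

definition modular_domain :: "(nat \<Rightarrow> 'v \<Rightarrow> rat) \<Rightarrow> 'v set \<Rightarrow> (complex \<times> ('v \<Rightarrow> complex)) set" where
  "modular_domain a v = {(w, x). x \<in> HomC \<and> adm {..<n} (\<lambda>k. x (primitive_pos_dual a k)) \<and>
     (\<forall>\<delta>\<in>B_region a v. \<forall>k<n. modular_factor {..<n} (\<lambda>k. x (primitive_pos_dual a k)) k (w + x \<delta>) \<noteq> 0)}"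

lemma finite_B_region: "regular_forms a \<Longrightarrow> v \<in> V_mod_L \<Longrightarrow> finite (B_region a v)"
  unfolding B_region_def by (rule finite_box)

text \<open>The conditions are finitely many, as \<open>B_region a v\<close> is finite, and each is
  stable under small changes by continuity.\<close>

lemma openin_modular_domain:
  assumes "regular_forms a" "v \<in> V_mod_L"
  shows "openin WX (modular_domain a v)"
proof (subst openin_subopen, intro ballI)
  fix p assume p: "p \<in> modular_domain a v"
  let ?\<omega> = "\<lambda>x k. x (primitive_pos_dual a k)"
  have top: "p \<in> topspace WX" using p by (auto simp: modular_domain_def)
  have adm: "adm {..<n} (?\<omega> (snd p))"
    and nz: "\<And>\<delta> k. \<delta> \<in> B_region a v \<Longrightarrow> k < n \<Longrightarrow> modular_factor {..<n} (?\<omega> (snd p)) k (fst p + snd p \<delta>) \<noteq> 0"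
    using p by (auto simp: modular_domain_def)
  note lim = tendsto_WX[OF top]
  have "eventually (\<lambda>q. adm {..<n} (?\<omega> (snd q))) (nhdsin WX p)"
    by (rule eventually_adm[OF adm]) (rule lim(2))
  moreover have "eventually (\<lambda>q. \<forall>\<delta>\<in>B_region a v. \<forall>k\<in>{..<n}. modular_factor {..<n} (?\<omega> (snd q)) k (fst q + snd q \<delta>) \<noteq> 0) (nhdsin WX p)"
  proof (intro eventually_ball_finite ballI finite_B_region[OF assms] finite_lessThan)
    fix \<delta> k assume d: "\<delta> \<in> B_region a v" and k: "k \<in> {..<n}"
    have "((\<lambda>q. modular_factor {..<n} (?\<omega> (snd q)) k (fst q + snd q \<delta>)) \<longlongrightarrow>
        modular_factor {..<n} (?\<omega> (snd p)) k (fst p + snd p \<delta>)) (nhdsin WX p)"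
      using nz[OF d] k by (intro tendsto_modular_factor[OF adm] tendsto_add lim) auto
    then show "eventually (\<lambda>q. modular_factor {..<n} (?\<omega> (snd q)) k (fst q + snd q \<delta>) \<noteq> 0) (nhdsin WX p)"
      by (rule tendsto_imp_eventually_ne) (use nz[OF d] k in auto)
  qed
  ultimately have "eventually (\<lambda>q. q \<in> modular_domain a v) (nhdsin WX p)"
    using lim(3) by eventually_elim (auto simp: modular_domain_def)
  then show "\<exists>T. openin WX T \<and> p \<in> T \<and> T \<subseteq> modular_domain a v"
    unfolding eventually_nhdsin using top by blast
qed

lemma continuous_map_line:
  assumes "lin_form x0" "lin_form y"
  shows "continuous_map euclidean HomC_topology (\<lambda>t::real. \<lambda>u. x0 u + of_real t * y u)"
  unfolding HomC_topology_def
proof (rule continuous_map_pullback')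
  have "continuous_on UNIV (\<lambda>t::real. x0 (e i) + of_real t * y (e i))" for i
    by (intro continuous_intros)
  then show "continuous_map euclidean (product_topology (\<lambda>_. euclidean) {..<n})
      ((\<lambda>x. \<lambda>i\<in>{..<n}. x (e i)) \<circ> (\<lambda>t::real. \<lambda>u. x0 u + of_real t * y u))"
    by (auto simp: continuous_map_componentwise o_def)
  have "lin_form (\<lambda>u. x0 u + of_real t * y u)" for t :: real
    using assms by (auto simp: lin_form_def algebra_simps)
  then show "topspace euclidean \<subseteq> (\<lambda>t::real. \<lambda>u. x0 u + of_real t * y u) -` HomC" by (auto simp: HomC_iff)
qed

text \<open>First x0 is moved along a line on which only finitely many parameters violate
  \<open>adm\<close>; then w0 is moved off a countable set.\<close>

lemma closure_of_modular_domain: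
  assumes "regular_forms a" "v \<in> V_mod_L" "n \<ge> 2"
  shows "WX closure_of modular_domain a v = UNIV \<times> HomC"
proof (rule subset_antisym)
  show "WX closure_of modular_domain a v \<subseteq> UNIV \<times> HomC"
    using closure_of_subset_topspace[of WX] by simp
  show "UNIV \<times> HomC \<subseteq> WX closure_of modular_domain a v"
  proof clarify
    fix w0 :: complex and x0 assume "x0 \<in> HomC"
    then have x0: "lin_form x0" by (simp add: HomC_iff)
    let ?\<alpha> = "primitive_pos_dual a"
    note lf = regular_forms_lin_form[OF assms(1)] and pd = primitive_pos_dual[OF assms(1)]
    \<comment> \<open>A direction whose values \<open>1 + k * \<i>\<close> on the dual vectors have
      pairwise nonreal ratios.\<close>
    define y where "y = (\<lambda>u. \<Sum>k<n. of_rat (a k u / a k (?\<alpha> k)) * Complex 1 (real k))"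
    have y: "lin_form y"
      unfolding lin_form_def
    proof (intro conjI allI)
      show "y (u + u') = y u + y u'" for u u'
        unfolding y_def sum.distrib[symmetric]
        by (intro sum.cong) (auto simp: lin_form_add[OF lf] of_rat_add add_divide_distrib distrib_right)
      show "y (scale r u) = of_rat r * y u" for r u
        unfolding y_def sum_distrib_left
        by (intro sum.cong) (auto simp: lin_form_scale[OF lf] mult.assoc[symmetric] of_rat_mult[symmetric])
    qed
    have y\<alpha>: "y (?\<alpha> k) = Complex 1 (real k)" if k: "k < n" for k
    proof -
      have "y (?\<alpha> k) = (\<Sum>i<n. if i = k then Complex 1 (real i) else 0)"
        unfolding y_def using pd(2,3)[OF k] by (intro sum.cong) auto
      then show ?thesis using k by simp
    qed
    define xt where "xt = (\<lambda>t::real. \<lambda>u. x0 u + of_real t * y u)"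
    have xt: "lin_form (xt t)" for t
      using x0 y by (auto simp: lin_form_def xt_def algebra_simps)
    \<comment> \<open>Up to a positive factor this is the imaginary part of the ratio. As a
      polynomial in t it is quadratic with leading coefficient i - k, so it has finitely many
      zeros.\<close>
    define Q where "Q = (\<lambda>i k t. Im (xt t (?\<alpha> i) * cnj (xt t (?\<alpha> k))))"
    have fin: "finite {t. Q i k t = 0}" if ik: "i < n" "k < n" "i \<noteq> k" for i k
    proof -
      define c0 where "c0 = Im (x0 (?\<alpha> i) * cnj (x0 (?\<alpha> k)))"
      define c1 where "c1 = Im (x0 (?\<alpha> i) * cnj (y (?\<alpha> k)) + y (?\<alpha> i) * cnj (x0 (?\<alpha> k)))"
      define c2 where "c2 = Im (y (?\<alpha> i) * cnj (y (?\<alpha> k)))"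
      have "c2 = real i - real k" using ik by (simp add: c2_def y\<alpha>)
      then have "c2 \<noteq> 0" using ik by simp
      then have "finite {t. poly [:c0, c1, c2:] t = 0}" by (intro poly_roots_finite) simp
      moreover have "Q i k t = poly [:c0, c1, c2:] t" for t
        by (simp add: Q_def xt_def c0_def c1_def c2_def algebra_simps)
      ultimately show ?thesis by simp
    qed
    define Bad where "Bad = (\<Union>i\<in>{..<n}. \<Union>k\<in>{..<n}-{i}. {t. Q i k t = 0})"
    have finBad: "finite Bad" unfolding Bad_def using fin by (intro finite_UN_I) auto
    have adm: "adm {..<n} (\<lambda>k. xt t (?\<alpha> k))" if t: "t \<notin> Bad" for t
    proof -
      have Q: "Q i k t \<noteq> 0" if "i < n" "k < n" "i \<noteq> k" for i k using t that by (auto simp: Bad_def)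
      have nz: "xt t (?\<alpha> k) \<noteq> 0" if k: "k < n" for k
      proof -
        \<comment> \<open>A second index exists because \<open>n \<ge> 2\<close>; a nonzero
          \<open>Q i k t\<close> forces the value at k to be nonzero.\<close>
        obtain i where "i < n" "i \<noteq> k" using assms(3) that[of "if k = 0 then 1 else 0"] by (auto split: if_splits)
        then show ?thesis using Q[of i k] k by (auto simp: Q_def)
      qed
      have "Im (xt t (?\<alpha> i) / xt t (?\<alpha> k)) \<noteq> 0" if ik: "i < n" "k < n" "i \<noteq> k" for i k
      proof
        assume im: "Im (xt t (?\<alpha> i) / xt t (?\<alpha> k)) = 0"
        have "xt t (?\<alpha> i) * cnj (xt t (?\<alpha> k)) = (xt t (?\<alpha> i) / xt t (?\<alpha> k)) * of_real ((cmod (xt t (?\<alpha> k)))\<^sup>2)"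
          unfolding complex_norm_square using nz[OF ik(2)] by simp
        then have "Q i k t = Im (xt t (?\<alpha> i) / xt t (?\<alpha> k)) * (cmod (xt t (?\<alpha> k)))\<^sup>2"
          unfolding Q_def by (simp only: times_complex.sel Re_complex_of_real Im_complex_of_real mult_zero_right add_0)
        then show False using im Q[OF ik] by simp
      qed
      then show ?thesis using nz by (auto simp: adm_def)
    qed
    show "(w0, x0) \<in> WX closure_of modular_domain a v"
      unfolding in_closure_of
    proof (intro conjI allI impI)
      show "(w0, x0) \<in> topspace WX" using \<open>x0 \<in> HomC\<close> by simp
      fix T assume "(w0, x0) \<in> T \<and> openin WX T"
      then obtain A B where AB: "openin euclidean A" "openin HomC_topology B" "w0 \<in> A" "x0 \<in> B" "A \<times> B \<subseteq> T"
        unfolding openin_prod_topology_alt by metis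
      have "openin euclidean {t \<in> topspace euclidean. xt t \<in> B}"
        unfolding xt_def by (rule openin_continuous_map_preimage[OF continuous_map_line[OF x0 y] AB(2)])
      then have "open {t. xt t \<in> B}" by simp
      moreover have "xt 0 = x0" by (simp add: xt_def fun_eq_iff)
      then have "0 \<in> {t. xt t \<in> B}" using AB(4) by simp
      ultimately obtain d where d: "d > 0" "ball 0 d \<subseteq> {t. xt t \<in> B}" by (meson openE)
      have "infinite ({0<..<d} - Bad)" using d(1) finBad by (simp add: infinite_Ioo)
      then have "{0<..<d} - Bad \<noteq> {}" by (metis finite.emptyI)
      then obtain t where t: "t \<in> {0<..<d}" "t \<notin> Bad" by blast
      have "t \<in> ball 0 d" using t(1) by simp
      then have tB: "xt t \<in> B" using d(2) by blast
      \<comment> \<open>For this t, the points w for which some \<open>w + xt t \<delta>\<close>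
        lies in the span.\<close>
      define C where "C = (\<Union>\<delta>\<in>B_region a v. (\<lambda>s. s - xt t \<delta>) ` int_span {..<n} (\<lambda>k. xt t (?\<alpha> k)))"
      have "countable C" unfolding C_def
        by (intro countable_UN countable_image countable_int_span countable_finite[OF finite_B_region[OF assms(1,2)]]) auto
      obtain d' where d': "d' > 0" "ball w0 d' \<subseteq> A" using AB(1,3) by (metis open_openin openE)
      have "uncountable (ball w0 d')" using d'(1) by (rule uncountable_ball)
      then have "\<not> ball w0 d' \<subseteq> C" using \<open>countable C\<close> countable_subset by blast
      then obtain w where w: "w \<in> A" "w \<notin> C" using d'(2) by blast
      have "modular_factor {..<n} (\<lambda>k. xt t (?\<alpha> k)) k (w + xt t \<delta>) \<noteq> 0" if "\<delta> \<in> B_region a v" "k < n" for \<delta> k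
      proof (rule modular_factor_nonzero[OF adm[OF t(2)]])
        show "w + xt t \<delta> \<notin> int_span {..<n} (\<lambda>k. xt t (?\<alpha> k))"
        proof
          assume "w + xt t \<delta> \<in> int_span {..<n} (\<lambda>k. xt t (?\<alpha> k))"
          then have "(w + xt t \<delta>) - xt t \<delta> \<in> C" unfolding C_def using that(1) by blast
          then show False using w(2) by simp
        qed
      qed (use that in auto)
      then have "(w, xt t) \<in> modular_domain a v"
        using adm[OF t(2)] xt by (auto simp: modular_domain_def HomC_iff)
      moreover have "(w, xt t) \<in> T" using AB(5) w(1) tB by blast
      ultimately show "\<exists>q. q \<in> modular_domain a v \<and> q \<in> T" by blast
    qed
  qed
qed

end

section \<open>Equivariance\<close>

lemma inverts_int_mat_unique:
  fixes g :: "int mat"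
  assumes "g \<in> carrier_mat n n" "h \<in> carrier_mat n n" "h' \<in> carrier_mat n n"
    "g * h = 1\<^sub>m n" "h' * g = 1\<^sub>m n"
  shows "h' = h"
proof -
  have "h = (h' * g) * h" using assms by simp
  also have "\<dots> = h' * (g * h)" using assms by (intro assoc_mult_mat)
  also have "\<dots> = h'" using assms by simp
  finally show ?thesis ..
qed

context based_lattice
begin

text \<open>For determinant 1 the adjugate is the inverse, so the inverse is again an integer
  matrix.\<close>

lemma mat_inv:
  assumes "g \<in> SL"
  shows "mat_inv g \<in> carrier_mat n n" "g * mat_inv g = 1\<^sub>m n" "mat_inv g * g = 1\<^sub>m n"
    "Determinant.det (mat_inv g) = 1"
proof -
  have g: "g \<in> carrier_mat n n" "Determinant.det g = 1" using assms by (auto simp: SL_def)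
  have "1 \<cdot>\<^sub>m 1\<^sub>m n = (1\<^sub>m n :: int mat)" by (rule eq_matI) auto
  then have adj: "adj_mat g \<in> carrier_mat n n" "g * adj_mat g = 1\<^sub>m n" "adj_mat g * g = 1\<^sub>m n"
    using adj_mat[OF g(1)] g(2) by auto
  have "mat_inv g = adj_mat g"
    unfolding mat_inv_def
  proof (rule the_equality)
    show "adj_mat g \<in> carrier_mat n n \<and> inverts_mat g (adj_mat g) \<and> inverts_mat (adj_mat g) g"
      using adj g(1) by (auto simp: inverts_mat_def)
    fix h assume "h \<in> carrier_mat n n \<and> inverts_mat g h \<and> inverts_mat h g"
    then show "h = adj_mat g"
      using inverts_int_mat_unique[OF g(1) adj(1), of h] adj(2) by (auto simp: inverts_mat_def)
  qed
  then show inv: "mat_inv g \<in> carrier_mat n n" "g * mat_inv g = 1\<^sub>m n" "mat_inv g * g = 1\<^sub>m n"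
    using adj by auto
  have "Determinant.det g * Determinant.det (mat_inv g) = Determinant.det (1\<^sub>m n :: int mat)"
    using det_mult[OF g(1) inv(1)] inv(2) by simp
  then show "Determinant.det (mat_inv g) = 1" using g(2) by simp
qed

lemma coord_act_vec: "i < n \<Longrightarrow> coord (act_vec g u) i = (\<Sum>j<n. of_int (g $$ (i, j)) * coord u j)"
  unfolding act_vec_def by (rule coord_sum_scale)

lemma act_vec_add: "act_vec g (u + v) = act_vec g u + act_vec g v"
  by (rule eq_coordI)
     (simp add: coord_act_vec lin_form_add[OF lin_form_coord] sum.distrib distrib_left)

lemma act_vec_scale: "act_vec g (scale r u) = scale r (act_vec g u)"
  by (rule eq_coordI)
     (simp add: coord_act_vec lin_form_scale[OF lin_form_coord] sum_distrib_left mult_ac)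

lemma act_vec_L: "u \<in> L \<Longrightarrow> act_vec g u \<in> L"
  by (auto simp: mem_L_iff coord_act_vec intro!: Ints_sum Ints_mult)

lemma act_vec_inverse:
  assumes "g \<in> carrier_mat n n" "h \<in> carrier_mat n n" "h * g = 1\<^sub>m n"
  shows "act_vec h (act_vec g u) = u"
proof (rule eq_coordI)
  fix i assume i: "i < n"
  have hg: "(\<Sum>k<n. h $$ (i, k) * g $$ (k, l)) = (if i = l then 1 else 0)" if l: "l < n" for l
  proof -
    have "(\<Sum>k<n. h $$ (i, k) * g $$ (k, l)) = (h * g) $$ (i, l)"
      using assms(1,2) i l by (simp add: scalar_prod_def lessThan_atLeast0)
    then show ?thesis using i l unfolding assms(3) by simp
  qed
  have "coord (act_vec h (act_vec g u)) i = (\<Sum>k<n. of_int (h $$ (i, k)) * (\<Sum>l<n. of_int (g $$ (k, l)) * coord u l))"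
    using i by (simp add: coord_act_vec)
  also have "\<dots> = (\<Sum>l<n. of_int (\<Sum>k<n. h $$ (i, k) * g $$ (k, l)) * coord u l)"
    by (simp add: sum_distrib_left sum_distrib_right mult.assoc) (rule sum.swap)
  also have "\<dots> = (\<Sum>l<n. if i = l then coord u l else 0)"
    using hg by (intro sum.cong) auto
  also have "\<dots> = coord u i" using i by simp
  finally show "coord (act_vec h (act_vec g u)) i = coord u i" .
qed

lemma act_form_eq: "lin_form x \<Longrightarrow> act_form g x = (\<lambda>u. x (act_vec (mat_inv g) u))"
proof
  fix u assume x: "lin_form x"
  have "x (act_vec (mat_inv g) u) = (\<Sum>i<n. of_rat (\<Sum>j<n. of_int (mat_inv g $$ (i, j)) * coord u j) * x (e i))"
    unfolding act_vec_def by (simp add: lin_form_sum[OF x] lin_form_scale[OF x])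
  also have "\<dots> = (\<Sum>i<n. \<Sum>j<n. x (e i) * of_int (mat_inv g $$ (i, j)) * of_rat (coord u j))"
    by (simp add: of_rat_sum of_rat_mult sum_distrib_right sum_distrib_left mult_ac)
  also have "\<dots> = act_form g x u"
    unfolding act_form_def sum_distrib_right by (rule sum.swap)
  finally show "act_form g x u = x (act_vec (mat_inv g) u)" ..
qed

text \<open>The last entry is overwritten by y. These congruences are needed because
  \<open>omit (n - 1) a\<close> and a agree only below n - 1, and linearity of the forms is known
  only below n.\<close>

lemma normal_vector_cong:
  assumes "\<And>i. i < n - 1 \<Longrightarrow> b i = b' i"
  shows "normal_vector b = normal_vector b'"
proof -
  have "det_forms (b(n - 1 := y)) = det_forms (b'(n - 1 := y))" for y
    unfolding det_forms_def using assms by (intro arg_cong[where f = Determinant.det] eq_matI) auto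
  then show ?thesis by (simp add: normal_vector_def)
qed

lemma chosen_dual_cong:
  assumes "\<And>i. i < n - 1 \<Longrightarrow> b i = b' i"
  shows "chosen_dual b = chosen_dual b'"
  unfolding chosen_dual_def pos_dual_family_def using assms by (intro arg_cong[where f = Eps] ext) auto

lemma geom_G_cong:
  assumes "\<And>i. i < n - 1 \<Longrightarrow> b i = b' i"
  shows "geom_G b = geom_G b'" "geom_G_defined b = geom_G_defined b'"
proof -
  have "G_region b = G_region b'"
    using assms by (auto simp: fun_eq_iff G_region_def chosen_dual_cong[OF assms])
  then show "geom_G b = geom_G b'" "geom_G_defined b = geom_G_defined b'"
    unfolding geom_G_def[abs_def] geom_G_defined_def[abs_def]
    by (simp_all add: normal_vector_cong[OF assms] chosen_dual_cong[OF assms])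
qed

lemma geom_B_cong:
  assumes "\<And>i. i < n \<Longrightarrow> a i = a' i"
  shows "geom_B a = geom_B a'" "geom_B_defined a = geom_B_defined a'"
proof -
  have p: "primitive_pos_dual a = primitive_pos_dual a'"
    unfolding primitive_pos_dual_def pos_dual_family_def using assms by (intro arg_cong[where f = The] ext) auto
  have "B_region a = B_region a'" using assms by (auto simp: fun_eq_iff B_region_def p)
  moreover have "det_forms a = det_forms a'"
    unfolding det_forms_def using assms by (intro arg_cong[where f = Determinant.det] eq_matI) auto
  ultimately show "geom_B a = geom_B a'" "geom_B_defined a = geom_B_defined a'"
    unfolding geom_B_def[abs_def] geom_B_defined_def[abs_def] by (simp_all add: p)
qed

end

locale lattice_action = based_lattice +
  fixes g :: "int mat" and a :: "nat \<Rightarrow> 'a \<Rightarrow> rat"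
  assumes n2: "2 \<le> n" and g: "g \<in> SL" and reg: "regular_forms a"
begin

abbreviation "T \<equiv> act_vec g"
abbreviation "T' \<equiv> act_vec (mat_inv g)"
definition "ga = (\<lambda>j u. a j (T' u))"

lemma T'_T [simp]: "T' (T u) = u"
  using g by (intro act_vec_inverse mat_inv) (auto simp: SL_def)

lemma T_T' [simp]: "T (T' u) = u"
  using g by (intro act_vec_inverse mat_inv) (auto simp: SL_def)

lemma lin_form_T': "lin_form x \<Longrightarrow> lin_form (\<lambda>u. x (T' u))"
  by (auto simp: lin_form_def act_vec_add act_vec_scale)

lemma ga_T [simp]: "ga j (T u) = a j u"
  by (simp add: ga_def)

lemma T_L_iff: "T u \<in> L \<longleftrightarrow> u \<in> L"
  using act_vec_L[of "T u" "mat_inv g"] act_vec_L[of u g] by auto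

text \<open>The matrix of the transported forms is the old one times the inverse of g, which has
  determinant 1.\<close>

lemma det_forms_ga: "det_forms ga = det_forms a"
proof -
  let ?h = "map_mat of_int (mat_inv g) :: rat mat"
  have h: "?h \<in> carrier_mat n n" using mat_inv(1)[OF g] by simp
  have "form_matrix ga = form_matrix a * ?h"
  proof (rule eq_matI)
    fix i j assume "i < dim_row (form_matrix a * ?h)" "j < dim_col (form_matrix a * ?h)"
    then have ij: "i < n" "j < n" using mat_inv(1)[OF g] by (auto simp: form_matrix_def)
    note lf = regular_forms_lin_form[OF reg ij(1)]
    have c: "coord (T' (e j)) k = of_int (mat_inv g $$ (k, j))" if "k < n" for k
    proof -
      have "coord (T' (e j)) k = (\<Sum>l<n. if l = j then of_int (mat_inv g $$ (k, l)) else 0)"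
        unfolding coord_act_vec[OF that] using ij(2) by (intro sum.cong) (auto simp: coord_e)
      then show ?thesis using ij(2) by simp
    qed
    have "ga i (e j) = (\<Sum>k<n. coord (T' (e j)) k * a i (e k))"
      unfolding ga_def using lin_form_expand[OF lf, of "T' (e j)"] by simp
    also have "\<dots> = (\<Sum>k<n. a i (e k) * of_int (mat_inv g $$ (k, j)))"
      by (intro sum.cong) (auto simp: c mult.commute)
    also have "\<dots> = (form_matrix a * ?h) $$ (i, j)"
      using ij mat_inv(1)[OF g] by (simp add: form_matrix_def scalar_prod_def lessThan_atLeast0)
    finally show "form_matrix ga $$ (i, j) = (form_matrix a * ?h) $$ (i, j)"
      using ij by (simp add: form_matrix_def)
  qed (use mat_inv(1)[OF g] in \<open>auto simp: form_matrix_def\<close>)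
  then show ?thesis
    unfolding det_forms_eq using det_mult[OF form_matrix_carrier h] of_int_hom.hom_det[of "mat_inv g"] mat_inv(4)[OF g]
    by simp
qed

lemma regular_ga: "regular_forms ga"
proof -
  have "ga j \<in> dual_lattice" if j: "j < n" for j
    unfolding dual_lattice_iff ga_def
    using reg j act_vec_L lin_form_T'[of "a j"] regular_forms_L[OF reg j] regular_forms_lin_form[OF reg j] by auto
  then show ?thesis using reg by (auto simp: regular_forms_def det_forms_ga)
qed

lemma primitive_T: "primitive_L u \<Longrightarrow> primitive_L (T u)"
  unfolding primitive_L_iff
proof (elim conjE, intro conjI allI ballI impI)
  assume u: "u \<in> L" "\<forall>(k::int). \<forall>u'\<in>L. u = scale (of_int k) u' \<longrightarrow> \<bar>k\<bar> = 1"
  then show "T u \<in> L" by (simp add: T_L_iff)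
  fix k :: int and u' assume u': "u' \<in> L" "T u = scale (of_int k) u'"
  have "u = T' (T u)" by simp
  also have "\<dots> = scale (of_int k) (T' u')" unfolding u'(2) by (rule act_vec_scale)
  finally show "\<bar>k\<bar> = 1" using u(2) act_vec_L[OF u'(1)] by blast
qed

lemma primitive_pos_dual_ga: "primitive_pos_dual ga = restrict (T \<circ> primitive_pos_dual a) {..<n}"
proof (rule primitive_pos_dual_spec(3)[OF regular_ga])
  show "pos_dual_family n ga (restrict (T \<circ> primitive_pos_dual a) {..<n})"
    using primitive_pos_dual[OF reg] by (auto simp: pos_dual_family_def T_L_iff)
  show "primitive_L (restrict (T \<circ> primitive_pos_dual a) {..<n} j)" if "j < n" for j
    using primitive_T[OF primitive_pos_dual(4)[OF reg that]] that by simp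
qed

lemma normal_vector_ga:
  assumes "j < n"
  shows "normal_vector (omit j ga) = T (normal_vector (omit j a))"
  unfolding normal_vector_omit[OF regular_ga assms] normal_vector_omit[OF reg assms] omit_sign_def det_forms_ga
  using assms by (simp add: primitive_pos_dual_ga act_vec_scale)

lemma V_mod_L_T: "v \<in> V_mod_L \<Longrightarrow> T ` v \<in> V_mod_L"
proof -
  assume "v \<in> V_mod_L"
  then obtain u where v: "v = (+) u ` L" by (auto simp: V_mod_L_def)
  have "T ` L = L"
  proof
    show "T ` L \<subseteq> L" using act_vec_L by auto
    show "L \<subseteq> T ` L"
    proof
      fix u assume "u \<in> L"
      then show "u \<in> T ` L" by (intro image_eqI[of _ _ "T' u"] act_vec_L) auto
    qed
  qed
  then have "T ` v = (+) (T u) ` L" unfolding v image_image act_vec_add by (metis image_image)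
  then show ?thesis by (auto simp: V_mod_L_def)
qed

lemma B_region_ga: "B_region ga (T ` v) = T ` B_region a v"
  by (auto simp: B_region_def primitive_pos_dual_ga)

lemma geom_B_ga:
  shows "geom_B_defined ga (\<lambda>u. x (T' u)) \<longleftrightarrow> geom_B_defined a x"
    and "geom_B ga (T ` v) w (\<lambda>u. x (T' u)) = geom_B a v w x"
proof -
  show "geom_B_defined ga (\<lambda>u. x (T' u)) \<longleftrightarrow> geom_B_defined a x"
    by (simp add: geom_B_defined_def primitive_pos_dual_ga)
  have inj: "inj_on T A" for A by (rule inj_on_inverseI[of _ T']) simp
  have "geom_B_sign ga = geom_B_sign a" by (simp add: geom_B_sign_def det_forms_ga)
  moreover have "gen_B {..<n} (\<lambda>k. x (T' (primitive_pos_dual ga k))) z = gen_B {..<n} (\<lambda>k. x (primitive_pos_dual a k)) z" for z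
    by (rule gen_B_cong) (simp add: primitive_pos_dual_ga)
  ultimately show "geom_B ga (T ` v) w (\<lambda>u. x (T' u)) = geom_B a v w x"
    unfolding geom_B_eq[OF reg] geom_B_eq[OF regular_ga] B_region_ga sum.reindex[OF inj] by simp
qed

text \<open>The family that \<open>SOME\<close> chooses for the transported forms need not be the
  image of the one chosen for a. By independence it may be replaced by that image, after which all
  data correspond under T.\<close>

lemma geom_G_ga:
  assumes j: "j < n" and x: "lin_form x" and v: "v \<in> V_mod_L"
  shows "geom_G_defined (omit j ga) (\<lambda>u. x (T' u)) \<longleftrightarrow> geom_G_defined (omit j a) x"
    and "geom_G_defined (omit j a) x \<Longrightarrow>
      geom_G (omit j ga) (T ` v) w (\<lambda>u. x (T' u)) = geom_G (omit j a) v w x"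
proof -
  interpret A: omitted_forms scale n e a j by unfold_locales (use n2 reg j in auto)
  interpret B: omitted_forms scale n e ga j by unfold_locales (use n2 regular_ga j in auto)
  define \<beta> where "\<beta> = chosen_dual (omit j a)"
  have \<beta>: "is_dual (omit j a) \<beta>" unfolding \<beta>_def by (rule A.chosen_dual_is_dual)
  have omT: "omit j ga i (T u) = omit j a i u" for i u by (simp add: omit_def)
  have T\<beta>: "is_dual (omit j ga) (\<lambda>i. T (\<beta> i))"
    using \<beta> by (simp add: is_dual_def omT T_L_iff)
  have x': "lin_form (\<lambda>u. x (T' u))" using x by (rule lin_form_T')
  have nr: "dual_nonreal (normal_vector (omit j ga)) (\<lambda>i. T (\<beta> i)) (\<lambda>u. x (T' u)) \<longleftrightarrow>
      dual_nonreal (normal_vector (omit j a)) \<beta> x"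
    by (simp add: dual_nonreal_def normal_vector_ga[OF j])
  show "geom_G_defined (omit j ga) (\<lambda>u. x (T' u)) \<longleftrightarrow> geom_G_defined (omit j a) x"
    unfolding A.geom_G_defined_dual[OF \<beta> x v] B.geom_G_defined_dual[OF T\<beta> x' V_mod_L_T[OF v]] nr ..
  assume "geom_G_defined (omit j a) x"
  then have nrA: "dual_nonreal (normal_vector (omit j a)) \<beta> x"
    unfolding A.geom_G_defined_dual[OF \<beta> x v] .
  then have nrB: "dual_nonreal (normal_vector (omit j ga)) (\<lambda>i. T (\<beta> i)) (\<lambda>u. x (T' u))" using nr by simp
  let ?S = "{\<delta> \<in> dual_region (omit j a) \<beta> v. 0 \<le> a j \<delta> \<and> a j \<delta> < a j (primitive_pos_dual a j)}"
  have tr: "transversal ?S id (dual_region (omit j a) \<beta> v) (normal_vector (omit j a))"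
    by (rule A.transversal_box[OF v])
  have R: "dual_region (omit j ga) (\<lambda>i. T (\<beta> i)) (T ` v) = T ` dual_region (omit j a) \<beta> v"
    by (auto simp: dual_region_def omT)
  have inj: "T u = T u' \<longleftrightarrow> u = u'" for u u' by (metis T'_T)
  have tr': "transversal ?S T (dual_region (omit j ga) (\<lambda>i. T (\<beta> i)) (T ` v)) (normal_vector (omit j ga))"
    using tr unfolding transversal_def R normal_vector_ga[OF j] ball_simps act_vec_scale[symmetric] act_vec_add[symmetric] inj
    by (auto simp: image_subset_iff)
  have "geom_G (omit j ga) (T ` v) w (\<lambda>u. x (T' u))
      = (\<Prod>\<delta>\<in>?S. dual_factor (normal_vector (omit j ga)) (\<lambda>i. T (\<beta> i)) w (\<lambda>u. x (T' u)) (T \<delta>))"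
    unfolding B.geom_G_dual[OF T\<beta> x' V_mod_L_T[OF v] nrB] by (rule B.dual_prod_transversal[OF x' nrB tr'])
  also have "\<dots> = (\<Prod>\<delta>\<in>?S. dual_factor (normal_vector (omit j a)) \<beta> w x \<delta>)"
    by (simp add: dual_factor_def normal_vector_ga[OF j])
  also have "\<dots> = geom_G (omit j a) v w x"
    unfolding A.geom_G_dual[OF \<beta> x v nrA] using A.dual_prod_transversal[OF x nrA tr] by simp
  finally show "geom_G (omit j ga) (T ` v) w (\<lambda>u. x (T' u)) = geom_G (omit j a) v w x" .
qed

end

context based_lattice
begin

text \<open>\<open>geom_G\<close> reads only the first n - 1 forms, so a is replaced by
  \<open>omit (n - 1) a\<close> and the results for omitted forms apply with j = n - 1.\<close>

lemma equivariance:
  assumes "n \<ge> 2" "regular_forms a" "g \<in> SL" "v \<in> V_mod_L" "lin_form x"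
  defines "ga \<equiv> \<lambda>j. act_form g (a j)"
  shows "geom_G_defined ga (act_form g x) \<longleftrightarrow> geom_G_defined a x"
    "geom_G_defined a x \<Longrightarrow> geom_G ga (act_coset g v) w (act_form g x) = geom_G a v w x"
    "geom_B_defined ga (act_form g x) \<longleftrightarrow> geom_B_defined a x"
    "geom_B ga (act_coset g v) w (act_form g x) = geom_B a v w x"
proof -
  interpret A: lattice_action scale n e g a by unfold_locales (use assms in auto)
  have n: "n - 1 < n" using assms(1) by simp
  have ga: "ga j = A.ga j" if "j < n" for j
    unfolding ga_def A.ga_def using act_form_eq[OF regular_forms_lin_form[OF assms(2) that]] .
  have om: "omit (n - 1) f i = f i" if "i < n - 1" for f :: "nat \<Rightarrow> 'v \<Rightarrow> rat" and i using that by (simp add: omit_def)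
  have G: "geom_G ga = geom_G (omit (n - 1) A.ga)" "geom_G_defined ga = geom_G_defined (omit (n - 1) A.ga)"
    using ga om by (auto intro!: geom_G_cong)
  have G': "geom_G a = geom_G (omit (n - 1) a)" "geom_G_defined a = geom_G_defined (omit (n - 1) a)"
    using om by (auto intro!: geom_G_cong)
  have B: "geom_B ga = geom_B A.ga" "geom_B_defined ga = geom_B_defined A.ga"
    using ga by (auto intro!: geom_B_cong)
  show "geom_G_defined ga (act_form g x) \<longleftrightarrow> geom_G_defined a x"
    unfolding G G' act_form_eq[OF assms(5)] by (rule A.geom_G_ga(1)[OF n assms(5,4)])
  show "geom_G ga (act_coset g v) w (act_form g x) = geom_G a v w x" if "geom_G_defined a x"
    using that unfolding G G' act_form_eq[OF assms(5)] act_coset_def by (rule A.geom_G_ga(2)[OF n assms(5,4)])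
  show "geom_B_defined ga (act_form g x) \<longleftrightarrow> geom_B_defined a x"
    unfolding B act_form_eq[OF assms(5)] by (rule A.geom_B_ga(1))
  show "geom_B ga (act_coset g v) w (act_form g x) = geom_B a v w x"
    unfolding B act_form_eq[OF assms(5)] act_coset_def by (rule A.geom_B_ga(2))
qed

end

theorem theorem1:
  fixes scale :: "rat \<Rightarrow> 'v::ab_group_add \<Rightarrow> 'v" and n :: nat and e :: "nat \<Rightarrow> 'v"
    and a :: "nat \<Rightarrow> 'v \<Rightarrow> rat" and v :: "'v set"
  assumes "n \<ge> 2"
    and "based_lattice scale n e"
    and "\<And>j. j < n \<Longrightarrow> based_lattice.primitive_dual scale n e (a j)"
    and "based_lattice.lin_indep_forms scale n e n a"
    and "v \<in> based_lattice.V_mod_L scale n e"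
  shows
    "(\<exists>U. openin (prod_topology euclidean (based_lattice.HomC_topology scale n e)) U \<and>
          (prod_topology euclidean (based_lattice.HomC_topology scale n e)) closure_of U
            = (UNIV :: complex set) \<times> based_lattice.HomC scale \<and>
          (\<forall>(w, x) \<in> U.
             (\<forall>j<n. based_lattice.geom_G_defined scale n e (omit j a) x) \<and>
             based_lattice.geom_B_defined scale n e a x \<and>
             (\<Prod>j<n. based_lattice.geom_G scale n e (omit j a) v w x powi ((-1) ^ j))
               = exp (2 * \<i> * of_real pi * based_lattice.geom_B scale n e a v w x)))
     \<and>
     (\<forall>g \<in> based_lattice.SL n. \<forall>u \<in> based_lattice.V_mod_L scale n e.
        \<forall>w :: complex. \<forall>x \<in> based_lattice.HomC scale.
        (let ga = (\<lambda>j. based_lattice.act_form scale n e g (a j));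
             gu = based_lattice.act_coset scale n e g u;
             gx = based_lattice.act_form scale n e g x
         in
          (based_lattice.geom_G_defined scale n e ga gx
             \<longleftrightarrow> based_lattice.geom_G_defined scale n e a x) \<and>
          (based_lattice.geom_G_defined scale n e a x \<longrightarrow>
             based_lattice.geom_G scale n e ga gu w gx = based_lattice.geom_G scale n e a u w x) \<and>
          (based_lattice.geom_B_defined scale n e ga gx
             \<longleftrightarrow> based_lattice.geom_B_defined scale n e a x) \<and>
          (based_lattice.geom_B_defined scale n e a x \<longrightarrow>
             based_lattice.geom_B scale n e ga gu w gx = based_lattice.geom_B scale n e a u w x)))"
proof -
  interpret based_lattice scale n e by fact
  have reg: "regular_forms a"
    unfolding regular_forms_def using assms(3,4) det_forms_nonzero[of a]
    by (auto simp: primitive_dual_def primitive_in_def)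
  have "\<exists>U. openin WX U \<and> WX closure_of U = UNIV \<times> HomC \<and>
      (\<forall>(w, x) \<in> U. (\<forall>j<n. geom_G_defined (omit j a) x) \<and> geom_B_defined a x \<and>
        (\<Prod>j<n. geom_G (omit j a) v w x powi ((-1) ^ j)) = exp (2 * \<i> * of_real pi * geom_B a v w x))"
  proof (intro exI conjI)
    show "openin WX (modular_domain a v)" by (rule openin_modular_domain[OF reg assms(5)])
    show "WX closure_of modular_domain a v = UNIV \<times> HomC"
      by (rule closure_of_modular_domain[OF reg assms(5,1)])
    show "\<forall>(w, x) \<in> modular_domain a v. (\<forall>j<n. geom_G_defined (omit j a) x) \<and> geom_B_defined a x \<and>
        (\<Prod>j<n. geom_G (omit j a) v w x powi ((-1) ^ j)) = exp (2 * \<i> * of_real pi * geom_B a v w x)"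
    proof clarify
      fix w x assume "(w, x) \<in> modular_domain a v"
      then have x: "lin_form x" "adm {..<n} (\<lambda>k. x (primitive_pos_dual a k))"
        "\<And>\<delta> k. \<delta> \<in> B_region a v \<Longrightarrow> k < n \<Longrightarrow>
          modular_factor {..<n} (\<lambda>k. x (primitive_pos_dual a k)) k (w + x \<delta>) \<noteq> 0"
        by (auto simp: modular_domain_def HomC_iff)
      show "(\<forall>j<n. geom_G_defined (omit j a) x) \<and> geom_B_defined a x \<and>
        (\<Prod>j<n. geom_G (omit j a) v w x powi ((-1) ^ j)) = exp (2 * \<i> * of_real pi * geom_B a v w x)"
        using geom_modular[OF assms(1) reg assms(5) x] by blast
    qed
  qed
  moreover have "\<forall>g \<in> SL. \<forall>u \<in> V_mod_L. \<forall>w. \<forall>x \<in> HomC.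
      (let ga = (\<lambda>j. act_form g (a j)); gu = act_coset g u; gx = act_form g x in
        (geom_G_defined ga gx \<longleftrightarrow> geom_G_defined a x) \<and>
        (geom_G_defined a x \<longrightarrow> geom_G ga gu w gx = geom_G a u w x) \<and>
        (geom_B_defined ga gx \<longleftrightarrow> geom_B_defined a x) \<and>
        (geom_B_defined a x \<longrightarrow> geom_B ga gu w gx = geom_B a u w x))"
    unfolding Let_def
  proof (intro ballI allI)
    fix g u w and x :: "'v \<Rightarrow> complex" assume g: "g \<in> SL" "u \<in> V_mod_L" and "x \<in> HomC"
    then have "lin_form x" by (simp add: HomC_iff)
    note equivariance[OF assms(1) reg g this]
    then show "(geom_G_defined (\<lambda>j. act_form g (a j)) (act_form g x) \<longleftrightarrow> geom_G_defined a x) \<and>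
        (geom_G_defined a x \<longrightarrow> geom_G (\<lambda>j. act_form g (a j)) (act_coset g u) w (act_form g x) = geom_G a u w x) \<and>
        (geom_B_defined (\<lambda>j. act_form g (a j)) (act_form g x) \<longleftrightarrow> geom_B_defined a x) \<and>
        (geom_B_defined a x \<longrightarrow> geom_B (\<lambda>j. act_form g (a j)) (act_coset g u) w (act_form g x) = geom_B a u w x)"
      by blast
  qed
  ultimately show ?thesis by (rule conjI)
qed

end
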